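(* Let $\bar\kappa$ be a Markov kernel on $\Omega=[0,1]$ (the kernel of the original MC) with stationary distribution $p\in\mathbf{D}$, satisfying Uniformly Bounded Variation, C\`adl\`ag and Countable Jump Discontinuities, and Unique Stationary Distribution. Let a sequence, indexed by $r\in\mathbb{N}$, of finite-state Markov chains with states $0=c^{(r)}_1<\dots<c^{(r)}_{J^{(r)}}=1$, transition matrices $Q^{(r)}=\{q^{(r)}_{ij}\}$ and stationary distributions (distribution functions) $p^{(r)}\in\mathbf{D}$ satisfy Proper Truncation with respect to $\bar\kappa$. Then there exists $r_0\in\mathbb{N}$ such that for all $r>r_0$ the stationary distribution $p^{(r)}$ is unique, and the error bound $$\|p-p^{(r)}\|_\infty\le\|(\mathcal{I}-\mathcal{K}^{(r)})^{-1}\|_O\cdot\|\mathcal{K}p-\mathcal{K}^{(r)}p\|_\infty$$ holds (in particular the inverse exists); moreover the right-hand side of this bound converges to $0$, i.e. $p^{(r)}\to p$ uniformly, as $r\to\infty$.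
   Context: Spaces. $\Omega=[0,1]$, $\mathcal{B}$ its Borel $\sigma$-algebra. $\mathbf{D}$ is the set of (right-continuous) distribution functions of probability measures on $(\Omega,\mathcal{B})$, viewed as functions on $\mathbb{R}$ that vanish for $x<0$ and are constant on $[1,\infty)$. $\mathbf{X}=\mathrm{span}(\mathbf{D})$ (distribution functions of finite signed measures on $\Omega$), and $\bar{\mathbf{X}}$ is its closure under the supremum norm $\|\cdot\|_\infty$, a Banach space. $\|\mathcal{L}\|_O$ is the operator norm on $\bar{\mathbf{X}}$, $\mathcal{I}$ the identity. For $f\in\mathbf{X}$, $\int_\Omega g\,df$ is the integral against the signed measure with distribution function $f$ (including a possible atom at $0$). Kernels and operators. A finite kernel is $\tau:\Omega^2\to\mathbb{R}_+$ with $\tau(x,\cdot)$ $\mathcal{B}$-measurable for each $x$, and for each $u$ either $\tau(\cdot,u)=0$ or $\alpha\tau(\cdot,u)\in\mathbf{D}$ for some $\alpha>0$; it is a Markov kernel if $\tau(\cdot,u)\in\mathbf{D}$ for all $u$. The operator $\mathcal{L}$ on $\bar{\mathbf{X}}$ associated with $\tau$ is $\mathcal{L}f(x)=\int_\Omega\tau(x,u)\,df(u)$ for $f\in\mathbf{X}$, and $\mathcal{L}f(x)=\lim_k\mathcal{L}f_k(x)$ for $f\in\bar{\mathbf{X}}\setminus\mathbf{X}$, where $(f_k)\subseteq\mathbf{X}$ is any sequence converging to $f$ in $\|\cdot\|_\infty$ (well defined when $\sup_xV_u(\tau(x,u))<\infty$); one also writes $\int_\Omega\tau(x,u)\,df(u)$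 for $\mathcal{L}f(x)$ in the second case. $V_u(\cdot)$ denotes total variation over $\Omega$ in the variable $u$. A stationary distribution of a Markov kernel $\bar\kappa$ is $p\in\mathbf{D}$ with $p(x)=\int_\Omega\bar\kappa(x,u)\,dp(u)$ for all $x\in\Omega$. Put $c^{(r)}_0:=-\infty$, $c^{(r)}_{J^{(r)}+1}:=+\infty$, $\bar\kappa(-\infty,u):=0$, $\bar\omega^{(r)}_i(x):=\sum_{j=1}^{J^{(r)}}\mathbf{1}\{c^{(r)}_j\le x\}q^{(r)}_{ij}$ and $\bar\kappa^{(r)}(x,u):=\sum_{i=1}^{J^{(r)}}\bar\omega^{(r)}_i(x)\mathbf{1}\{u\in(c^{(r)}_{i-1},c^{(r)}_i]\}$. $\mathcal{K}$ and $\mathcal{K}^{(r)}$ are the operators associated with the kernels $\kappa(x,u):=\mathbf{1}\{x\ge0\}+\bar\kappa(x,u)$ and $\kappa^{(r)}(x,u):=\sum_{i=1}^{J^{(r)}}[\mathbf{1}\{x\ge0\}+\bar\omega^{(r)}_i(x)]\mathbf{1}\{u\in(c^{(r)}_{i-1},c^{(r)}_i]\}$. Let $\zeta_\tau(x_1,x_2):=|\tau(x_2,1)-\tau(x_1,1)|$ and $v_\tau(x_1,x_2):=V_u(\tau(x_2,u)-\tau(x_1,u))$. Conditions. Uniformly Bounded Variation: $\sup_{x\in\Omega}V_u(\bar\kappa(x,u))<\infty$. C\`adl\`ag and Countable Jump Discontinuities: for every $\epsilon>0$ there are knots $0=s_1<\dots<s_{N_\epsilon}=1$ such that, with $E_i=[s_i,s_{i+1})$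 for $i<N_\epsilon$ and $E_{N_\epsilon}=\{1\}$, one has $\zeta_{\bar\kappa}(x_1,x_2)<\epsilon$ and $v_{\bar\kappa}(x_1,x_2)<\epsilon$ for all $x_1,x_2\in E_i$ and all $i$. Unique Stationary Distribution: the stationary distribution $p$ of $\bar\kappa$ is unique and the set of solutions $f\in\bar{\mathbf{X}}$ of $f(x)=\int_\Omega\bar\kappa(x,u)\,df(u)$ ($x\in\Omega$) is $\{\alpha p\}_{\alpha\in\mathbb{R}}$. Proper Truncation: (i) there are $\epsilon^{(r)}\in\mathbb{R}_+$ with $\lim_{r\to\infty}\epsilon^{(r)}=0$ such that for all $r$, all $i=1,\dots,J^{(r)}$ and all $x_1,x_2\in[c^{(r)}_i,c^{(r)}_{i+1})\cap\Omega$, $\zeta_{\bar\kappa}(x_1,x_2)<\epsilon^{(r)}$ and $v_{\bar\kappa}(x_1,x_2)<\epsilon^{(r)}$; (ii) $\{c^{(r_1)}_i\}_{i}\subseteq\{c^{(r_2)}_i\}_{i}$ for all $r_1<r_2$; (iii) $q^{(r)}_{ij}=\bar\kappa(c^{(r)}_j,c^{(r)}_i)-\bar\kappa(c^{(r)}_{j-1},c^{(r)}_i)$ for all $i,j=1,\dots,J^{(r)}$, $r\in\mathbb{N}$; (iv) $\lim_{r\to\infty}\bar\kappa^{(r)}(x,u)=\bar\kappa(x,u)$ for all $x,u\in\Omega$. *)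

theory Defs
  imports "HOL-Probability.Probability"
begin

section \<open>Distribution functions on the unit interval\<close>

text \<open>
  All functions of the state variable are total functions on the real line. Measures on
  \<open>[0,1]\<close> are represented as Borel measures on the real line that are concentrated on \<open>{0..1}\<close>,
  so that their distribution functions (\<open>cdf\<close>) vanish on the negative half-line and are constant
  on \<open>{1..}\<close>.
\<close>

definition unit_measure :: "real measure \<Rightarrow> bool" where
  "unit_measure M \<longleftrightarrow> finite_borel_measure M \<and> emeasure M (UNIV - {0..1}) = 0"

definition dist_funs :: "(real \<Rightarrow> real) set" where
  "dist_funs = {cdf M |M. unit_measure M \<and> prob_space M}"

definition dist_span :: "(real \<Rightarrow> real) set" where
  "dist_span = {(\<lambda>x. \<Sum>i<n. a i * F i x) |(n::nat) a F. \<forall>i<n. F i \<in> dist_funs}"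

definition dist_space :: "(real \<Rightarrow> real) set" where
  "dist_space = {f. \<exists>fs. (\<forall>k. fs k \<in> dist_span) \<and> uniform_limit UNIV fs f sequentially}"

text \<open>The supremum is taken in the reals, so these two notions are meaningful for bounded functions
  and for bounded operators only.\<close>

definition supnorm :: "(real \<Rightarrow> real) \<Rightarrow> real" where
  "supnorm f = (SUP x. \<bar>f x\<bar>)"

definition opnorm :: "((real \<Rightarrow> real) \<Rightarrow> (real \<Rightarrow> real)) \<Rightarrow> real" where
  "opnorm A = (SUP f\<in>{f \<in> dist_space. supnorm f \<le> 1}. supnorm (A f))"

definition bounded_on_dist_space :: "((real \<Rightarrow> real) \<Rightarrow> (real \<Rightarrow> real)) \<Rightarrow> bool" where
  "bounded_on_dist_space A \<longleftrightarrow> (\<exists>B. \<forall>f\<in>dist_space. supnorm (A f) \<le> B * supnorm f)"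

text \<open>
  The integral over \<open>{0..1}\<close> against the signed measure with distribution function \<open>f\<close>, which is
  written as a difference of two finite measures. For bounded measurable \<open>g\<close> the value does not
  depend on the choice of this decomposition. An atom at \<open>0\<close> contributes.
\<close>

definition unit_integral :: "(real \<Rightarrow> real) \<Rightarrow> (real \<Rightarrow> real) \<Rightarrow> real" where
  "unit_integral g f = (THE I. \<exists>M N. unit_measure M \<and> unit_measure N \<and>
     f = (\<lambda>x. cdf M x - cdf N x) \<and>
     I = set_lebesgue_integral M {0..1} g - set_lebesgue_integral N {0..1} g)"

text \<open>Total variation over \<open>{0..1}\<close>, possibly infinite.\<close>

definition variation :: "(real \<Rightarrow> real) \<Rightarrow> ereal" where
  "variation g = Sup {ereal (\<Sum>i<n. \<bar>g (t (Suc i)) - g (t i)\<bar>) |(n::nat) t.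
     mono_on {..n} t \<and> t ` {..n} \<subseteq> {0..1}}"


section \<open>Kernels and operators\<close>

text \<open>In \<open>\<tau> x u\<close> the second argument is the current state; only \<open>u \<in> {0..1}\<close> is relevant.\<close>

definition finite_kernel :: "(real \<Rightarrow> real \<Rightarrow> real) \<Rightarrow> bool" where
  "finite_kernel \<tau> \<longleftrightarrow>
     (\<forall>x\<in>{0..1}. \<forall>u\<in>{0..1}. 0 \<le> \<tau> x u) \<and>
     (\<forall>x\<in>{0..1}. \<tau> x \<in> borel_measurable (restrict_space borel {0..1})) \<and>
     (\<forall>u\<in>{0..1}. (\<forall>x. \<tau> x u = 0) \<or> (\<exists>\<alpha>>0. (\<lambda>x. \<alpha> * \<tau> x u) \<in> dist_funs))"

definition markov_kernel :: "(real \<Rightarrow> real \<Rightarrow> real) \<Rightarrow> bool" where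
  "markov_kernel \<tau> \<longleftrightarrow> finite_kernel \<tau> \<and> (\<forall>u\<in>{0..1}. (\<lambda>x. \<tau> x u) \<in> dist_funs)"

definition kernel_op :: "(real \<Rightarrow> real \<Rightarrow> real) \<Rightarrow> (real \<Rightarrow> real) \<Rightarrow> (real \<Rightarrow> real)" where
  "kernel_op \<tau> f = (\<lambda>x.
     if f \<in> dist_span then unit_integral (\<tau> x) f
     else THE l. \<forall>fs. (\<forall>k. fs k \<in> dist_span) \<and> uniform_limit UNIV fs f sequentially \<longrightarrow>
            (\<lambda>k. unit_integral (\<tau> x) (fs k)) \<longlonglongrightarrow> l)"

definition id_minus :: "((real \<Rightarrow> real) \<Rightarrow> (real \<Rightarrow> real)) \<Rightarrow> (real \<Rightarrow> real) \<Rightarrow> (real \<Rightarrow> real)" where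
  "id_minus A f = (\<lambda>x. f x - A f x)"

definition stationary_dist :: "(real \<Rightarrow> real \<Rightarrow> real) \<Rightarrow> (real \<Rightarrow> real) \<Rightarrow> bool" where
  "stationary_dist \<kappa> p \<longleftrightarrow> p \<in> dist_funs \<and> (\<forall>x\<in>{0..1}. p x = unit_integral (\<kappa> x) p)"

definition shifted_kernel :: "(real \<Rightarrow> real \<Rightarrow> real) \<Rightarrow> real \<Rightarrow> real \<Rightarrow> real" where
  "shifted_kernel \<kappa> x u = of_bool (x \<ge> 0) + \<kappa> x u"


section \<open>Finite chains\<close>

text \<open>The states are \<open>c 1 < \<dots> < c J\<close>; the transition matrix is \<open>q i j\<close> with \<open>1 \<le> i, j \<le> J\<close>.
  Values at other indices are irrelevant.\<close>

definition finite_chain :: "nat \<Rightarrow> (nat \<Rightarrow> real) \<Rightarrow> (nat \<Rightarrow> nat \<Rightarrow> real) \<Rightarrow> bool" where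
  "finite_chain J c q \<longleftrightarrow>
     1 \<le> J \<and> c 1 = 0 \<and> c J = 1 \<and> strict_mono_on {1..J} c \<and>
     (\<forall>i\<in>{1..J}. \<forall>j\<in>{1..J}. 0 \<le> q i j) \<and> (\<forall>i\<in>{1..J}. (\<Sum>j=1..J. q i j) = 1)"

definition chain_stationary_dist ::
    "nat \<Rightarrow> (nat \<Rightarrow> real) \<Rightarrow> (nat \<Rightarrow> nat \<Rightarrow> real) \<Rightarrow> (real \<Rightarrow> real) \<Rightarrow> bool" where
  "chain_stationary_dist J c q p \<longleftrightarrow> (\<exists>\<pi> :: nat \<Rightarrow> real.
     (\<forall>j\<in>{1..J}. 0 \<le> \<pi> j) \<and> (\<Sum>j=1..J. \<pi> j) = 1 \<and>
     (\<forall>j\<in>{1..J}. (\<Sum>i=1..J. \<pi> i * q i j) = \<pi> j) \<and>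
     p = (\<lambda>x. \<Sum>j=1..J. of_bool (c j \<le> x) * \<pi> j))"

definition ext_state :: "nat \<Rightarrow> (nat \<Rightarrow> real) \<Rightarrow> nat \<Rightarrow> ereal" where
  "ext_state J c i = (if i = 0 then -\<infinity> else if i = J + 1 then \<infinity> else ereal (c i))"

definition ext_kernel :: "(real \<Rightarrow> real \<Rightarrow> real) \<Rightarrow> ereal \<Rightarrow> real \<Rightarrow> real" where
  "ext_kernel \<kappa> x u = (if x = -\<infinity> then 0 else \<kappa> (real_of_ereal x) u)"

definition row_dist :: "nat \<Rightarrow> (nat \<Rightarrow> real) \<Rightarrow> (nat \<Rightarrow> nat \<Rightarrow> real) \<Rightarrow> nat \<Rightarrow> real \<Rightarrow> real" where
  "row_dist J c q i x = (\<Sum>j=1..J. of_bool (c j \<le> x) * q i j)"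

definition chain_kernel ::
    "nat \<Rightarrow> (nat \<Rightarrow> real) \<Rightarrow> (nat \<Rightarrow> nat \<Rightarrow> real) \<Rightarrow> real \<Rightarrow> real \<Rightarrow> real" where
  "chain_kernel J c q x u = (\<Sum>i=1..J. row_dist J c q i x *
     of_bool (ereal u \<in> {ext_state J c (i - 1)<..ext_state J c i}))"

definition shifted_chain_kernel ::
    "nat \<Rightarrow> (nat \<Rightarrow> real) \<Rightarrow> (nat \<Rightarrow> nat \<Rightarrow> real) \<Rightarrow> real \<Rightarrow> real \<Rightarrow> real" where
  "shifted_chain_kernel J c q x u = (\<Sum>i=1..J. (of_bool (x \<ge> 0) + row_dist J c q i x) *
     of_bool (ereal u \<in> {ext_state J c (i - 1)<..ext_state J c i}))"


section \<open>Conditions\<close>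

definition kernel_zeta :: "(real \<Rightarrow> real \<Rightarrow> real) \<Rightarrow> real \<Rightarrow> real \<Rightarrow> real" where
  "kernel_zeta \<tau> x1 x2 = \<bar>\<tau> x2 1 - \<tau> x1 1\<bar>"

definition kernel_var :: "(real \<Rightarrow> real \<Rightarrow> real) \<Rightarrow> real \<Rightarrow> real \<Rightarrow> ereal" where
  "kernel_var \<tau> x1 x2 = variation (\<lambda>u. \<tau> x2 u - \<tau> x1 u)"

definition uniformly_bounded_variation :: "(real \<Rightarrow> real \<Rightarrow> real) \<Rightarrow> bool" where
  "uniformly_bounded_variation \<kappa> \<longleftrightarrow> (SUP x\<in>{0..1}. variation (\<kappa> x)) < \<infinity>"

definition cadlag_countable_jumps :: "(real \<Rightarrow> real \<Rightarrow> real) \<Rightarrow> bool" where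
  "cadlag_countable_jumps \<kappa> \<longleftrightarrow> (\<forall>\<epsilon>>0. \<exists>(N::nat) s.
     1 \<le> N \<and> s 1 = 0 \<and> s N = 1 \<and> strict_mono_on {1..N} s \<and>
     (\<forall>i\<in>{1..N}. let E = (if i < N then {s i..<s (i + 1)} else {1}) in
        \<forall>x1\<in>E. \<forall>x2\<in>E. kernel_zeta \<kappa> x1 x2 < \<epsilon> \<and> kernel_var \<kappa> x1 x2 < ereal \<epsilon>))"

definition unique_stationary_dist :: "(real \<Rightarrow> real \<Rightarrow> real) \<Rightarrow> (real \<Rightarrow> real) \<Rightarrow> bool" where
  "unique_stationary_dist \<kappa> p \<longleftrightarrow>
     (\<forall>f. stationary_dist \<kappa> f \<longleftrightarrow> f = p) \<and>
     {f \<in> dist_space. \<forall>x\<in>{0..1}. f x = kernel_op \<kappa> f x} = {(\<lambda>x. \<alpha> * p x) |\<alpha>. True}"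

definition proper_truncation ::
    "(real \<Rightarrow> real \<Rightarrow> real) \<Rightarrow> (nat \<Rightarrow> nat) \<Rightarrow> (nat \<Rightarrow> nat \<Rightarrow> real) \<Rightarrow> (nat \<Rightarrow> nat \<Rightarrow> nat \<Rightarrow> real) \<Rightarrow> bool"
  where
  "proper_truncation \<kappa> J c q \<longleftrightarrow>
     (\<exists>\<epsilon>. (\<forall>r. 0 \<le> \<epsilon> r) \<and> \<epsilon> \<longlonglongrightarrow> 0 \<and>
        (\<forall>r. \<forall>i\<in>{1..J r}. \<forall>x1\<in>{0..1}. \<forall>x2\<in>{0..1}.
           ereal x1 \<in> {ext_state (J r) (c r) i..<ext_state (J r) (c r) (i + 1)} \<and>
           ereal x2 \<in> {ext_state (J r) (c r) i..<ext_state (J r) (c r) (i + 1)} \<longrightarrow>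
           kernel_zeta \<kappa> x1 x2 < \<epsilon> r \<and> kernel_var \<kappa> x1 x2 < ereal (\<epsilon> r))) \<and>
     (\<forall>r1 r2. r1 < r2 \<longrightarrow> c r1 ` {1..J r1} \<subseteq> c r2 ` {1..J r2}) \<and>
     (\<forall>r. \<forall>i\<in>{1..J r}. \<forall>j\<in>{1..J r}.
        q r i j = ext_kernel \<kappa> (ext_state (J r) (c r) j) (c r i)
                - ext_kernel \<kappa> (ext_state (J r) (c r) (j - 1)) (c r i)) \<and>
     (\<forall>x\<in>{0..1}. \<forall>u\<in>{0..1}. (\<lambda>r. chain_kernel (J r) (c r) (q r) x u) \<longlonglongrightarrow> \<kappa> x u)"

end

theory Submission
  imports Defs "HOL-Complex_Analysis.Great_Picard"
begin

text \<open>
  The Jordan decomposition and a layer-cake argument bound \<open>\<integral> g df\<close> by \<open>\<bar>g 1\<bar> + 3 V(g)\<close> times the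
  supremum norm of \<open>f\<close>. This makes integrals against elements of \<open>dist_space\<close> well defined, and the
  operators \<open>K\<close> and \<open>K\<^sub>r\<close> are uniformly bounded. The chain kernel samples \<open>\<kappa>\<close> on a grid in both
  variables: sampling in the current state does not increase the variation, and the truncation
  condition makes the functions \<open>K\<^sub>r f\<close> with \<open>\<parallel>f\<parallel> \<le> 1\<close> nearly constant, uniformly in \<open>r\<close>, on the
  cells of any fixed grid that is fine enough. So the \<open>K\<^sub>r\<close> are collectively compact and converge
  strongly to \<open>K\<close>. As \<open>I - K\<close> is injective, the \<open>I - K\<^sub>r\<close> are eventually bounded below by a common
  constant; since \<open>K\<^sub>r\<close> has finite rank, they are then bijective with uniformly bounded inverses. The
  error bound follows from \<open>(I - K\<^sub>r) (p - p\<^sub>r) = K p - K\<^sub>r p\<close>.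
\<close>

section \<open>Total variation and Stieltjes integrals\<close>

text \<open>The unshifted operator fixes \<open>p\<close>, so the identity minus it is never
  injective. The shift adds the rank-one term \<open>of_bool (x \<ge> 0) * f 1\<close>, a deflation:
  a probability distribution function is stationary exactly when the shifted operator sends it to
  itself plus \<open>of_bool (x \<ge> 0)\<close>. This right-hand side is the same for \<kappa> and
  for every chain, so it cancels in the error identity.

  Two obstacles shape the rest. The closure is taken in the supremum norm of distribution functions,
  which does not control the total variation of the signed measure; so integrals have to be bounded
  by the size of the distribution function alone, and the integrand pays with its variation.
  Moreover the kernels are close only pointwise in the current state, which does not make the
  difference of the operators small in norm, so a Neumann series around the inverse for \<kappa> is
  not at hand. Compactness and a proof by contradiction, in the manner of Anselone, replace it; of
  the limit operator only the injectivity of identity minus operator enters.\<close>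

lemma variation_le_iff:
  "variation g \<le> ereal V \<longleftrightarrow> (\<forall>n t. mono_on {..n} t \<longrightarrow> t ` {..n} \<subseteq> {0..1} \<longrightarrow>
     (\<Sum>i<n. \<bar>g (t (Suc i)) - g (t i)\<bar>) \<le> V)"
proof -
  have *: "(\<forall>x\<in>{f n t |n t. P n t}. Q x) \<longleftrightarrow> (\<forall>n t. P n t \<longrightarrow> Q (f n t))"
    for f :: "nat \<Rightarrow> (nat \<Rightarrow> real) \<Rightarrow> ereal" and P Q by blast
  show ?thesis unfolding variation_def Sup_le_iff * by auto
qed

lemma variation_leD:
  assumes "variation g \<le> ereal V" "mono_on {..n} t" "\<And>i. i \<le> n \<Longrightarrow> 0 \<le> t i \<and> t i \<le> 1"
  shows "(\<Sum>i<n. \<bar>g (t (Suc i)) - g (t i)\<bar>) \<le> V"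
proof -
  have "t ` {..n} \<subseteq> {0..1}" using assms(3) by auto
  then show ?thesis using assms(1,2) unfolding variation_le_iff by blast
qed

lemma variation_nonneg: "variation g \<ge> 0"
proof -
  have "ereal (\<Sum>i<0. \<bar>g 0 - g 0\<bar>) \<le> variation g"
    unfolding variation_def
    by (rule Sup_upper) (auto intro!: exI[of _ 0] exI[of _ "\<lambda>_. 0"] simp: mono_on_def)
  then show ?thesis by (simp add: zero_ereal_def)
qed

lemma variation_le_nonneg: "variation g \<le> ereal V \<Longrightarrow> 0 \<le> V"
  using variation_nonneg[of g] order.trans by (metis ereal_less_eq(3) zero_ereal_def)

text \<open>A monotone \<open>s\<close> carries partitions to partitions, so every partition sum of
  \<open>h\<close> is one of \<open>g\<close>. Two instances matter: freezing with
  \<open>s x = max x u\<close>, and rounding the current state to a grid.\<close>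

lemma variation_sample:
  assumes g: "variation g \<le> ereal V" and s: "\<And>x y. 0 \<le> x \<Longrightarrow> x \<le> y \<Longrightarrow> y \<le> 1 \<Longrightarrow> s x \<le> s y"
    and s01: "\<And>x. 0 \<le> x \<Longrightarrow> x \<le> 1 \<Longrightarrow> 0 \<le> s x \<and> s x \<le> (1::real)"
    and h: "\<And>x. 0 \<le> x \<Longrightarrow> x \<le> 1 \<Longrightarrow> h x = g (s x)"
  shows "variation h \<le> ereal V"
  unfolding variation_le_iff
proof (intro allI impI)
  fix n and t :: "nat \<Rightarrow> real" assume t: "mono_on {..n} t" "t ` {..n} \<subseteq> {0..1}"
  have t01: "0 \<le> t i" "t i \<le> 1" if "i \<le> n" for i using that t(2) by (auto simp: subset_eq)
  have "(\<Sum>i<n. \<bar>g ((s \<circ> t) (Suc i)) - g ((s \<circ> t) i)\<bar>) \<le> V"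
    by (rule variation_leD[OF g]) (use t01 s s01 t(1) in \<open>auto simp: mono_on_def\<close>)
  also have "(\<Sum>i<n. \<bar>g ((s \<circ> t) (Suc i)) - g ((s \<circ> t) i)\<bar>) = (\<Sum>i<n. \<bar>h (t (Suc i)) - h (t i)\<bar>)"
    by (rule sum.cong) (use t01 h in auto)
  finally show "(\<Sum>i<n. \<bar>h (t (Suc i)) - h (t i)\<bar>) \<le> V" .
qed

lemma variation_cong: "(\<And>x. x \<in> {0..1} \<Longrightarrow> g x = h x) \<Longrightarrow> variation g \<le> ereal V \<Longrightarrow> variation h \<le> ereal V"
  by (rule variation_sample[where s="\<lambda>x. x" and g=g]) auto

lemma variation_lincomb:
  assumes "variation g \<le> ereal V" "variation h \<le> ereal W"
  shows "variation (\<lambda>x. a * g x + b * h x) \<le> ereal (\<bar>a\<bar> * V + \<bar>b\<bar> * W)"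
  unfolding variation_le_iff
proof (intro allI impI)
  fix n and t :: "nat \<Rightarrow> real" assume t: "mono_on {..n} t" "t ` {..n} \<subseteq> {0..1}"
  have 1: "(\<Sum>i<n. \<bar>g (t (Suc i)) - g (t i)\<bar>) \<le> V" "(\<Sum>i<n. \<bar>h (t (Suc i)) - h (t i)\<bar>) \<le> W"
    using assms t unfolding variation_le_iff by blast+
  have "(\<Sum>i<n. \<bar>a * g (t (Suc i)) + b * h (t (Suc i)) - (a * g (t i) + b * h (t i))\<bar>) \<le>
    (\<Sum>i<n. \<bar>a\<bar> * \<bar>g (t (Suc i)) - g (t i)\<bar> + \<bar>b\<bar> * \<bar>h (t (Suc i)) - h (t i)\<bar>)"
  proof (rule sum_mono)
    fix i
    have "a * g (t (Suc i)) + b * h (t (Suc i)) - (a * g (t i) + b * h (t i)) =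
      a * (g (t (Suc i)) - g (t i)) + b * (h (t (Suc i)) - h (t i))" by (simp add: algebra_simps)
    then show "\<bar>a * g (t (Suc i)) + b * h (t (Suc i)) - (a * g (t i) + b * h (t i))\<bar> \<le>
      \<bar>a\<bar> * \<bar>g (t (Suc i)) - g (t i)\<bar> + \<bar>b\<bar> * \<bar>h (t (Suc i)) - h (t i)\<bar>"
      by (metis abs_mult abs_triangle_ineq)
  qed
  also have "\<dots> \<le> \<bar>a\<bar> * V + \<bar>b\<bar> * W"
    unfolding sum.distrib sum_distrib_left[symmetric]
    by (intro add_mono mult_left_mono 1) auto
  finally show "(\<Sum>i<n. \<bar>a * g (t (Suc i)) + b * h (t (Suc i)) - (a * g (t i) + b * h (t i))\<bar>) \<le> \<bar>a\<bar> * V + \<bar>b\<bar> * W" .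
qed

lemma variation_antimono:
  assumes "antimono (g :: real \<Rightarrow> real)"
  shows "variation g \<le> ereal (g 0 - g 1)"
  unfolding variation_le_iff
proof (intro allI impI)
  fix n and t :: "nat \<Rightarrow> real" assume t: "mono_on {..n} t" "t ` {..n} \<subseteq> {0..1}"
  have "(\<Sum>i<n. \<bar>g (t (Suc i)) - g (t i)\<bar>) = (\<Sum>i<n. g (t i) - g (t (Suc i)))"
  proof (rule sum.cong)
    fix i assume "i \<in> {..<n}"
    then have "t i \<le> t (Suc i)" using t(1) by (auto simp: mono_on_def)
    then have "g (t (Suc i)) \<le> g (t i)" using assms by (auto dest: antimonoD)
    then show "\<bar>g (t (Suc i)) - g (t i)\<bar> = g (t i) - g (t (Suc i))" by simp
  qed simp
  also have "\<dots> = g (t 0) - g (t n)" by (rule sum_lessThan_telescope')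
  also have "\<dots> \<le> g 0 - g 1"
  proof (rule diff_mono)
    show "g (t 0) \<le> g 0" by (rule antimonoD[OF assms]) (use t(2) in auto)
    show "g 1 \<le> g (t n)" by (rule antimonoD[OF assms]) (use t(2) in auto)
  qed
  finally show "(\<Sum>i<n. \<bar>g (t (Suc i)) - g (t i)\<bar>) \<le> g 0 - g 1" .
qed

lemma variation_bounds:
  assumes "variation g \<le> ereal V" "0 \<le> x" "x \<le> y" "y \<le> 1"
  shows "\<bar>g y - g x\<bar> \<le> V"
  using variation_leD[OF assms(1), where n=1 and t="\<lambda>i. if i = 0 then x else y"] assms
  by (auto simp: mono_on_def)

text \<open>\<open>g\<close> frozen before \<open>u\<close> has as variation over \<open>{0..1}\<close> the variation of \<open>g\<close> over \<open>{u..1}\<close>.\<close>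

definition tail_variation :: "(real \<Rightarrow> real) \<Rightarrow> real \<Rightarrow> real" where
  "tail_variation g u = real_of_ereal (variation (\<lambda>x. g (max x u)))"

lemma variation_max:
  assumes "variation g \<le> ereal V" "0 \<le> u" "u \<le> 1"
  shows "variation (\<lambda>x. g (max x u)) \<le> ereal V"
  by (rule variation_sample[OF assms(1), where s="\<lambda>x. max x u"]) (use assms in auto)

text \<open>\<open>real_of_ereal\<close> would send an infinite variation to 0; the bound
  \<open>V\<close> rules this out, so that the real-valued \<open>tail_variation\<close> is the true
  variation.\<close>

lemma tail_variation:
  assumes "variation g \<le> ereal V" "0 \<le> u" "u \<le> 1"
  shows "variation (\<lambda>x. g (max x u)) = ereal (tail_variation g u)"
    and "0 \<le> tail_variation g u" and "tail_variation g u \<le> V"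
proof -
  have 1: "variation (\<lambda>x. g (max x u)) \<le> ereal V" by (rule variation_max[OF assms])
  moreover note variation_nonneg[of "\<lambda>x. g (max x u)"]
  ultimately show 2: "variation (\<lambda>x. g (max x u)) = ereal (tail_variation g u)"
    unfolding tail_variation_def by (cases "variation (\<lambda>x. g (max x u))") auto
  show "tail_variation g u \<le> V" using 1 2 by simp
  show "0 \<le> tail_variation g u" using variation_nonneg[of "\<lambda>x. g (max x u)"] 2 by simp
qed

text \<open>A partition of \<open>{v..1}\<close> can be extended to the left by the point
  \<open>u\<close>, which adds the increment from \<open>u\<close> to \<open>v\<close>. The
  inequality makes both \<open>tail_variation g\<close> and \<open>tail_variation g - g\<close>
  decreasing.\<close>

lemma tail_variation_decr:
  assumes g: "variation g \<le> ereal V" and uv: "0 \<le> u" "u \<le> v" "v \<le> 1"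
  shows "tail_variation g v + \<bar>g v - g u\<bar> \<le> tail_variation g u"
proof -
  let ?U = "tail_variation g u"
  have U: "variation (\<lambda>x. g (max x u)) \<le> ereal ?U" using tail_variation[OF g, of u] uv by auto
  have "variation (\<lambda>x. g (max x v)) \<le> ereal (?U - \<bar>g v - g u\<bar>)"
    unfolding variation_le_iff
  proof (intro allI impI)
    fix n and t :: "nat \<Rightarrow> real" assume t: "mono_on {..n} t" "t ` {..n} \<subseteq> {0..1}"
    have t01: "0 \<le> t i" "t i \<le> 1" if "i \<le> n" for i using that t(2) by (auto simp: subset_eq)
    \<comment> \<open>The points \<open>u\<close> and \<open>v\<close> are put in front and the old
      points are lifted to at least \<open>v\<close>; the sum over \<open>s\<close> then has the
      wanted increment, a nonnegative term that is dropped, and the old sum.\<close>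
    define s where "s i = (case i of 0 \<Rightarrow> u | Suc 0 \<Rightarrow> v | Suc (Suc j) \<Rightarrow> max (t j) v)" for i
    have s: "s 0 = u" "s (Suc 0) = v" "\<And>j. s (Suc (Suc j)) = max (t j) v"
      by (auto simp: s_def)
    have mono: "s i \<le> s j" if "i \<le> j" "j \<le> Suc (Suc n)" for i j
      using that uv t(1)
      by (auto simp: s_def mono_on_def split: nat.splits intro: max.coboundedI1 max.mono)
    have su: "max (s i) u = s i" if "i \<le> Suc (Suc n)" for i using mono[of 0 i] that s by auto
    have "(\<Sum>i<Suc (Suc n). \<bar>g (max (s (Suc i)) u) - g (max (s i) u)\<bar>) \<le> ?U"
      by (rule variation_leD[OF U])
        (use mono t01 uv in \<open>auto simp: mono_on_def s_def max.coboundedI1 split: nat.splits\<close>)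
    also have "(\<Sum>i<Suc (Suc n). \<bar>g (max (s (Suc i)) u) - g (max (s i) u)\<bar>) =
      (\<Sum>i<Suc (Suc n). \<bar>g (s (Suc i)) - g (s i)\<bar>)"
      by (rule sum.cong) (use su in auto)
    also have "\<dots> = \<bar>g v - g u\<bar> + \<bar>g (max (t 0) v) - g v\<bar> +
        (\<Sum>i<n. \<bar>g (max (t (Suc i)) v) - g (max (t i) v)\<bar>)"
      by (simp only: sum.lessThan_Suc_shift s)
    finally show "(\<Sum>i<n. \<bar>g (max (t (Suc i)) v) - g (max (t i) v)\<bar>) \<le> ?U - \<bar>g v - g u\<bar>" by simp
  qed
  then show ?thesis using tail_variation(1)[OF g, of v] uv by simp
qed

text \<open>The tail variation is used instead of the usual variation from the left because it gives
  decreasing parts, whose level sets are initial segments, the sets that distribution functions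
  measure. Clamping by \<open>cl\<close> extends the parts monotonically to the line. The bound
  \<open>2 * V\<close> is \<open>V\<close> for the tail variation plus \<open>V\<close> for the
  increment of \<open>g\<close> up to 1.\<close>

lemma jordan_decomposition:
  assumes g: "variation g \<le> ereal V"
  obtains h1 h2 :: "real \<Rightarrow> real" where
    "antimono h1" "antimono h2" "\<And>u. u \<in> {0..1} \<Longrightarrow> g u = g 1 + h1 u - h2 u"
    "\<And>u. 0 \<le> h1 u" "\<And>u. 0 \<le> h2 u" "\<And>u. h1 u \<le> V" "\<And>u. h2 u \<le> 2 * V"
proof -
  define cl :: "real \<Rightarrow> real" where "cl u = max 0 (min 1 u)" for u
  have cl: "0 \<le> cl u" "cl u \<le> 1" "u \<le> v \<Longrightarrow> cl u \<le> cl v" "u \<in> {0..1} \<Longrightarrow> cl u = u" for u v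
    by (auto simp: cl_def)
  let ?W = "tail_variation g"
  define h1 where "h1 u = ?W (cl u)" for u
  define h2 where "h2 u = ?W (cl u) - g (cl u) + g 1" for u
  have dec: "?W (cl v) + \<bar>g (cl v) - g (cl u)\<bar> \<le> ?W (cl u)" if "u \<le> v" for u v
    by (rule tail_variation_decr[OF g]) (use cl that in auto)
  have dec1: "?W 1 + \<bar>g 1 - g (cl u)\<bar> \<le> ?W (cl u)" for u
    by (rule tail_variation_decr[OF g]) (use cl in auto)
  have W1: "0 \<le> ?W 1" using tail_variation(2)[OF g, of 1] by simp
  have W0: "0 \<le> ?W (cl u)" for u using tail_variation(2)[OF g, of "cl u"] cl by auto
  have WV: "?W (cl u) \<le> V" for u using tail_variation(3)[OF g, of "cl u"] cl by auto
  show ?thesis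
  proof (rule that)
    show "antimono h1"
    proof (rule antimonoI)
      fix u v :: real assume "u \<le> v" from dec[OF this] show "h1 v \<le> h1 u" unfolding h1_def by linarith
    qed
    show "antimono h2"
    proof (rule antimonoI)
      fix u v :: real assume "u \<le> v" from dec[OF this] show "h2 v \<le> h2 u" unfolding h2_def by linarith
    qed
    show "g u = g 1 + h1 u - h2 u" if "u \<in> {0..1}" for u using cl(4)[OF that] by (simp add: h1_def h2_def)
    show "0 \<le> h1 u" for u using W0 by (simp add: h1_def)
    show "h1 u \<le> V" for u using WV by (simp add: h1_def)
    show "0 \<le> h2 u" for u using dec1[of u] W1 unfolding h2_def by linarith
    show "h2 u \<le> 2 * V" for u
      using variation_bounds[OF g, of "cl u" 1] cl[of u] WV[of u] unfolding h2_def by (simp add: abs_le_iff)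
  qed
qed

section \<open>Formal combinations of measures on the unit interval\<close>

definition comb_cdf :: "(real \<times> real measure) list \<Rightarrow> real \<Rightarrow> real" where
  "comb_cdf xs x = (\<Sum>(a, M)\<leftarrow>xs. a * cdf M x)"

text \<open>Lists cover both the weighted sums of \<open>dist_span\<close> and the differences of
  two measures in \<open>unit_integral\<close>, and they allow induction. Distinct lists may have
  the same distribution function; that the integral does not see the difference is
  \<open>comb_int_eqI\<close>.\<close>

definition comb_int :: "(real \<Rightarrow> real) \<Rightarrow> (real \<times> real measure) list \<Rightarrow> real" where
  "comb_int g xs = (\<Sum>(a, M)\<leftarrow>xs. a * set_lebesgue_integral M {0..1} g)"

definition unit_comb :: "(real \<times> real measure) list \<Rightarrow> bool" where
  "unit_comb xs \<longleftrightarrow> (\<forall>(a, M)\<in>set xs. unit_measure M)"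

lemma comb_simps [simp]:
  "comb_cdf [] = (\<lambda>_. 0)" "comb_cdf ((a, M) # xs) = (\<lambda>x. a * cdf M x + comb_cdf xs x)"
  "comb_int g [] = 0" "comb_int g ((a, M) # xs) = a * set_lebesgue_integral M {0..1} g + comb_int g xs"
  "unit_comb []" "unit_comb ((a, M) # xs) \<longleftrightarrow> unit_measure M \<and> unit_comb xs"
  by (auto simp: comb_cdf_def comb_int_def unit_comb_def fun_eq_iff)

lemma comb_append [simp]:
  "comb_cdf (xs @ ys) = (\<lambda>x. comb_cdf xs x + comb_cdf ys x)"
  "comb_int g (xs @ ys) = comb_int g xs + comb_int g ys"
  "unit_comb (xs @ ys) \<longleftrightarrow> unit_comb xs \<and> unit_comb ys"
  by (auto simp: comb_cdf_def comb_int_def unit_comb_def fun_eq_iff)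

definition comb_scale :: "real \<Rightarrow> (real \<times> real measure) list \<Rightarrow> (real \<times> real measure) list" where
  "comb_scale b xs = map (\<lambda>(a, M). (b * a, M)) xs"

lemma comb_scale [simp]:
  "comb_cdf (comb_scale b xs) = (\<lambda>x. b * comb_cdf xs x)"
  "comb_int g (comb_scale b xs) = b * comb_int g xs"
  "unit_comb (comb_scale b xs) \<longleftrightarrow> unit_comb xs"
  by (induction xs) (auto simp: comb_scale_def fun_eq_iff algebra_simps)

lemma unit_measureD:
  assumes "unit_measure M"
  shows "finite_borel_measure M" "finite_measure M" "sets M = sets borel" "space M = UNIV"
proof -
  show 1: "finite_borel_measure M" using assms by (simp add: unit_measure_def)
  then interpret finite_borel_measure M .
  show "finite_measure M" "sets M = sets borel" "space M = UNIV"
    by (rule finite_measure_axioms M_is_borel borel_UNIV)+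
qed

lemma unit_measure_outside:
  assumes "unit_measure M" "A \<in> sets borel" "A \<inter> {0..1} = {}"
  shows "measure M A = 0"
proof -
  interpret finite_borel_measure M using unit_measureD(1)[OF assms(1)] .
  have "emeasure M A \<le> emeasure M (UNIV - {0..1})"
    by (rule emeasure_mono) (use assms(3) M_is_borel in auto)
  then have "emeasure M A = 0" using assms(1) by (simp add: unit_measure_def)
  then show ?thesis by (simp add: measure_def)
qed

lemma unit_measure_Int:
  assumes "unit_measure M" "A \<in> sets borel"
  shows "measure M (A \<inter> {0..1}) = measure M A"
proof -
  interpret finite_borel_measure M using unit_measureD(1)[OF assms(1)] .
  have "measure M A = measure M (A \<inter> {0..1}) + measure M (A - {0..1})"
    using finite_measure_Union[of "A \<inter> {0..1}" "A - {0..1}"] assms(2) M_is_borel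
    by (auto simp: Int_Diff_Un Int_Diff)
  also have "measure M (A - {0..1}) = 0" by (rule unit_measure_outside[OF assms(1)]) (use assms in auto)
  finally show ?thesis by simp
qed

lemma cdf_unit:
  assumes "unit_measure M"
  shows "x < 0 \<Longrightarrow> cdf M x = 0" "1 \<le> x \<Longrightarrow> cdf M x = measure M {0..1}"
    "x \<in> {0..1} \<Longrightarrow> cdf M x = measure M {0..x}"
proof -
  show "cdf M x = 0" if "x < 0"
    unfolding cdf_def by (rule unit_measure_outside[OF assms]) (use that in auto)
  show "cdf M x = measure M {0..1}" if "1 \<le> x"
  proof -
    have "{..x} \<inter> {0..1} = {0..1}" using that by auto
    then show ?thesis unfolding cdf_def using unit_measure_Int[OF assms, of "{..x}"] by simp
  qed
  show "cdf M x = measure M {0..x}" if "x \<in> {0..1}"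
  proof -
    have eq: "{..x} \<inter> {0..1} = {0..x}" using that by auto
    show ?thesis unfolding cdf_def using unit_measure_Int[OF assms, of "{..x}", unfolded eq] by simp
  qed
qed

text \<open>The mass of an open half-line need not be a value of the distribution function, but as a
  limit of values it obeys the same bound.\<close>

lemma comb_cdf_left_limit:
  assumes "unit_comb xs"
  shows "(comb_cdf xs \<longlongrightarrow> (\<Sum>(a, M)\<leftarrow>xs. a * measure M {..<x})) (at_left x)"
  using assms
proof (induction xs)
  case (Cons y ys)
  obtain a M where y: "y = (a, M)" by (cases y)
  interpret finite_borel_measure M using Cons.prems y unit_measureD(1) by auto
  show ?case using Cons y by (auto intro!: tendsto_intros cdf_at_left)
qed simp

text \<open>Initial segments of \<open>{0..1}\<close> are the level sets of antimonotone functions.\<close>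

lemma comb_down_set_bound:
  assumes xs: "unit_comb xs" and B: "\<And>x. \<bar>comb_cdf xs x\<bar> \<le> B"
    and A: "\<And>u v. u \<le> v \<Longrightarrow> v \<in> A \<Longrightarrow> u \<in> (A :: real set)"
  shows "\<bar>\<Sum>(a, M)\<leftarrow>xs. a * measure M A\<bar> \<le> B"
proof -
  have B0: "0 \<le> B" using B[of 0] by linarith
  \<comment> \<open>Apart from the trivial cases an initial segment is a closed or an open
    half-line, with mass a value or a left limit of the combined distribution function. The whole
    line has mass \<open>comb_cdf xs 1\<close>.\<close>
  consider "A = {}" | "A = UNIV" | s where "A = {..s}" | s where "A = {..<s}"
  proof (cases "A = {} \<or> \<not> bdd_above A")
    case True
    then show ?thesis
    proof
      assume "\<not> bdd_above A"
      then have "x \<in> A" for x using A by (meson bdd_above.I linear)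
      then show ?thesis using that by blast
    qed (use that in blast)
  next
    case False
    define s where "s = Sup A"
    have s: "x \<le> s" if "x \<in> A" for x using that False cSup_upper s_def by blast
    have s': "x \<in> A" if "x < s" for x
      using that False less_cSup_iff[of A x] A s_def by (meson less_imp_le)
    show ?thesis
    proof (cases "s \<in> A")
      case True
      then have "A = {..s}" using s A by auto
      then show ?thesis using that by blast
    next
      case False
      have "A = {..<s}"
      proof (intro set_eqI)
        fix x show "x \<in> A \<longleftrightarrow> x \<in> {..<s}" using s[of x] s'[of x] False by (auto simp: le_less)
      qed
      then show ?thesis using that by blast
    qed
  qed
  then show ?thesis
  proof cases
    case 1
    have "(\<Sum>(a, M)\<leftarrow>xs. a * measure M {}) = 0" by (induction xs) auto
    then show ?thesis using 1 B0 by simp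
  next
    case 2
    have "(\<Sum>(a, M)\<leftarrow>xs. a * measure M UNIV) = comb_cdf xs 1" using xs
    proof (induction xs)
      case (Cons y ys)
      obtain a M where y: "y = (a, M)" by (cases y)
      have "measure M UNIV = cdf M 1"
        using unit_measure_Int[of M UNIV] cdf_unit(2)[of M 1] Cons.prems y by auto
      then show ?case using Cons y by simp
    qed simp
    then show ?thesis using 2 B by simp
  next
    case 3
    then show ?thesis using B[of s] by (simp add: comb_cdf_def cdf_def)
  next
    case 4
    have "((\<lambda>x. \<bar>comb_cdf xs x\<bar>) \<longlongrightarrow> \<bar>\<Sum>(a, M)\<leftarrow>xs. a * measure M {..<s}\<bar>) (at_left s)"
      by (intro tendsto_intros comb_cdf_left_limit xs)
    then have "\<bar>\<Sum>(a, M)\<leftarrow>xs. a * measure M {..<s}\<bar> \<le> B"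
      by (rule tendsto_upperbound) (use B in auto)
    then show ?thesis using 4 by simp
  qed
qed

lemma set_integrable_unit:
  fixes B :: real assumes "unit_measure M" "g \<in> borel_measurable borel" "\<And>u. u \<in> {0..1} \<Longrightarrow> \<bar>g u\<bar> \<le> B"
  shows "set_integrable M {0..1} g"
proof -
  interpret finite_borel_measure M using unit_measureD(1)[OF assms(1)] .
  have [measurable]: "g \<in> borel_measurable M" "{0..1} \<in> sets M"
    using assms(2) M_is_borel measurable_cong_sets by auto
  have "(\<lambda>u. indicator {0..1} u *\<^sub>R g u) \<in> borel_measurable M" by measurable
  then show ?thesis unfolding set_integrable_def
    by (rule integrable_const_bound[where B="\<bar>B\<bar>", rotated])
      (use assms(3) in \<open>auto simp: indicator_def intro!: order_trans[OF _ abs_ge_self]\<close>)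
qed

lemma borel_antimono: "antimono (h :: real \<Rightarrow> real) \<Longrightarrow> h \<in> borel_measurable borel"
  using borel_measurable_mono[of "\<lambda>x. - h x"] by (simp add: mono_def antimono_def)

text \<open>Layer cake: up to \<open>1/n\<close>, the function \<open>h\<close> is an average of indicators of its level sets.\<close>

lemma comb_int_antimono_bound:
  assumes xs: "unit_comb xs" and B: "\<And>x. \<bar>comb_cdf xs x\<bar> \<le> B"
    and h: "antimono h" "\<And>u. 0 \<le> h u" "\<And>u. h u \<le> V"
  shows "\<bar>comb_int h xs\<bar> \<le> V * B"
proof -
  have B0: "0 \<le> B" using B[of 0] by linarith
  have V0: "0 \<le> V" using h(2,3)[of 0] by linarith
  \<comment> \<open>\<open>T\<close> depends on the list and not only on its distribution function.
    It enters only through the error \<open>T / n\<close>, which disappears in the limit.\<close>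
  define T where "T = (\<Sum>(a, M)\<leftarrow>xs. \<bar>a\<bar> * measure M UNIV)"
  have main: "\<bar>comb_int h xs\<bar> \<le> V * B + T / real n" if n: "n > 0" for n :: nat
  proof -
    \<comment> \<open>No level above \<open>m\<close> is reached, since \<open>h \<le> V\<close>. At
      most \<open>n * V\<close> level sets of weight \<open>1/n\<close> and mass at most
      \<open>B\<close> give \<open>V * B\<close>.\<close>
    define m where "m = nat \<lfloor>n * V\<rfloor>"
    define A where "A k = {u. real k \<le> n * h u}" for k :: nat
    define hn where "hn u = (\<Sum>k=1..m. indicator (A k) u) / n" for u :: real
    have A_down: "u \<in> A k" if "u \<le> v" "v \<in> A k" for u v k
    proof -
      have "real n * h v \<le> real n * h u" using antimonoD[OF h(1) that(1)] by (rule mult_left_mono) simp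
      then show ?thesis using that(2) unfolding A_def by simp
    qed
    have hn_eq: "hn u = \<lfloor>n * h u\<rfloor> / n" for u
    proof -
      have *: "{1..m} \<inter> {k. real k \<le> n * h u} = {1..nat \<lfloor>n * h u\<rfloor>}"
      proof -
        have eq: "k \<le> m \<and> real k \<le> n * h u \<longleftrightarrow> k \<le> nat \<lfloor>n * h u\<rfloor>" for k
        proof -
          have "\<lfloor>n * h u\<rfloor> \<le> \<lfloor>n * V\<rfloor>" using h(3)[of u] by (intro floor_mono mult_left_mono) auto
          then have "nat \<lfloor>n * h u\<rfloor> \<le> m" unfolding m_def by simp
          moreover have "real k \<le> n * h u \<longleftrightarrow> k \<le> nat \<lfloor>n * h u\<rfloor>"
            using h(2)[of u] n by (simp add: le_nat_floor le_nat_iff le_floor_iff)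
          ultimately show ?thesis by auto
        qed
        show ?thesis
        proof (rule set_eqI)
          fix k
          show "k \<in> {1..m} \<inter> {k. real k \<le> n * h u} \<longleftrightarrow> k \<in> {1..nat \<lfloor>n * h u\<rfloor>}"
            using eq[of k] by (simp only: Int_iff atLeastAtMost_iff mem_Collect_eq) blast
        qed
      qed
      have "(\<Sum>k=1..m. indicator (A k) u :: real) = real (card ({1..m} \<inter> {k. real k \<le> n * h u}))"
        unfolding A_def indicator_def by (subst sum_of_bool_eq) auto
      also have "\<dots> = \<lfloor>n * h u\<rfloor>" unfolding * using h(2)[of u] n by simp
      finally show ?thesis by (simp add: hn_def)
    qed
    have close: "\<bar>h u - hn u\<bar> \<le> 1 / n" for u
    proof -
      have "h u - hn u = (n * h u - \<lfloor>n * h u\<rfloor>) / n" unfolding hn_eq using n by (simp add: diff_divide_distrib)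
      then have "\<bar>h u - hn u\<bar> = (n * h u - \<lfloor>n * h u\<rfloor>) / n" using n by simp
      also have "\<dots> \<le> 1 / n" by (rule divide_right_mono; linarith)
      finally show ?thesis .
    qed
    have A_meas [measurable]: "A k \<in> sets borel" for k
    proof -
      have [measurable]: "h \<in> borel_measurable borel" by (rule borel_antimono[OF h(1)])
      show ?thesis unfolding A_def by measurable
    qed
    have hn_meas: "hn \<in> borel_measurable borel" unfolding hn_def by measurable
    have hn_int: "comb_int hn xs = (\<Sum>k=1..m. \<Sum>(a, M)\<leftarrow>xs. a * measure M (A k)) / n"
      using xs
    proof (induction xs)
      case (Cons y ys)
      obtain a M where y: "y = (a, M)" by (cases y)
      then have M: "unit_measure M" using Cons.prems by auto
      interpret finite_borel_measure M using unit_measureD(1)[OF M] .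
      have [measurable]: "A k \<in> sets M" "{0..1} \<in> sets M" for k using A_meas M_is_borel by auto
      have "set_lebesgue_integral M {0..1} hn =
        (LINT u|M. (\<Sum>k=1..m. indicator (A k \<inter> {0..1}) u) / n)"
        unfolding set_lebesgue_integral_def hn_def
        by (rule Bochner_Integration.integral_cong) (auto simp: indicator_def)
      also have "\<dots> = (\<Sum>k=1..m. measure M (A k \<inter> {0..1})) / n"
        by (subst Bochner_Integration.integral_divide_zero, subst Bochner_Integration.integral_sum)
          (auto simp: emeasure_eq_measure borel_UNIV)
      also have "\<dots> = (\<Sum>k=1..m. measure M (A k)) / n"
        by (simp add: unit_measure_Int[OF M])
      finally show ?case using Cons y
        by (simp add: sum.distrib sum_distrib_left add_divide_distrib)
    qed simp
    have "\<bar>comb_int hn xs\<bar> \<le> (\<Sum>k=1..m. B) / n"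
      unfolding hn_int abs_divide abs_of_nat
      by (intro divide_right_mono order_trans[OF sum_abs] sum_mono comb_down_set_bound[OF xs B])
        (auto intro: A_down)
    also have "\<dots> \<le> V * B"
    proof -
      have "real m \<le> n * V" unfolding m_def using V0 by simp
      then have "real m * B \<le> n * V * B" using B0 by (rule mult_right_mono)
      then show ?thesis using n by (simp add: field_simps)
    qed
    finally have 1: "\<bar>comb_int hn xs\<bar> \<le> V * B" .
    have "\<bar>comb_int h xs - comb_int hn xs\<bar> \<le> T / n" using xs unfolding T_def
    proof (induction xs)
      case (Cons y ys)
      obtain a M where y: "y = (a, M)" by (cases y)
      then have M: "unit_measure M" using Cons.prems by auto
      interpret finite_borel_measure M using unit_measureD(1)[OF M] .
      have ih: "set_integrable M {0..1} h"
        by (rule set_integrable_unit[OF M borel_antimono[OF h(1)], of V]) (use h in auto)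
      have ihn: "set_integrable M {0..1} hn"
      proof (rule set_integrable_unit[OF M hn_meas, of "V + 1"])
        fix u :: real
        have "1 / real n \<le> 1" using n by simp
        then show "\<bar>hn u\<bar> \<le> V + 1" using close[of u] h(2,3)[of u] by linarith
      qed
      have "\<bar>set_lebesgue_integral M {0..1} h - set_lebesgue_integral M {0..1} hn\<bar> =
          \<bar>set_lebesgue_integral M {0..1} (\<lambda>u. h u - hn u)\<bar>"
        using set_integral_diff(2)[OF ih ihn] by simp
      also have "\<dots> \<le> (LINT u|M. 1 / n)"
      proof -
        have "\<bar>set_lebesgue_integral M {0..1} (\<lambda>u. h u - hn u)\<bar> \<le>
            (LINT u|M. \<bar>indicator {0..1} u *\<^sub>R (h u - hn u)\<bar>)"
          unfolding set_lebesgue_integral_def by (rule integral_abs_bound)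
        also have "\<dots> \<le> (LINT u|M. 1 / n)"
          using set_integral_diff(1)[OF ih ihn] close unfolding set_integrable_def
          by (intro integral_mono integrable_abs) (auto simp: indicator_def)
        finally show ?thesis .
      qed
      also have "\<dots> = measure M UNIV / n" by (simp add: borel_UNIV)
      finally have "\<bar>a * (set_lebesgue_integral M {0..1} h - set_lebesgue_integral M {0..1} hn)\<bar>
        \<le> \<bar>a\<bar> * (measure M UNIV / n)" unfolding abs_mult by (rule mult_left_mono) simp
      moreover have "\<bar>comb_int h ys - comb_int hn ys\<bar> \<le> (\<Sum>(a, M)\<leftarrow>ys. \<bar>a\<bar> * measure M UNIV) / n"
        using Cons y by auto
      ultimately show ?case unfolding y by (simp add: algebra_simps add_divide_distrib)
    qed simp
    then show ?thesis using 1 by linarith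
  qed
  have "((\<lambda>n. V * B + T / real n) \<longlongrightarrow> V * B + 0) sequentially"
    by (intro tendsto_intros lim_const_over_n)
  then have "\<bar>comb_int h xs\<bar> \<le> V * B + 0"
    by (rule tendsto_lowerbound) (auto intro!: eventually_sequentiallyI[of 1] main)
  then show ?thesis by simp
qed

text \<open>Nothing is known about \<open>g\<close> off the unit interval, so \<open>g\<close>
  itself need not be Borel. The Jordan parts are monotone on the whole line and provide a measurable
  substitute.\<close>

lemma variation_measurable:
  assumes "variation g \<le> ereal V"
  obtains g' where "g' \<in> borel_measurable borel" "\<And>u. u \<in> {0..1} \<Longrightarrow> g u = g' u"
    "\<And>u. u \<in> {0..1} \<Longrightarrow> \<bar>g' u\<bar> \<le> \<bar>g 1\<bar> + V"
proof -
  obtain h1 h2 where h: "antimono h1" "antimono h2" "\<And>u. u \<in> {0..1} \<Longrightarrow> g u = g 1 + h1 u - h2 u"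
    by (rule jordan_decomposition[OF assms]) blast
  have [measurable]: "h1 \<in> borel_measurable borel" "h2 \<in> borel_measurable borel"
    by (rule borel_antimono[OF h(1)] borel_antimono[OF h(2)])+
  show ?thesis
  proof (rule that[of "\<lambda>u. g 1 + h1 u - h2 u"])
    fix u :: real assume u: "u \<in> {0..1}"
    then show "\<bar>g 1 + h1 u - h2 u\<bar> \<le> \<bar>g 1\<bar> + V"
      using variation_bounds[OF assms, of u 1] h(3)[OF u] u by simp
    show "g u = g 1 + h1 u - h2 u" by (rule h(3)[OF u])
  qed measurable
qed

lemma set_integrable_variation:
  assumes "variation g \<le> ereal V" "unit_measure M"
  shows "set_integrable M {0..1} g"
proof (rule variation_measurable[OF assms(1)])
  fix g' assume g': "g' \<in> borel_measurable borel" "\<And>u. u \<in> {0..1} \<Longrightarrow> g u = g' u"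
    "\<And>u. u \<in> {0..1} \<Longrightarrow> \<bar>g' u\<bar> \<le> \<bar>g 1\<bar> + V"
  have "set_integrable M {0..1} g'" by (rule set_integrable_unit[OF assms(2) g'(1,3)])
  moreover have "(\<lambda>u. indicator {0..1} u *\<^sub>R g' u) = (\<lambda>u. indicator {0..1} u *\<^sub>R g u)"
    using g'(2) by (auto simp: indicator_def)
  ultimately show ?thesis by (simp add: set_integrable_def)
qed

lemma comb_int_cong: "(\<And>u. u \<in> {0..1} \<Longrightarrow> g u = g' u) \<Longrightarrow> comb_int g xs = comb_int g' xs"
proof (induction xs)
  case (Cons y ys)
  have "set_lebesgue_integral M {0..1} g = set_lebesgue_integral M {0..1} g'" for M :: "real measure"
    unfolding set_lebesgue_integral_def
    by (rule Bochner_Integration.integral_cong) (use Cons.prems in \<open>auto simp: indicator_def\<close>)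
  then show ?case using Cons by (cases y) auto
qed simp

lemma comb_int_lincomb:
  assumes "variation g \<le> ereal V" "variation h \<le> ereal W" "unit_comb xs"
  shows "comb_int (\<lambda>u. a * g u + b * h u) xs = a * comb_int g xs + b * comb_int h xs"
  using assms(3)
proof (induction xs)
  case (Cons y ys)
  obtain c M where y: "y = (c, M)" by (cases y)
  then have M: "unit_measure M" using Cons.prems by auto
  have i: "set_integrable M {0..1} (\<lambda>u. a * g u)" "set_integrable M {0..1} (\<lambda>u. b * h u)"
    using set_integrable_variation[OF assms(1) M] set_integrable_variation[OF assms(2) M] by auto
  have "set_lebesgue_integral M {0..1} (\<lambda>u. a * g u + b * h u) =
    a * set_lebesgue_integral M {0..1} g + b * set_lebesgue_integral M {0..1} h"
    using set_integral_add(2)[OF i] by simp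
  then show ?case using Cons y by (simp add: algebra_simps)
qed simp

lemma comb_int_const: "unit_comb xs \<Longrightarrow> comb_int (\<lambda>_. c) xs = c * comb_cdf xs 1"
proof (induction xs)
  case (Cons y ys)
  obtain a M where y: "y = (a, M)" by (cases y)
  then have M: "unit_measure M" using Cons.prems by auto
  interpret finite_borel_measure M using unit_measureD(1)[OF M] .
  have [measurable]: "{0..1} \<in> sets M" using M_is_borel by auto
  have "set_lebesgue_integral M {0..1} (\<lambda>_. c) = c * cdf M 1"
    using cdf_unit(2)[OF M, of 1] by (simp add: set_lebesgue_integral_def borel_UNIV)
  then show ?case using Cons y by (simp add: algebra_simps)
qed simp

text \<open>The constant \<open>g 1\<close> meets the total mass, and the two Jordan parts cost
  \<open>V\<close> and \<open>2 * V\<close>. Since \<open>B\<close> bounds only the distribution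
  function, the estimate survives uniform limits, along which the total variation of the measures
  may blow up.\<close>

lemma comb_int_bound:
  assumes g: "variation g \<le> ereal V" and xs: "unit_comb xs" and B: "\<And>x. \<bar>comb_cdf xs x\<bar> \<le> B"
  shows "\<bar>comb_int g xs\<bar> \<le> (\<bar>g 1\<bar> + 3 * V) * B"
proof (rule jordan_decomposition[OF g])
  fix h1 h2 :: "real \<Rightarrow> real" assume h:
    "antimono h1" "antimono h2" "\<And>u. u \<in> {0..1} \<Longrightarrow> g u = g 1 + h1 u - h2 u"
    "\<And>u. 0 \<le> h1 u" "\<And>u. 0 \<le> h2 u" "\<And>u. h1 u \<le> V" "\<And>u. h2 u \<le> 2 * V"
  note v = variation_antimono[OF h(1)] variation_antimono[OF h(2)]
  have vc: "variation (\<lambda>_. g 1) \<le> ereal 0" unfolding variation_le_iff by simp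
  have v2: "variation (\<lambda>u. 1 * h1 u + (-1) * h2 u) \<le> ereal (\<bar>1\<bar> * (h1 0 - h1 1) + \<bar>-1\<bar> * (h2 0 - h2 1))"
    by (rule variation_lincomb[OF v])
  have "comb_int g xs = comb_int (\<lambda>u. 1 * g 1 + 1 * (1 * h1 u + (-1) * h2 u)) xs"
  proof (rule comb_int_cong)
    fix u :: real assume u: "u \<in> {0..1}"
    show "g u = 1 * g 1 + 1 * (1 * h1 u + (-1) * h2 u)"
      using h(3)[OF u] by simp
  qed
  also have "\<dots> = 1 * comb_int (\<lambda>_. g 1) xs + 1 * comb_int (\<lambda>u. 1 * h1 u + (-1) * h2 u) xs"
    by (rule comb_int_lincomb[OF vc v2 xs])
  also have "\<dots> = g 1 * comb_cdf xs 1 + comb_int h1 xs - comb_int h2 xs"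
    using comb_int_lincomb[OF v xs, of 1 "-1"] comb_int_const[OF xs] by simp
  finally have eq: "comb_int g xs = g 1 * comb_cdf xs 1 + comb_int h1 xs - comb_int h2 xs" .
  have "\<bar>comb_int h1 xs\<bar> \<le> V * B" by (rule comb_int_antimono_bound[OF xs B h(1,4,6)])
  moreover have "\<bar>comb_int h2 xs\<bar> \<le> 2 * V * B" by (rule comb_int_antimono_bound[OF xs B h(2,5,7)])
  moreover have "\<bar>g 1 * comb_cdf xs 1\<bar> \<le> \<bar>g 1\<bar> * B"
    unfolding abs_mult by (rule mult_left_mono[OF B]) simp
  ultimately show ?thesis unfolding eq by (simp add: algebra_simps)
qed

section \<open>Integration against distribution functions\<close>

text \<open>Sums of measures and discrete measures are built from their distribution functions, for
  which the premises are easy to check. Premises \<open>0\<close> and \<open>1\<close> leave no mass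
  outside the unit interval.\<close>

lemma unit_measure_of_cdf:
  assumes mono: "\<And>x y. x \<le> y \<Longrightarrow> F x \<le> F y" and rc: "\<And>a. continuous (at_right a) F"
    and 0: "\<And>x. x < 0 \<Longrightarrow> F x = 0" and 1: "\<And>x. 1 \<le> x \<Longrightarrow> F x = (F 1 :: real)"
  obtains M where "unit_measure M" "cdf M = F" "emeasure M UNIV = F 1"
proof -
  have bot: "(F \<longlongrightarrow> 0) at_bot"
    by (rule tendsto_eventually) (auto simp: eventually_at_bot_dense intro!: exI[of _ 0] 0)
  have top: "(F \<longlongrightarrow> F 1) at_top"
    by (rule tendsto_eventually) (auto simp: eventually_at_top_linorder intro!: exI[of _ 1] 1)
  define M where "M = interval_measure F"
  have F1: "0 \<le> F 1" using 0[of "-1"] mono[of "-1" 1] by simp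
  interpret finite_borel_measure M
    unfolding M_def by (rule finite_borel_measure_interval_measure[OF mono rc bot top F1])
  have cdf: "cdf M = F"
    unfolding M_def cdf_def using measure_interval_measure_Iic[OF mono rc bot] by auto
  have UNIV: "emeasure M UNIV = F 1"
    unfolding M_def by (rule interval_measure_UNIV[OF mono rc bot top F1])
  have "{..1} \<union> {1<..} = (UNIV :: real set)" by auto
  then have "measure M UNIV = measure M {..1} + measure M {1<..}"
    using finite_measure_Union[of "{..1}" "{1<..}"] M_is_borel by (simp add: disjoint_iff)
  moreover have "measure M {..1} = F 1" using cdf by (simp add: cdf_def fun_eq_iff)
  moreover have "measure M UNIV = F 1" using UNIV F1 by (simp add: measure_def)
  ultimately have gt: "measure M {1<..} = 0" by simp
  have "(cdf M \<longlongrightarrow> 0) (at_left 0)"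
    by (rule tendsto_eventually) (auto simp: eventually_at_left_field cdf intro!: exI[of _ "-1"] 0)
  then have lt: "measure M {..<0} = 0"
    using cdf_at_left[of 0] tendsto_unique[of "at_left (0::real)"] by force
  have "UNIV - {0..1::real} = {..<0} \<union> {1<..}" by auto
  then have "measure M (UNIV - {0..1}) = 0"
    using finite_measure_Union[of "{..<0}" "{1<..}"] lt gt M_is_borel by (auto simp: disjoint_iff)
  then have "emeasure M (UNIV - {0..1}) = 0" by (simp add: emeasure_eq_measure)
  then have "unit_measure M" unfolding unit_measure_def using finite_borel_measure_axioms by simp
  then show ?thesis using that cdf UNIV by blast
qed

lemma cdf_unit_measure_props:
  assumes "unit_measure M"
  shows "x \<le> y \<Longrightarrow> cdf M x \<le> cdf M y" "continuous (at_right a) (cdf M)"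
proof -
  interpret finite_borel_measure M using unit_measureD(1)[OF assms] .
  show "x \<le> y \<Longrightarrow> cdf M x \<le> cdf M y" "continuous (at_right a) (cdf M)"
    by (auto intro: cdf_nondecreasing cdf_is_right_cont)
qed

lemma unit_measure_add:
  assumes M: "unit_measure M" and N: "unit_measure N" and a: "0 \<le> a"
  obtains P where "unit_measure P" "cdf P = (\<lambda>x. cdf M x + a * cdf N x)"
proof (rule unit_measure_of_cdf[of "\<lambda>x. cdf M x + a * cdf N x"])
  note p = cdf_unit_measure_props[OF M] cdf_unit_measure_props[OF N]
  fix x y :: real
  show "x \<le> y \<Longrightarrow> cdf M x + a * cdf N x \<le> cdf M y + a * cdf N y"
    by (intro add_mono mult_left_mono p a)
  show "continuous (at_right x) (\<lambda>x. cdf M x + a * cdf N x)"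
    by (intro continuous_intros p)
  show "x < 0 \<Longrightarrow> cdf M x + a * cdf N x = 0"
    "1 \<le> x \<Longrightarrow> cdf M x + a * cdf N x = cdf M 1 + a * cdf N 1"
    by (auto simp: cdf_unit[OF M] cdf_unit[OF N])
qed (use that in auto)

text \<open>Terms with nonnegative weight are collected in the first measure, the others in the
  second. This is the existence half for the description in \<open>unit_integral\<close>.\<close>

lemma comb_cdf_difference:
  "unit_comb xs \<Longrightarrow> \<exists>M N. unit_measure M \<and> unit_measure N \<and> comb_cdf xs = (\<lambda>x. cdf M x - cdf N x)"
proof (induction xs)
  case Nil
  obtain M where "unit_measure M" "cdf M = (\<lambda>_. 0)"
    by (rule unit_measure_of_cdf[of "\<lambda>_. 0"]) auto
  then show ?case by (auto intro!: exI[of _ M])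
next
  case (Cons y ys)
  obtain a L where y: "y = (a, L)" by (cases y)
  then have L: "unit_measure L" using Cons.prems by auto
  obtain M N where MN: "unit_measure M" "unit_measure N" "comb_cdf ys = (\<lambda>x. cdf M x - cdf N x)"
    using Cons y by auto
  show ?case
  proof (cases "0 \<le> a")
    case True
    obtain P where "unit_measure P" "cdf P = (\<lambda>x. cdf M x + a * cdf L x)"
      by (rule unit_measure_add[OF MN(1) L True])
    then show ?thesis using MN y by (intro exI[of _ P] exI[of _ N]) (simp add: fun_eq_iff)
  next
    case False
    then have "0 \<le> - a" by simp
    obtain P where "unit_measure P" "cdf P = (\<lambda>x. cdf N x + (- a) * cdf L x)"
      by (rule unit_measure_add[OF MN(2) L \<open>0 \<le> - a\<close>])
    then show ?thesis using MN y by (intro exI[of _ M] exI[of _ P]) (simp add: fun_eq_iff)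
  qed
qed

text \<open>The difference of the two lists has distribution function 0, so
  \<open>comb_int_bound\<close> applies with \<open>B = 0\<close>.\<close>

lemma comb_int_eqI:
  assumes "variation g \<le> ereal V" "unit_comb xs" "unit_comb ys" "comb_cdf xs = comb_cdf ys"
  shows "comb_int g xs = comb_int g ys"
  using comb_int_bound[OF assms(1), of "xs @ comb_scale (-1) ys" 0] assms(2-) by simp

text \<open>A decomposition into \<open>M\<close> and \<open>N\<close> is itself the list
  \<open>[(1, M), (-1, N)]\<close>, so uniqueness of the described value is an instance of
  \<open>comb_int_eqI\<close>.\<close>

lemma unit_integral_comb:
  assumes g: "variation g \<le> ereal V" and xs: "unit_comb xs"
  shows "unit_integral g (comb_cdf xs) = comb_int g xs"
proof -
  have eq: "comb_int g xs = set_lebesgue_integral M {0..1} g - set_lebesgue_integral N {0..1} g"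
    if "unit_measure M" "unit_measure N" "comb_cdf xs = (\<lambda>x. cdf M x - cdf N x)" for M N
    using comb_int_eqI[OF g xs, of "[(1, M), (-1, N)]"] that by simp
  show ?thesis unfolding unit_integral_def
    by (rule the_equality) (use comb_cdf_difference[OF xs] eq in \<open>blast, metis\<close>)
qed

definition prob_comb :: "(real \<times> real measure) list \<Rightarrow> bool" where
  "prob_comb xs \<longleftrightarrow> unit_comb xs \<and> (\<forall>(a, M)\<in>set xs. prob_space M)"

section \<open>The span of the distribution functions and its uniform closure\<close>

lemma dist_span_iff: "f \<in> dist_span \<longleftrightarrow> (\<exists>xs. prob_comb xs \<and> f = comb_cdf xs)"
proof
  assume "f \<in> dist_span"
  then obtain n :: nat and a F where f: "f = (\<lambda>x. \<Sum>i<n. a i * F i x)" "\<forall>i<n. F i \<in> dist_funs"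
    unfolding dist_span_def by blast
  then obtain M where M: "\<forall>i<n. unit_measure (M i) \<and> prob_space (M i) \<and> F i = cdf (M i)"
    unfolding dist_funs_def by simp metis
  let ?xs = "map (\<lambda>i. (a i, M i)) [0..<n]"
  have "f x = comb_cdf ?xs x" for x
    unfolding f comb_cdf_def using M
    by (simp add: o_def interv_sum_list_conv_sum_set_nat atLeast0LessThan)
  moreover have "prob_comb ?xs" using M by (auto simp: prob_comb_def unit_comb_def)
  ultimately show "\<exists>xs. prob_comb xs \<and> f = comb_cdf xs" by blast
next
  assume "\<exists>xs. prob_comb xs \<and> f = comb_cdf xs"
  then obtain xs where xs: "prob_comb xs" "f = comb_cdf xs" by blast
  have "f = (\<lambda>x. \<Sum>i<length xs. fst (xs ! i) * cdf (snd (xs ! i)) x)"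
    unfolding xs comb_cdf_def
    by (simp add: fun_eq_iff sum_list_sum_nth atLeast0LessThan case_prod_beta)
  moreover have "cdf (snd (xs ! i)) \<in> dist_funs" if "i < length xs" for i
    using xs(1) nth_mem[OF that] unfolding prob_comb_def unit_comb_def dist_funs_def
    by (cases "xs ! i") auto
  ultimately show "f \<in> dist_span" unfolding dist_span_def
    by (intro CollectI exI[of _ "length xs"] exI[of _ "\<lambda>i. fst (xs ! i)"] exI[of _ "\<lambda>i. cdf (snd (xs ! i))"]) auto
qed

lemma dist_spanE:
  assumes "f \<in> dist_span"
  obtains xs where "unit_comb xs" "f = comb_cdf xs"
  using assms unfolding dist_span_iff prob_comb_def by blast

lemma dist_span_lincomb:
  assumes "f \<in> dist_span" "h \<in> dist_span"
  shows "(\<lambda>x. a * f x + b * h x) \<in> dist_span"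
proof -
  obtain xs ys where xs: "prob_comb xs" "f = comb_cdf xs" and ys: "prob_comb ys" "h = comb_cdf ys"
    using assms unfolding dist_span_iff by blast
  have "prob_comb (comb_scale a xs @ comb_scale b ys)"
    using xs ys unfolding prob_comb_def by (auto simp: comb_scale_def unit_comb_def)
  then show ?thesis unfolding dist_span_iff using xs ys
    by (intro exI[of _ "comb_scale a xs @ comb_scale b ys"]) auto
qed

lemma dist_funs_span: "f \<in> dist_funs \<Longrightarrow> f \<in> dist_span"
  unfolding dist_span_iff dist_funs_def
  by safe (rule_tac x="[(1, M)]" in exI, auto simp: prob_comb_def unit_comb_def fun_eq_iff)

lemma dist_span_zero: "(\<lambda>_. 0) \<in> dist_span"
  unfolding dist_span_iff by (rule exI[of _ "[]"]) (simp add: prob_comb_def)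

lemma dist_span_sum:
  "finite I \<Longrightarrow> (\<And>i. i \<in> I \<Longrightarrow> F i \<in> dist_span) \<Longrightarrow> (\<lambda>x. \<Sum>i\<in>I. a i * F i x) \<in> dist_span"
proof (induction I rule: finite_induct)
  case (insert i I)
  then show ?case using dist_span_lincomb[of "F i" "\<lambda>x. \<Sum>i\<in>I. a i * F i x" "a i" 1] by simp
qed (simp add: dist_span_zero)

lemma dist_space_iff: "f \<in> dist_space \<longleftrightarrow> (\<forall>e>0. \<exists>g\<in>dist_span. \<forall>x. \<bar>g x - f x\<bar> < e)"
proof
  assume "f \<in> dist_space"
  then obtain fs where fs: "\<And>k. fs k \<in> dist_span" "uniform_limit UNIV fs f sequentially"
    unfolding dist_space_def by blast
  show "\<forall>e>0. \<exists>g\<in>dist_span. \<forall>x. \<bar>g x - f x\<bar> < e"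
  proof (intro allI impI)
    fix e :: real assume "e > 0"
    then have "\<forall>\<^sub>F k in sequentially. \<forall>x. \<bar>fs k x - f x\<bar> < e"
      using fs(2) by (auto simp: uniform_limit_iff dist_real_def)
    then show "\<exists>g\<in>dist_span. \<forall>x. \<bar>g x - f x\<bar> < e" using fs(1) by (auto simp: eventually_sequentially)
  qed
next
  assume A: "\<forall>e>0. \<exists>g\<in>dist_span. \<forall>x. \<bar>g x - f x\<bar> < e"
  have "\<forall>k. \<exists>g. g \<in> dist_span \<and> (\<forall>x. \<bar>g x - f x\<bar> < 1 / real (Suc k))"
    using A by (meson of_nat_0_less_iff zero_less_Suc zero_less_divide_1_iff)
  then obtain fs where fs: "\<And>k. fs k \<in> dist_span" "\<And>k x. \<bar>fs k x - f x\<bar> < 1 / real (Suc k)"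
    by metis
  have "uniform_limit UNIV fs f sequentially"
    unfolding uniform_limit_iff
  proof (intro allI impI)
    fix e :: real assume "e > 0"
    then obtain N where N: "N \<noteq> 0" "1 / real N < e" using real_arch_inverse[of e] by (auto simp: inverse_eq_divide)
    have "dist (fs k x) (f x) < e" if "k \<ge> N" for k x
    proof -
      have "1 / real (Suc k) \<le> 1 / real N" using that N by (simp add: frac_le)
      then show ?thesis using fs(2)[of k x] N(2) by (simp add: dist_real_def)
    qed
    then show "\<forall>\<^sub>F k in sequentially. \<forall>x\<in>UNIV. dist (fs k x) (f x) < e"
      unfolding eventually_sequentially by blast
  qed
  then show "f \<in> dist_space" unfolding dist_space_def using fs by blast
qed

lemma dist_span_space: "f \<in> dist_span \<Longrightarrow> f \<in> dist_space"
  unfolding dist_space_iff by (auto intro!: bexI[of _ f])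

lemma dist_spaceE:
  assumes "f \<in> dist_space"
  obtains fs where "\<And>k. fs k \<in> dist_span" "uniform_limit UNIV fs f sequentially"
  using assms unfolding dist_space_def by blast

lemma dist_space_limit:
  assumes "\<And>k. fs k \<in> dist_space" "uniform_limit UNIV fs f sequentially"
  shows "f \<in> dist_space"
  unfolding dist_space_iff
proof (intro allI impI)
  fix e :: real assume e: "e > 0"
  then have "\<forall>\<^sub>F k in sequentially. \<forall>x. \<bar>fs k x - f x\<bar> < e / 2"
    using assms(2) by (auto simp: uniform_limit_iff dist_real_def elim!: allE[of _ "e/2"])
  then obtain k where k: "\<And>x. \<bar>fs k x - f x\<bar> < e / 2" by (auto simp: eventually_sequentially)
  obtain g where g: "g \<in> dist_span" "\<And>x. \<bar>g x - fs k x\<bar> < e / 2"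
    using assms(1)[of k] e unfolding dist_space_iff by (meson half_gt_zero)
  have "\<bar>g x - f x\<bar> < e" for x using k[of x] g(2)[of x] by linarith
  then show "\<exists>g\<in>dist_span. \<forall>x. \<bar>g x - f x\<bar> < e" using g(1) by blast
qed

lemma uniform_limit_lincomb:
  fixes f h :: "real \<Rightarrow> real"
  assumes "uniform_limit UNIV fs f sequentially" "uniform_limit UNIV hs h sequentially"
  shows "uniform_limit UNIV (\<lambda>k x. a * fs k x + b * hs k x) (\<lambda>x. a * f x + b * h x) sequentially"
  by (intro uniform_limit_intros bounded_linear.uniform_limit[OF bounded_linear_mult_right] assms)

lemma dist_space_lincomb:
  assumes "f \<in> dist_space" "h \<in> dist_space"
  shows "(\<lambda>x. a * f x + b * h x) \<in> dist_space"
proof -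
  obtain fs where fs: "\<And>k. fs k \<in> dist_span" "uniform_limit UNIV fs f sequentially"
    using dist_spaceE[OF assms(1)] by blast
  obtain hs where hs: "\<And>k. hs k \<in> dist_span" "uniform_limit UNIV hs h sequentially"
    using dist_spaceE[OF assms(2)] by blast
  show ?thesis
    by (rule dist_space_limit[OF _ uniform_limit_lincomb[OF fs(2) hs(2)]])
      (intro dist_span_space dist_span_lincomb fs hs)
qed

lemma dist_space_diff: "f \<in> dist_space \<Longrightarrow> h \<in> dist_space \<Longrightarrow> (\<lambda>x. f x - h x) \<in> dist_space"
  using dist_space_lincomb[of f h 1 "-1"] by simp

lemma comb_cdf_bounded:
  assumes "unit_comb xs"
  shows "\<exists>B. \<forall>x. \<bar>comb_cdf xs x\<bar> \<le> B"
proof -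
  obtain M N where MN: "unit_measure M" "unit_measure N" "comb_cdf xs = (\<lambda>x. cdf M x - cdf N x)"
    using comb_cdf_difference[OF assms] by blast
  have b: "0 \<le> cdf L x" "cdf L x \<le> measure L UNIV" if "unit_measure L" for L x
  proof -
    interpret finite_borel_measure L using unit_measureD(1)[OF that] .
    show "0 \<le> cdf L x" "cdf L x \<le> measure L UNIV" using cdf_nonneg cdf_bounded[of x] borel_UNIV by auto
  qed
  have "\<bar>comb_cdf xs x\<bar> \<le> measure M UNIV + measure N UNIV" for x
    using b[OF MN(1), of x] b[OF MN(2), of x] unfolding MN(3) by linarith
  then show ?thesis by blast
qed

lemma dist_space_bounded:
  assumes "f \<in> dist_space"
  shows "\<exists>B. \<forall>x. \<bar>f x\<bar> \<le> B"
proof -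
  obtain g where g: "g \<in> dist_span" "\<And>x. \<bar>g x - f x\<bar> < 1"
    using assms zero_less_one unfolding dist_space_iff by blast
  obtain xs where xs: "unit_comb xs" "g = comb_cdf xs" by (rule dist_spanE[OF g(1)])
  obtain B where B: "\<And>x. \<bar>g x\<bar> \<le> B" using comb_cdf_bounded[OF xs(1)] xs(2) by blast
  have "\<bar>f x\<bar> \<le> B + 1" for x using g(2)[of x] B[of x] by linarith
  then show ?thesis by blast
qed

section \<open>The supremum norm and the integral on the closure\<close>

lemma supnorm_upper:
  assumes "\<forall>x. \<bar>f x\<bar> \<le> B"
  shows "\<bar>f x\<bar> \<le> supnorm f"
  unfolding supnorm_def by (rule cSUP_upper) (use assms in \<open>auto intro!: bdd_aboveI2\<close>)

lemma supnorm_least: "(\<And>x. \<bar>f x\<bar> \<le> B) \<Longrightarrow> supnorm f \<le> B"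
  unfolding supnorm_def by (rule cSUP_least) auto

lemma dist_space_supnorm: "f \<in> dist_space \<Longrightarrow> \<bar>f x\<bar> \<le> supnorm f"
  using dist_space_bounded[of f] supnorm_upper by blast

text \<open>The operator of \<open>\<tau>\<close> at \<open>f\<close> and \<open>x\<close> only depends on \<open>f\<close> and the section \<open>\<tau> x\<close>.\<close>

definition ext_integral :: "(real \<Rightarrow> real) \<Rightarrow> (real \<Rightarrow> real) \<Rightarrow> real" where
  "ext_integral g f = kernel_op (\<lambda>_. g) f 0"

lemma kernel_op_ext: "kernel_op \<tau> f x = ext_integral (\<tau> x) f"
  by (simp add: kernel_op_def ext_integral_def)

lemma ext_integral_unit: "f \<in> dist_span \<Longrightarrow> ext_integral g f = unit_integral g f"
  by (simp add: kernel_op_def ext_integral_def)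

lemma ext_integral_comb:
  assumes "variation g \<le> ereal V" "unit_comb xs" "comb_cdf xs \<in> dist_span"
  shows "ext_integral g (comb_cdf xs) = comb_int g xs"
  using unit_integral_comb[OF assms(1,2)] ext_integral_unit[OF assms(3)] by simp

lemma ext_integral_cong:
  assumes "\<And>u. u \<in> {0..1} \<Longrightarrow> g u = g' u"
  shows "ext_integral g = ext_integral g'"
proof -
  have "set_lebesgue_integral M {0..1} g = set_lebesgue_integral M {0..1} g'" for M :: "real measure"
    unfolding set_lebesgue_integral_def
    by (rule Bochner_Integration.integral_cong) (use assms in \<open>auto simp: indicator_def\<close>)
  then have "unit_integral g = unit_integral g'" by (simp add: unit_integral_def fun_eq_iff)
  then show ?thesis by (simp add: ext_integral_def kernel_op_def fun_eq_iff)
qed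

lemma ext_integral_span_lincomb:
  assumes g: "variation g \<le> ereal V" and f: "f \<in> dist_span" and h: "h \<in> dist_span"
  shows "ext_integral g (\<lambda>x. a * f x + b * h x) = a * ext_integral g f + b * ext_integral g h"
proof -
  obtain xs where xs: "unit_comb xs" "f = comb_cdf xs" by (rule dist_spanE[OF f])
  obtain ys where ys: "unit_comb ys" "h = comb_cdf ys" by (rule dist_spanE[OF h])
  let ?zs = "comb_scale a xs @ comb_scale b ys"
  have z: "(\<lambda>x. a * f x + b * h x) = comb_cdf ?zs" using xs ys by auto
  have "ext_integral g (comb_cdf ?zs) = comb_int g ?zs"
    by (rule ext_integral_comb[OF g]) (use xs ys dist_span_lincomb[OF f h, of a b] z in auto)
  then show ?thesis
    using ext_integral_comb[OF g xs(1)] ext_integral_comb[OF g ys(1)] xs ys z f h by simp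
qed

lemma ext_integral_span_bound:
  assumes g: "variation g \<le> ereal V" and f: "f \<in> dist_span" and B: "\<And>x. \<bar>f x\<bar> \<le> B"
  shows "\<bar>ext_integral g f\<bar> \<le> (\<bar>g 1\<bar> + 3 * V) * B"
proof -
  obtain xs where xs: "unit_comb xs" "f = comb_cdf xs" by (rule dist_spanE[OF f])
  show ?thesis using comb_int_bound[OF g xs(1)] B ext_integral_comb[OF g xs(1)] xs f by simp
qed

lemma ext_integral_span_diff:
  assumes g: "variation g \<le> ereal V" and f: "f \<in> dist_span" and h: "h \<in> dist_span"
    and B: "\<And>x. \<bar>f x - h x\<bar> \<le> B"
  shows "\<bar>ext_integral g f - ext_integral g h\<bar> \<le> (\<bar>g 1\<bar> + 3 * V) * B"
  using ext_integral_span_bound[OF g dist_span_lincomb[OF f h, of 1 "-1"], of B] B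
    ext_integral_span_lincomb[OF g f h, of 1 "-1"] by simp

text \<open>By the bound above, integrals of approximating sequences are Cauchy, and their limit
  does not depend on the sequence.\<close>

lemma ext_integral_limit:
  assumes g: "variation g \<le> ereal V" and f: "f \<in> dist_space"
    and fs: "\<And>k. fs k \<in> dist_span" "uniform_limit UNIV fs f sequentially"
  shows "(\<lambda>k. ext_integral g (fs k)) \<longlonglongrightarrow> ext_integral g f"
proof -
  \<comment> \<open>The summand 1 makes \<open>C\<close> positive, so that one may divide by
    it.\<close>
  define C where "C = \<bar>g 1\<bar> + 3 * V + 1"
  have C: "C > 0" using variation_le_nonneg[OF g] by (simp add: C_def)
  have close: "\<bar>ext_integral g h - ext_integral g h'\<bar> \<le> C * B"
    if "h \<in> dist_span" "h' \<in> dist_span" "\<And>x. \<bar>h x - h' x\<bar> \<le> B" for h h' B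
  proof -
    have "0 \<le> B" using that(3)[of 0] by linarith
    then show ?thesis using ext_integral_span_diff[OF g that] by (simp add: C_def algebra_simps)
  qed
  have ev: "\<forall>\<^sub>F k in sequentially. \<forall>x. \<bar>hs k x - f x\<bar> \<le> e"
    if "uniform_limit UNIV hs f sequentially" "e > 0" for hs e
    using uniform_limitD[OF that] by eventually_elim (auto simp: dist_real_def less_imp_le)
  show ?thesis
  proof (cases "f \<in> dist_span")
    case True
    show ?thesis
    proof (rule tendstoI)
      fix e :: real assume "e > 0"
      then have e: "e / (2 * C) > 0" using C by simp
      show "\<forall>\<^sub>F k in sequentially. dist (ext_integral g (fs k)) (ext_integral g f) < e"
        using ev[OF fs(2) e]
      proof eventually_elim
        case (elim k)
        then have "\<bar>ext_integral g (fs k) - ext_integral g f\<bar> \<le> C * (e / (2 * C))"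
          using close[OF fs(1) True] by blast
        also have "\<dots> < e" using C \<open>e > 0\<close> by simp
        finally show ?case by (simp add: dist_real_def)
      qed
    qed
  next
    case False
    have close_seq: "\<forall>\<^sub>F k in sequentially. \<forall>\<^sub>F m in sequentially. \<bar>ext_integral g (hs k) - ext_integral g (hs' m)\<bar> < e"
      if hs: "\<And>k. hs k \<in> dist_span" "uniform_limit UNIV hs f sequentially"
        "\<And>k. hs' k \<in> dist_span" "uniform_limit UNIV hs' f sequentially" and e: "e > 0" for hs hs' e
    proof -
      have e': "e / (4 * C) > 0" using C e by simp
      show ?thesis using ev[OF hs(2) e']
      proof eventually_elim
        case k: (elim k)
        show ?case using ev[OF hs(4) e']
        proof eventually_elim
          case m: (elim m)
          have "\<bar>hs k x - hs' m x\<bar> \<le> e / (2 * C)" for x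
          proof -
            have "\<bar>hs k x - hs' m x\<bar> \<le> e / (4 * C) + e / (4 * C)" using spec[OF k, of x] spec[OF m, of x] by linarith
            also have "\<dots> = e / (2 * C)" by simp
            finally show ?thesis .
          qed
          then have "\<bar>ext_integral g (hs k) - ext_integral g (hs' m)\<bar> \<le> C * (e / (2 * C))"
            using close[OF hs(1) hs(3)] by blast
          also have "\<dots> < e" using C \<open>e > 0\<close> by simp
          finally show ?case .
        qed
      qed
    qed
    have "Cauchy (\<lambda>k. ext_integral g (fs k))"
    proof (rule metric_CauchyI)
      fix e :: real assume "e > 0"
      then have e': "e / (4 * C) > 0" using C by simp
      obtain N where N: "\<And>k x. k \<ge> N \<Longrightarrow> \<bar>fs k x - f x\<bar> \<le> e / (4 * C)"
        using ev[OF fs(2) e'] unfolding eventually_sequentially by blast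
      have "dist (ext_integral g (fs k)) (ext_integral g (fs m)) < e" if "k \<ge> N" "m \<ge> N" for k m
      proof -
        have "\<bar>fs k x - fs m x\<bar> \<le> e / (2 * C)" for x
        proof -
          have "\<bar>fs k x - fs m x\<bar> \<le> e / (4 * C) + e / (4 * C)"
            using N[OF that(1), of x] N[OF that(2), of x] by linarith
          also have "\<dots> = e / (2 * C)" by simp
          finally show ?thesis .
        qed
        then have "\<bar>ext_integral g (fs k) - ext_integral g (fs m)\<bar> \<le> C * (e / (2 * C))"
          using close[OF fs(1) fs(1)] by blast
        also have "\<dots> < e" using C \<open>e > 0\<close> by simp
        finally show ?thesis by (simp add: dist_real_def)
      qed
      then show "\<exists>N. \<forall>m\<ge>N. \<forall>n\<ge>N. dist (ext_integral g (fs m)) (ext_integral g (fs n)) < e" by blast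
    qed
    then obtain l where l: "(\<lambda>k. ext_integral g (fs k)) \<longlonglongrightarrow> l"
      using Cauchy_convergent_iff convergent_def by blast
    \<comment> \<open>Comparing an arbitrary approximating sequence with \<open>fs\<close> shows
      that all of them have the limit \<open>l\<close>; this is what the definite description in
      \<open>kernel_op\<close> asks for.\<close>
    have l': "(\<lambda>k. ext_integral g (hs k)) \<longlonglongrightarrow> l"
      if hs: "\<And>k. hs k \<in> dist_span" "uniform_limit UNIV hs f sequentially" for hs
    proof (rule tendstoI)
      fix e :: real assume "e > 0"
      then have e2: "e / 2 > 0" by simp
      show "\<forall>\<^sub>F k in sequentially. dist (ext_integral g (hs k)) l < e"
        using close_seq[OF hs fs e2]
      proof eventually_elim
        case (elim k)
        have "((\<lambda>m. \<bar>ext_integral g (hs k) - ext_integral g (fs m)\<bar>) \<longlonglongrightarrow> \<bar>ext_integral g (hs k) - l\<bar>)"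
          by (intro tendsto_intros l)
        then have "\<bar>ext_integral g (hs k) - l\<bar> \<le> e / 2"
          by (rule tendsto_upperbound) (use elim in \<open>auto elim!: eventually_mono\<close>)
        then show ?case using \<open>e > 0\<close> by (simp add: dist_real_def)
      qed
    qed
    have "ext_integral g f = (THE l. \<forall>fs. (\<forall>k. fs k \<in> dist_span) \<and> uniform_limit UNIV fs f sequentially \<longrightarrow>
            (\<lambda>k. unit_integral g (fs k)) \<longlonglongrightarrow> l)"
      using False by (simp add: ext_integral_def kernel_op_def)
    also have "\<dots> = l"
    proof (rule the_equality, intro allI impI)
      fix hs assume "(\<forall>k. hs k \<in> dist_span) \<and> uniform_limit UNIV hs f sequentially"
      then show "(\<lambda>k. unit_integral g (hs k)) \<longlonglongrightarrow> l" using l'[of hs] by (simp add: ext_integral_unit)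
    next
      fix l2 assume "\<forall>fs. (\<forall>k. fs k \<in> dist_span) \<and> uniform_limit UNIV fs f sequentially \<longrightarrow>
            (\<lambda>k. unit_integral g (fs k)) \<longlonglongrightarrow> l2"
      then have "(\<lambda>k. unit_integral g (fs k)) \<longlonglongrightarrow> l2" using fs by blast
      then show "l2 = l" using l LIMSEQ_unique fs(1) by (simp add: ext_integral_unit)
    qed
    finally show ?thesis using l by simp
  qed
qed

lemma ext_integral_lincomb:
  assumes g: "variation g \<le> ereal V" and f: "f \<in> dist_space" and h: "h \<in> dist_space"
  shows "ext_integral g (\<lambda>x. a * f x + b * h x) = a * ext_integral g f + b * ext_integral g h"
proof -
  obtain fs where fs: "\<And>k. fs k \<in> dist_span" "uniform_limit UNIV fs f sequentially"
    using dist_spaceE[OF f] by blast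
  obtain hs where hs: "\<And>k. hs k \<in> dist_span" "uniform_limit UNIV hs h sequentially"
    using dist_spaceE[OF h] by blast
  have "(\<lambda>k. ext_integral g (\<lambda>x. a * fs k x + b * hs k x)) \<longlonglongrightarrow> ext_integral g (\<lambda>x. a * f x + b * h x)"
    by (intro ext_integral_limit[OF g] dist_space_lincomb dist_span_lincomb uniform_limit_lincomb f h fs hs)
  moreover have "(\<lambda>k. ext_integral g (\<lambda>x. a * fs k x + b * hs k x)) \<longlonglongrightarrow> a * ext_integral g f + b * ext_integral g h"
    unfolding ext_integral_span_lincomb[OF g fs(1) hs(1)]
    by (intro tendsto_intros ext_integral_limit[OF g] f h fs hs)
  ultimately show ?thesis by (rule LIMSEQ_unique)
qed

lemma ext_integral_bound:
  assumes g: "variation g \<le> ereal V" and f: "f \<in> dist_space" and B: "\<And>x. \<bar>f x\<bar> \<le> B"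
  shows "\<bar>ext_integral g f\<bar> \<le> (\<bar>g 1\<bar> + 3 * V) * B"
proof -
  let ?C = "\<bar>g 1\<bar> + 3 * V"
  obtain fs where fs: "\<And>k. fs k \<in> dist_span" "uniform_limit UNIV fs f sequentially"
    using dist_spaceE[OF f] by blast
  have le: "\<bar>ext_integral g f\<bar> \<le> ?C * (B + e)" if "e > 0" for e
  proof (rule tendsto_upperbound)
    show "(\<lambda>k. \<bar>ext_integral g (fs k)\<bar>) \<longlonglongrightarrow> \<bar>ext_integral g f\<bar>"
      by (intro tendsto_intros ext_integral_limit[OF g] f fs)
    show "\<forall>\<^sub>F k in sequentially. \<bar>ext_integral g (fs k)\<bar> \<le> ?C * (B + e)"
      using uniform_limitD[OF fs(2) that]
    proof eventually_elim
      case (elim k)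
      have "\<bar>fs k x\<bar> \<le> B + e" for x using bspec[OF elim, of x] B[of x] by (simp add: dist_real_def abs_less_iff abs_le_iff)
      then show ?case by (rule ext_integral_span_bound[OF g fs(1)])
    qed
  qed simp
  have "((\<lambda>e. ?C * (B + e)) \<longlongrightarrow> ?C * (B + 0)) (at_right 0)" by (intro tendsto_intros)
  then have "\<bar>ext_integral g f\<bar> \<le> ?C * (B + 0)"
    by (rule tendsto_lowerbound) (auto simp: eventually_at_right_less intro!: eventually_mono[OF eventually_at_right_less le])
  then show ?thesis by simp
qed

lemma ext_integral_lincomb_integrand:
  assumes g: "variation g \<le> ereal V" and g': "variation g' \<le> ereal W" and f: "f \<in> dist_space"
  shows "ext_integral (\<lambda>u. a * g u + b * g' u) f = a * ext_integral g f + b * ext_integral g' f"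
proof -
  obtain fs where fs: "\<And>k. fs k \<in> dist_span" "uniform_limit UNIV fs f sequentially"
    using dist_spaceE[OF f] by blast
  note v = variation_lincomb[OF g g', of a b]
  have "ext_integral (\<lambda>u. a * g u + b * g' u) (fs k) = a * ext_integral g (fs k) + b * ext_integral g' (fs k)" for k
  proof -
    obtain xs where xs: "unit_comb xs" "fs k = comb_cdf xs" by (rule dist_spanE[OF fs(1)])
    then show ?thesis
      using comb_int_lincomb[OF g g' xs(1), of a b] fs(1)[of k]
      by (simp add: ext_integral_comb[OF v] ext_integral_comb[OF g] ext_integral_comb[OF g'])
  qed
  then have "(\<lambda>k. ext_integral (\<lambda>u. a * g u + b * g' u) (fs k)) \<longlonglongrightarrow> a * ext_integral g f + b * ext_integral g' f"
    by (simp, intro tendsto_intros ext_integral_limit[OF g] ext_integral_limit[OF g'] f fs)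
  then show ?thesis using ext_integral_limit[OF v f fs] LIMSEQ_unique by blast
qed

lemma variation_const: "variation (\<lambda>_. c) \<le> ereal 0"
  unfolding variation_le_iff by simp

lemma ext_integral_const:
  assumes f: "f \<in> dist_space"
  shows "ext_integral (\<lambda>_. c) f = c * f 1"
proof -
  obtain fs where fs: "\<And>k. fs k \<in> dist_span" "uniform_limit UNIV fs f sequentially"
    using dist_spaceE[OF f] by blast
  have "ext_integral (\<lambda>_. c) (fs k) = c * fs k 1" for k
  proof -
    obtain xs where xs: "unit_comb xs" "fs k = comb_cdf xs" by (rule dist_spanE[OF fs(1)])
    then show ?thesis using ext_integral_comb[OF variation_const xs(1)] comb_int_const fs(1)[of k] by simp
  qed
  moreover have "(\<lambda>k. c * fs k 1) \<longlonglongrightarrow> c * f 1"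
    by (intro tendsto_intros tendsto_uniform_limitI[OF fs(2)]) simp
  ultimately show ?thesis using ext_integral_limit[OF variation_const f fs, of c] LIMSEQ_unique by simp
qed

lemma variation_atMost: "variation (\<lambda>u. of_bool (u \<le> c)) \<le> ereal 1"
  by (rule order_trans[OF variation_antimono]) (auto simp: antimono_def)

text \<open>Evaluation at \<open>c\<close> survives the passage to the closure, where no measure
  need stand behind \<open>f\<close>. Integrals of step functions thereby become finite expressions
  in values of \<open>f\<close>.\<close>

lemma ext_integral_atMost:
  assumes f: "f \<in> dist_space" and c: "0 \<le> c" "c \<le> 1"
  shows "ext_integral (\<lambda>u. of_bool (u \<le> c)) f = f c"
proof -
  obtain fs where fs: "\<And>k. fs k \<in> dist_span" "uniform_limit UNIV fs f sequentially"
    using dist_spaceE[OF f] by blast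
  have "comb_int (\<lambda>u. of_bool (u \<le> c)) xs = comb_cdf xs c" if "unit_comb xs" for xs
    using that
  proof (induction xs)
    case (Cons y ys)
    obtain a M where y: "y = (a, M)" by (cases y)
    then have M: "unit_measure M" using Cons.prems by auto
    interpret finite_borel_measure M using unit_measureD(1)[OF M] .
    have [measurable]: "{0..c} \<in> sets M" using M_is_borel by auto
    have "set_lebesgue_integral M {0..1} (\<lambda>u. of_bool (u \<le> c)) = (LINT u|M. indicator {0..c} u)"
      unfolding set_lebesgue_integral_def
      by (rule Bochner_Integration.integral_cong) (use c in \<open>auto simp: indicator_def\<close>)
    also have "\<dots> = cdf M c" using cdf_unit(3)[OF M, of c] c by (simp add: borel_UNIV)
    finally show ?case using Cons y by simp
  qed simp
  note comb = this
  have "ext_integral (\<lambda>u. of_bool (u \<le> c)) (fs k) = fs k c" for k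
  proof -
    obtain xs where xs: "unit_comb xs" "fs k = comb_cdf xs" by (rule dist_spanE[OF fs(1)])
    then show ?thesis
      using ext_integral_comb[OF variation_atMost xs(1)] comb[OF xs(1)] fs(1)[of k] by simp
  qed
  moreover have "(\<lambda>k. fs k c) \<longlonglongrightarrow> f c"
    by (intro tendsto_uniform_limitI[OF fs(2)]) simp
  ultimately show ?thesis 
    using LIMSEQ_unique[OF ext_integral_limit[OF variation_atMost f fs, of c]] by simp
qed

lemma comb_int_tendsto:
  assumes gr: "\<And>r. variation (gr r) \<le> ereal V" "\<And>r. \<bar>gr r 1\<bar> \<le> b" and g: "variation g \<le> ereal W"
    and lim: "\<And>u. u \<in> {0..1} \<Longrightarrow> (\<lambda>r. gr r u) \<longlonglongrightarrow> g u" and xs: "unit_comb xs"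
  shows "(\<lambda>r. comb_int (gr r) xs) \<longlonglongrightarrow> comb_int g xs"
  using xs
proof (induction xs)
  case (Cons y ys)
  obtain a M where y: "y = (a, M)" by (cases y)
  then have M: "unit_measure M" using Cons.prems by auto
  interpret finite_borel_measure M using unit_measureD(1)[OF M] .
  have "(\<lambda>r. set_lebesgue_integral M {0..1} (gr r)) \<longlonglongrightarrow> set_lebesgue_integral M {0..1} g"
    unfolding set_lebesgue_integral_def
  proof (rule integral_dominated_convergence[where w="\<lambda>_. b + V"])
    show "(\<lambda>u. indicator {0..1} u *\<^sub>R g u) \<in> borel_measurable M"
      using set_integrable_variation[OF g M] unfolding set_integrable_def by auto
    show "(\<lambda>u. indicator {0..1} u *\<^sub>R gr r u) \<in> borel_measurable M" for r
      using set_integrable_variation[OF gr(1) M] unfolding set_integrable_def by auto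
    show "AE u in M. (\<lambda>r. indicator {0..1} u *\<^sub>R gr r u) \<longlonglongrightarrow> indicator {0..1} u *\<^sub>R g u"
      by (rule AE_I2) (auto simp: indicator_def intro!: lim)
    show "AE u in M. norm (indicator {0..1} u *\<^sub>R gr r u) \<le> b + V" for r
    proof (rule AE_I2)
      fix u :: real
      have "0 \<le> V" by (rule variation_le_nonneg[OF gr(1)])
      then show "norm (indicator {0..1} u *\<^sub>R gr r u) \<le> b + V"
        using variation_bounds[OF gr(1)[of r], of u 1] gr(2)[of r] by (auto simp: indicator_def)
    qed
  qed simp
  then show ?case using Cons y by (auto intro!: tendsto_intros)
qed simp

text \<open>Dominated convergence handles the span; the common bound on the variations makes the
  functionals equicontinuous and carries the limit over to the closure. The convergence is for fixed
  \<open>f\<close>, not uniform over a ball.\<close>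

lemma ext_integral_tendsto:
  assumes gr: "\<And>r. variation (gr r) \<le> ereal V" "\<And>r. \<bar>gr r 1\<bar> \<le> b" and g: "variation g \<le> ereal W"
    and lim: "\<And>u. u \<in> {0..1} \<Longrightarrow> (\<lambda>r. gr r u) \<longlonglongrightarrow> g u" and f: "f \<in> dist_space"
  shows "(\<lambda>r. ext_integral (gr r) f) \<longlonglongrightarrow> ext_integral g f"
proof (rule tendstoI)
  fix e :: real assume e: "e > 0"
  have V0: "0 \<le> V" by (rule variation_le_nonneg[OF gr(1)])
  have W0: "0 \<le> W" by (rule variation_le_nonneg[OF g])
  have b0: "0 \<le> b" using gr(2)[of 0] by linarith
  define C where "C = max (b + 3 * V) (\<bar>g 1\<bar> + 3 * W) + 1"
  have C: "C > 0" using V0 b0 by (simp add: C_def max_def)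
  have "e / (4 * C) > 0" using e C by simp
  then obtain h where h: "h \<in> dist_span" "\<And>x. \<bar>h x - f x\<bar> < e / (4 * C)"
    using f unfolding dist_space_iff by blast
  have hd: "h \<in> dist_space" by (rule dist_span_space[OF h(1)])
  have approx: "\<bar>ext_integral k h - ext_integral k f\<bar> \<le> e / 4"
    if k: "variation k \<le> ereal U" "\<bar>k 1\<bar> + 3 * U \<le> C" for k U
  proof -
    have "\<bar>ext_integral k (\<lambda>x. 1 * h x + (-1) * f x)\<bar> \<le> (\<bar>k 1\<bar> + 3 * U) * (e / (4 * C))"
      by (rule ext_integral_bound[OF k(1) dist_space_lincomb[OF hd f]]) (use h(2) in \<open>auto intro: less_imp_le\<close>)
    also have "\<dots> \<le> C * (e / (4 * C))" by (rule mult_right_mono[OF k(2)]) (use e C in auto)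
    also have "\<dots> = e / 4" using C by simp
    finally show ?thesis unfolding ext_integral_lincomb[OF k(1) hd f] by simp
  qed
  have "(\<lambda>r. ext_integral (gr r) h) \<longlonglongrightarrow> ext_integral g h"
  proof -
    obtain xs where xs: "unit_comb xs" "h = comb_cdf xs" by (rule dist_spanE[OF h(1)])
    show ?thesis using comb_int_tendsto[OF gr g lim xs(1)] xs h(1)
      by (simp add: ext_integral_comb[OF gr(1)] ext_integral_comb[OF g])
  qed
  then have "\<forall>\<^sub>F r in sequentially. dist (ext_integral (gr r) h) (ext_integral g h) < e / 4"
    using e by (intro tendstoD) auto
  then show "\<forall>\<^sub>F r in sequentially. dist (ext_integral (gr r) f) (ext_integral g f) < e"
  proof eventually_elim
    case (elim r)
    have "\<bar>gr r 1\<bar> + 3 * V \<le> C" using gr(2)[of r] by (simp add: C_def max_def)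
    moreover have "\<bar>g 1\<bar> + 3 * W \<le> C" by (simp add: C_def max_def)
    ultimately have "\<bar>ext_integral (gr r) h - ext_integral (gr r) f\<bar> \<le> e / 4"
      "\<bar>ext_integral g h - ext_integral g f\<bar> \<le> e / 4"
      using approx[OF gr(1)] approx[OF g] by blast+
    then show ?case using elim e unfolding dist_real_def by linarith
  qed
qed

section \<open>Kernel operators\<close>

text \<open>Gaussian elimination, one column per induction step: row \<open>l\<close> is the pivot
  row for column \<open>k\<close>, and \<open>A'\<close> is the reduced matrix. It inherits
  injectivity because its null vectors extend to null vectors of \<open>A\<close>.\<close>

lemma square_system_solvable:
  fixes A :: "'b \<Rightarrow> 'a \<Rightarrow> real"
  assumes "finite C" "finite R" "card R = card C"
    and "\<And>z. (\<And>j. j \<in> R \<Longrightarrow> (\<Sum>i\<in>C. A j i * z i) = 0) \<Longrightarrow> \<forall>i\<in>C. z i = 0"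
  shows "\<exists>z. \<forall>j\<in>R. (\<Sum>i\<in>C. A j i * z i) = b j"
  using assms
proof (induction C arbitrary: R A b rule: finite_induct)
  case (insert k C)
  note inj = insert.prems(3)
  \<comment> \<open>Otherwise the unit vector of column \<open>k\<close> would be a nonzero null
    vector.\<close>
  have "\<exists>j\<in>R. A j k \<noteq> 0"
  proof (rule ccontr)
    assume no: "\<not> ?thesis"
    have "\<forall>i\<in>insert k C. of_bool (i = k) = (0 :: real)"
    proof (rule inj)
      fix j assume "j \<in> R"
      then show "(\<Sum>i\<in>insert k C. A j i * of_bool (i = k)) = 0"
        using no by (intro sum.neutral) auto
    qed
    then show False by simp
  qed
  then obtain l where l: "l \<in> R" "A l k \<noteq> 0" by blast
  define A' where "A' j i = A j i - A j k / A l k * A l i" for j i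
  \<comment> \<open>Back substitution: the entry at \<open>k\<close> is chosen so that the pivot row
    takes the value \<open>d\<close>.\<close>
  define y where "y d z = (\<lambda>i. if i = k then (d - (\<Sum>i\<in>C. A l i * z i)) / A l k else z i)" for d :: real and z
  have on_C: "(\<Sum>i\<in>C. A j i * y d z i) = (\<Sum>i\<in>C. A j i * z i)" for j d z
    using insert.hyps by (intro sum.cong) (auto simp: y_def)
  have y_l: "(\<Sum>i\<in>insert k C. A l i * y d z i) = d" for d z
    using insert.hyps l(2) by (simp add: on_C) (simp add: y_def)
  have y_j: "(\<Sum>i\<in>insert k C. A j i * y d z i) = (\<Sum>i\<in>C. A' j i * z i) + A j k / A l k * d" for j d z
  proof -
    have "(\<Sum>i\<in>C. A' j i * z i) = (\<Sum>i\<in>C. A j i * z i) - A j k / A l k * (\<Sum>i\<in>C. A l i * z i)"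
      by (simp add: A'_def left_diff_distrib sum_subtractf sum_distrib_left mult.assoc)
    then show ?thesis
      using insert.hyps l(2) by (simp add: on_C) (simp add: y_def diff_divide_distrib algebra_simps)
  qed
  have "\<exists>z. \<forall>j\<in>R - {l}. (\<Sum>i\<in>C. A' j i * z i) = b j - A j k / A l k * b l"
  proof (rule insert.IH)
    show "finite (R - {l})" "card (R - {l}) = card C" using insert.prems insert.hyps l(1) by simp_all
    fix z assume z: "\<And>j. j \<in> R - {l} \<Longrightarrow> (\<Sum>i\<in>C. A' j i * z i) = 0"
    have "\<forall>i\<in>insert k C. y 0 z i = 0"
    proof (rule inj)
      fix j assume "j \<in> R"
      then show "(\<Sum>i\<in>insert k C. A j i * y 0 z i) = 0"
        using y_l[of 0 z] y_j[of j 0 z] z[of j] by (cases "j = l") auto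
    qed
    then show "\<forall>i\<in>C. z i = 0" using insert.hyps by (auto simp: y_def split: if_splits)
  qed
  then obtain z where z: "\<forall>j\<in>R - {l}. (\<Sum>i\<in>C. A' j i * z i) = b j - A j k / A l k * b l" by blast
  have "(\<Sum>i\<in>insert k C. A j i * y (b l) z i) = b j" if "j \<in> R" for j
  proof (cases "j = l")
    case False
    then show ?thesis using y_j[of j "b l" z] bspec[OF z, of j] that by simp
  qed (simp only: y_l)
  then show ?case by blast
qed simp

text \<open>The properties shared by \<kappa> and all chain kernels. The values for
  \<open>x < 0\<close> and \<open>1 \<le> x\<close> are recorded because the operators produce
  functions on the whole line, and the supremum norm looks at all of it.\<close>

definition regular_kernel :: "(real \<Rightarrow> real \<Rightarrow> real) \<Rightarrow> real \<Rightarrow> bool" where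
  "regular_kernel \<tau> V \<longleftrightarrow> (\<forall>x. variation (\<tau> x) \<le> ereal V) \<and>
     (\<forall>x u. u \<in> {0..1} \<longrightarrow> (x < 0 \<longrightarrow> \<tau> x u = 0) \<and> (1 \<le> x \<longrightarrow> \<tau> x u = 1) \<and> \<bar>\<tau> x u\<bar> \<le> 1)"

lemma dist_funs_dist_space: "f \<in> dist_funs \<Longrightarrow> f \<in> dist_space"
  by (intro dist_span_space dist_funs_span)

lemma dist_funs_props:
  assumes "f \<in> dist_funs"
  shows "x < 0 \<Longrightarrow> f x = 0" "1 \<le> x \<Longrightarrow> f x = 1" "0 \<le> f x" "f x \<le> 1"
proof -
  obtain M where M: "unit_measure M" "prob_space M" "f = cdf M" using assms unfolding dist_funs_def by blast
  interpret prob_space M by (rule M(2))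
  have "f y = 1" if "1 \<le> y" for y
    using cdf_unit(2)[OF M(1) that] unit_measure_Int[OF M(1), of UNIV] M(3) prob_space
      unit_measureD(4)[OF M(1)] by simp
  then show "1 \<le> x \<Longrightarrow> f x = 1" .
  show "x < 0 \<Longrightarrow> f x = 0" using cdf_unit(1)[OF M(1)] M(3) by simp
  show "0 \<le> f x" "f x \<le> 1" unfolding M(3) cdf_def by (simp_all add: prob_le_1)
qed

lemma shifted_kernel_section: "shifted_kernel \<tau> x = (\<lambda>u. of_bool (x \<ge> 0) + \<tau> x u)"
  by (simp add: shifted_kernel_def fun_eq_iff)

context
  fixes \<tau> V assumes reg: "regular_kernel \<tau> V"
begin

lemma regular_kernelD:
  "variation (\<tau> x) \<le> ereal V" "x < 0 \<Longrightarrow> u \<in> {0..1} \<Longrightarrow> \<tau> x u = 0"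
  "1 \<le> x \<Longrightarrow> u \<in> {0..1} \<Longrightarrow> \<tau> x u = 1" "u \<in> {0..1} \<Longrightarrow> \<bar>\<tau> x u\<bar> \<le> 1"
  using reg unfolding regular_kernel_def by auto

lemma regular_kernel_nonneg: "0 \<le> V"
  by (rule variation_le_nonneg[OF regular_kernelD(1)])

lemma variation_shifted: "variation (shifted_kernel \<tau> x) \<le> ereal V"
proof -
  have "variation (\<lambda>u. 1 * of_bool (x \<ge> 0) + 1 * \<tau> x u) \<le> ereal (\<bar>1\<bar> * 0 + \<bar>1\<bar> * V)"
    by (rule variation_lincomb[OF variation_const regular_kernelD(1)])
  then show ?thesis by (simp add: shifted_kernel_section)
qed

text \<open>The section of the shift is constant in the current state, and integrating a constant
  yields a multiple of the total mass \<open>f 1\<close>.\<close>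

lemma kernel_op_shifted:
  assumes "f \<in> dist_space"
  shows "kernel_op (shifted_kernel \<tau>) f x = of_bool (x \<ge> 0) * f 1 + kernel_op \<tau> f x"
  using ext_integral_lincomb_integrand[OF variation_const regular_kernelD(1) assms, of 1 "of_bool (x \<ge> 0)" 1 x]
    ext_integral_const[OF assms, of "of_bool (x \<ge> 0)"]
  by (simp add: kernel_op_ext shifted_kernel_section)

lemma kernel_op_outside:
  assumes f: "f \<in> dist_space"
  shows "x < 0 \<Longrightarrow> kernel_op \<tau> f x = 0" "1 \<le> x \<Longrightarrow> kernel_op \<tau> f x = f 1"
proof -
  assume "x < 0"
  then have "ext_integral (\<tau> x) = ext_integral (\<lambda>_. 0)"
    by (intro ext_integral_cong regular_kernelD)
  then show "kernel_op \<tau> f x = 0" using ext_integral_const[OF f, of 0] by (simp add: kernel_op_ext)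
next
  assume "1 \<le> x"
  then have "ext_integral (\<tau> x) = ext_integral (\<lambda>_. 1)"
    by (intro ext_integral_cong regular_kernelD)
  then show "kernel_op \<tau> f x = f 1" using ext_integral_const[OF f, of 1] by (simp add: kernel_op_ext)
qed

lemma shifted_bound:
  assumes f: "f \<in> dist_space" and B: "\<And>x. \<bar>f x\<bar> \<le> B"
  shows "\<bar>kernel_op (shifted_kernel \<tau>) f x\<bar> \<le> (2 + 3 * V) * B"
proof -
  have B0: "0 \<le> B" using B[of 0] by linarith
  have "\<bar>kernel_op (shifted_kernel \<tau>) f x\<bar> \<le> (\<bar>shifted_kernel \<tau> x 1\<bar> + 3 * V) * B"
    unfolding kernel_op_ext by (rule ext_integral_bound[OF variation_shifted f B])
  \<comment> \<open>At the state 1 the shift and the kernel contribute at most 1 each.\<close>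
  also have "\<dots> \<le> (2 + 3 * V) * B"
    using regular_kernelD(4)[of 1 x] B0 by (intro mult_right_mono) (auto simp: shifted_kernel_def)
  finally show ?thesis .
qed

lemma shifted_lincomb:
  assumes "f \<in> dist_space" "h \<in> dist_space"
  shows "kernel_op (shifted_kernel \<tau>) (\<lambda>x. a * f x + b * h x) x =
    a * kernel_op (shifted_kernel \<tau>) f x + b * kernel_op (shifted_kernel \<tau>) h x"
  unfolding kernel_op_ext by (rule ext_integral_lincomb[OF variation_shifted assms])

text \<open>At \<open>x = 1\<close> the shifted operator doubles \<open>f 1\<close>, so that its fixed points have mass zero.\<close>

lemma shifted_fixed_point:
  assumes f: "f \<in> dist_space" and fix_pt: "\<And>x. f x = kernel_op (shifted_kernel \<tau>) f x"
  shows "f 1 = 0" "f x = kernel_op \<tau> f x"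
proof -
  show 1: "f 1 = 0" using fix_pt[of 1] kernel_op_shifted[OF f, of 1] kernel_op_outside(2)[OF f, of 1] by simp
  show "f x = kernel_op \<tau> f x" using fix_pt[of x] kernel_op_shifted[OF f, of x] 1 by simp
qed

text \<open>A probability distribution function has \<open>f 1 = 1\<close>, so the shift adds
  exactly \<open>of_bool (x \<ge> 0)\<close>. Stationarity becomes an inhomogeneous equation whose
  right-hand side does not depend on \<tau>.\<close>

lemma stationary_iff_shifted:
  assumes f: "f \<in> dist_funs"
  shows "stationary_dist \<tau> f \<longleftrightarrow> (\<forall>x. kernel_op (shifted_kernel \<tau>) f x = f x + of_bool (x \<ge> 0))"
proof -
  note fd = dist_funs_dist_space[OF f] and fs = dist_funs_span[OF f]
  \<comment> \<open>Stationarity only speaks about the unit interval; elsewhere both sides are 0 or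
    both are 1.\<close>
  have "f x = kernel_op \<tau> f x" if "x \<notin> {0..1}" for x
    using kernel_op_outside[OF fd, of x] dist_funs_props(1,2)[OF f, of x] dist_funs_props(2)[OF f, of 1] that
    by (cases "x < 0") auto
  then have "(\<forall>x\<in>{0..1}. f x = kernel_op \<tau> f x) \<longleftrightarrow> (\<forall>x. f x = kernel_op \<tau> f x)" by blast
  moreover have "stationary_dist \<tau> f \<longleftrightarrow> (\<forall>x\<in>{0..1}. f x = kernel_op \<tau> f x)"
    using f fs by (simp add: stationary_dist_def kernel_op_ext ext_integral_unit)
  moreover have "kernel_op (shifted_kernel \<tau>) f x = of_bool (x \<ge> 0) + kernel_op \<tau> f x" for x
    using kernel_op_shifted[OF fd, of x] dist_funs_props(2)[OF f, of 1] by simp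
  ultimately show ?thesis by auto
qed

end

lemma regular_markov_kernel:
  assumes \<kappa>: "markov_kernel \<kappa>" and V: "\<And>x. x \<in> {0..1} \<Longrightarrow> variation (\<kappa> x) \<le> ereal V"
  shows "regular_kernel \<kappa> V"
proof -
  have \<kappa>D: "(\<lambda>x. \<kappa> x u) \<in> dist_funs" if "u \<in> {0..1}" for u
    using \<kappa> that by (simp add: markov_kernel_def)
  have V0: "0 \<le> V" by (rule variation_le_nonneg[OF V[of 0]]) simp
  have "variation (\<kappa> x) \<le> ereal V" for x
  proof (cases "x \<in> {0..1}")
    case False
    then consider "x < 0" | "1 \<le> x" by fastforce
    then have "variation (\<kappa> x) \<le> ereal 0"
    proof cases
      case 1
      show ?thesis by (rule variation_cong[OF _ variation_const[of 0]]) (use dist_funs_props(1)[OF \<kappa>D _] 1 in auto)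
    next
      case 2
      show ?thesis by (rule variation_cong[OF _ variation_const[of 1]]) (use dist_funs_props(2)[OF \<kappa>D _] 2 in auto)
    qed
    then show ?thesis using V0 order_trans by (metis ereal_less_eq(3))
  qed (rule V)
  then show ?thesis unfolding regular_kernel_def
    using dist_funs_props[OF \<kappa>D] by (auto simp: abs_le_iff intro: order_trans[of _ 0])
qed

lemma step_dist_funs:
  fixes w :: "'a \<Rightarrow> real"
  assumes I: "finite I" and c: "\<And>i. i \<in> I \<Longrightarrow> 0 \<le> c i \<and> c i \<le> (1::real)"
    and w: "\<And>i. i \<in> I \<Longrightarrow> 0 \<le> w i" "(\<Sum>i\<in>I. w i) = 1"
  shows "(\<lambda>x. \<Sum>i\<in>I. of_bool (c i \<le> x) * w i) \<in> dist_funs"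
proof -
  let ?F = "\<lambda>x. \<Sum>i\<in>I. of_bool (c i \<le> x) * w i"
  have cont: "continuous (at_right a) (\<lambda>x. of_bool (b \<le> x) :: real)" for a b :: real
  proof -
    have "\<forall>\<^sub>F x in at_right a. (b \<le> x) = (b \<le> a)"
    proof (cases "b \<le> a")
      case True
      then show ?thesis by (auto intro: eventually_mono[OF eventually_at_right_less])
    next
      case False
      then show ?thesis by (auto simp: eventually_at_right_field not_le)
    qed
    then show ?thesis unfolding continuous_within
      by (intro tendsto_eventually) (auto elim: eventually_mono)
  qed
  have F1: "?F x = 1" if "1 \<le> x" for x
    using w(2) c that by (subst w(2)[symmetric], intro sum.cong) (auto intro: order_trans)
  obtain M where M: "unit_measure M" "cdf M = ?F" "emeasure M UNIV = ?F 1"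
  proof (rule unit_measure_of_cdf[of ?F])
    show "?F x \<le> ?F y" if "x \<le> y" for x y
      using that w(1) by (intro sum_mono mult_right_mono) auto
    show "continuous (at_right a) ?F" for a by (intro continuous_intros cont)
    show "?F x = 0" if "x < 0" for x using c that by (intro sum.neutral) force
    show "?F x = ?F 1" if "1 \<le> x" for x using F1[OF that] F1[of 1] by simp
  qed (use that in auto)
  have "prob_space M" by (rule prob_spaceI) (use M unit_measureD(4)[OF M(1)] F1[of 1] in auto)
  then show ?thesis unfolding dist_funs_def using M(1) M(2)[symmetric] by blast
qed

text \<open>Finite variation of the partial sum is carried along, because the next summand can only
  be split off with it.\<close>

lemma ext_integral_sum_integrand:
  assumes f: "f \<in> dist_space"
  shows "finite I \<Longrightarrow> (\<And>i. i \<in> I \<Longrightarrow> variation (g i) \<le> ereal (V i)) \<Longrightarrow>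
    (\<exists>W. variation (\<lambda>u. \<Sum>i\<in>I. a i * g i u) \<le> ereal W) \<and>
    ext_integral (\<lambda>u. \<Sum>i\<in>I. a i * g i u) f = (\<Sum>i\<in>I. a i * ext_integral (g i) f)"
proof (induction I rule: finite_induct)
  case empty
  show ?case using variation_const[of 0] ext_integral_const[OF f, of 0] by auto
next
  case (insert i I)
  then obtain W where W: "variation (\<lambda>u. \<Sum>i\<in>I. a i * g i u) \<le> ereal W" by auto
  have vi: "variation (g i) \<le> ereal (V i)" using insert by auto
  show ?case
    using variation_lincomb[OF vi W, of "a i" 1] ext_integral_lincomb_integrand[OF vi W f, of "a i" 1] insert
    by auto
qed

section \<open>A single finite chain\<close>

lemma sum_telescope_from_1: "(\<Sum>j=1..n. e j - e (j - 1)) = e n - (e 0 :: real)" for n :: nat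
  by (induction n) auto

locale chain_grid =
  fixes \<kappa> :: "real \<Rightarrow> real \<Rightarrow> real" and V :: real
    and J :: nat and c :: "nat \<Rightarrow> real" and q :: "nat \<Rightarrow> nat \<Rightarrow> real"
  assumes reg: "regular_kernel \<kappa> V"
    and chain: "finite_chain J c q"
    and q_eq: "\<And>i j. i \<in> {1..J} \<Longrightarrow> j \<in> {1..J} \<Longrightarrow>
      q i j = ext_kernel \<kappa> (ext_state J c j) (c i) - ext_kernel \<kappa> (ext_state J c (j - 1)) (c i)"
begin

abbreviation chain_op :: "(real \<Rightarrow> real) \<Rightarrow> real \<Rightarrow> real" where
  "chain_op \<equiv> kernel_op (shifted_kernel (chain_kernel J c q))"

section \<open>Rounding to the grid and the sampled kernel\<close>

lemma J: "1 \<le> J" and c_1: "c 1 = 0" and c_J: "c J = 1"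
  using chain by (auto simp: finite_chain_def)

lemma c_less_iff: "i \<in> {1..J} \<Longrightarrow> j \<in> {1..J} \<Longrightarrow> c i < c j \<longleftrightarrow> i < j"
  using chain strict_mono_on_less[of "{1..J}" c] by (simp add: finite_chain_def)

lemma c_le_iff: "i \<in> {1..J} \<Longrightarrow> j \<in> {1..J} \<Longrightarrow> c i \<le> c j \<longleftrightarrow> i \<le> j"
  using c_less_iff[of j i] by (simp add: not_less[symmetric])

lemma c_unit: "i \<in> {1..J} \<Longrightarrow> 0 \<le> c i \<and> c i \<le> 1"
  using c_le_iff[of 1 i] c_le_iff[of i J] J c_1 c_J by simp

text \<open>The next state is rounded down because row distributions are right-continuous step
  functions; the current state is rounded up (\<open>above\<close>) because the cells are closed on
  the right.\<close>

definition below :: "real \<Rightarrow> nat" where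
  "below x = Max {i \<in> {1..J}. c i \<le> x}"

definition above :: "real \<Rightarrow> nat" where
  "above u = Min {i \<in> {1..J}. u \<le> c i}"

lemma below:
  assumes "0 \<le> x"
  shows "below x \<in> {1..J}" "c (below x) \<le> x" "i \<in> {1..J} \<Longrightarrow> c i \<le> x \<longleftrightarrow> i \<le> below x"
proof -
  let ?S = "{i \<in> {1..J}. c i \<le> x}"
  have S: "finite ?S" "?S \<noteq> {}" using J c_1 assms by (auto intro!: exI[of _ 1])
  have "below x \<in> ?S" unfolding below_def by (rule Max_in[OF S])
  then show B: "below x \<in> {1..J}" "c (below x) \<le> x" by auto
  show "c i \<le> x \<longleftrightarrow> i \<le> below x" if i: "i \<in> {1..J}"
  proof
    show "c i \<le> x \<Longrightarrow> i \<le> below x" unfolding below_def using S(1) i by (intro Max_ge) auto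
    show "i \<le> below x \<Longrightarrow> c i \<le> x" using c_le_iff[OF i B(1)] B(2) by simp
  qed
qed

lemma above:
  assumes "u \<le> 1"
  shows "above u \<in> {1..J}" "u \<le> c (above u)" "i \<in> {1..J} \<Longrightarrow> u \<le> c i \<longleftrightarrow> above u \<le> i"
proof -
  let ?S = "{i \<in> {1..J}. u \<le> c i}"
  have S: "finite ?S" "?S \<noteq> {}" using J c_J assms by (auto intro!: exI[of _ J])
  have "above u \<in> ?S" unfolding above_def by (rule Min_in[OF S])
  then show B: "above u \<in> {1..J}" "u \<le> c (above u)" by auto
  show "u \<le> c i \<longleftrightarrow> above u \<le> i" if i: "i \<in> {1..J}"
  proof
    show "u \<le> c i \<Longrightarrow> above u \<le> i" unfolding above_def using S(1) i by (intro Min_le) auto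
    show "above u \<le> i \<Longrightarrow> u \<le> c i" using c_le_iff[OF B(1) i] B(2) by simp
  qed
qed

text \<open>The state 1 is sampled at itself, so a bound on \<open>kernel_zeta\<close>, which looks
  at \<open>u = 1\<close>, passes to the sampled kernel.\<close>

lemma above_1: "c (above 1) = 1"
  using above(1,2)[of 1] c_unit[OF above(1), of 1] by (intro antisym) auto

text \<open>The entries of \<open>q\<close> are increments of \<kappa> along the states, so their
  partial sums telescope; the convention at \<open>-\<infinity>\<close> makes the starting value
  0.\<close>

lemma row_dist_eq:
  assumes i: "i \<in> {1..J}"
  shows "x < 0 \<Longrightarrow> row_dist J c q i x = 0" "0 \<le> x \<Longrightarrow> row_dist J c q i x = \<kappa> (c (below x)) (c i)"
proof -
  assume "x < 0"
  then have "\<not> c j \<le> x" if "j \<in> {1..J}" for j using c_unit[OF that] by auto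
  then show "row_dist J c q i x = 0" unfolding row_dist_def by (intro sum.neutral) auto
next
  assume x: "0 \<le> x"
  let ?e = "\<lambda>j. ext_kernel \<kappa> (ext_state J c j) (c i)"
  have l: "below x \<in> {1..J}" by (rule below[OF x])
  have "row_dist J c q i x = (\<Sum>j=1..J. of_bool (j \<le> below x) * q i j)"
    unfolding row_dist_def by (intro sum.cong) (use below(3)[OF x] in auto)
  also have "\<dots> = (\<Sum>j=1..below x. q i j)"
    by (rule sum.mono_neutral_cong_right) (use l in auto)
  also have "\<dots> = (\<Sum>j=1..below x. ?e j - ?e (j - 1))"
    by (intro sum.cong) (use q_eq[OF i] l in auto)
  also have "\<dots> = ?e (below x) - ?e 0"
    by (rule sum_telescope_from_1)
  also have "\<dots> = \<kappa> (c (below x)) (c i)"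
    using l by (auto simp: ext_kernel_def ext_state_def)
  finally show "row_dist J c q i x = \<kappa> (c (below x)) (c i)" .
qed

text \<open>In this form \<open>ext_integral_atMost\<close> integrates the indicator. The first cell
  is unbounded to the left and has nothing to subtract.\<close>

lemma cell_indicator:
  assumes "i \<in> {1..J}"
  shows "of_bool (ereal u \<in> {ext_state J c (i - 1)<..ext_state J c i}) =
    (of_bool (u \<le> c i) - (if i = 1 then 0 else of_bool (u \<le> c (i - 1))) :: real)"
proof -
  have "c (i - 1) < c i" if "i \<noteq> 1"
  proof -
    have "i - 1 \<in> {1..J}" using assms that by auto
    then show ?thesis using c_less_iff[of "i - 1" i] assms by auto
  qed
  then show ?thesis using assms by (auto simp: ext_state_def)
qed

lemma chain_kernel_above:
  assumes u: "u \<in> {0..1}"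
  shows "chain_kernel J c q x u = row_dist J c q (above u) x"
proof -
  have u1: "u \<le> 1" using u by simp
  note a = above[OF u1]
  have "ereal u \<in> {ext_state J c (i - 1)<..ext_state J c i} \<longleftrightarrow> i = above u" if i: "i \<in> {1..J}" for i
  proof (cases "i = 1")
    case True
    then show ?thesis using a(1) a(3)[of 1] i by (auto simp: ext_state_def)
  next
    case False
    then have "i - 1 \<in> {1..J}" using i by auto
    then show ?thesis using False a(3)[of i] a(3)[of "i - 1"] i by (auto simp: ext_state_def not_le[symmetric])
  qed
  then have "chain_kernel J c q x u = (\<Sum>i=1..J. if i = above u then row_dist J c q i x else 0)"
    unfolding chain_kernel_def by (intro sum.cong) auto
  then show ?thesis using a(1) by simp
qed

lemma chain_kernel_eq:
  assumes u: "u \<in> {0..1}"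
  shows "x < 0 \<Longrightarrow> chain_kernel J c q x u = 0"
    "0 \<le> x \<Longrightarrow> chain_kernel J c q x u = \<kappa> (c (below x)) (c (above u))"
  using chain_kernel_above[OF u] row_dist_eq[OF above(1)] u by auto

text \<open>The cells partition the unit interval, so the term \<open>of_bool (x \<ge> 0)\<close>
  leaves the sum over cells. The two kernels agree where the integral looks.\<close>

lemma shifted_chain_kernel_op: "kernel_op (shifted_chain_kernel J c q) = chain_op"
proof (intro ext)
  fix f x
  have "ext_integral (shifted_chain_kernel J c q x) = ext_integral (shifted_kernel (chain_kernel J c q) x)"
  proof (rule ext_integral_cong)
    fix u :: real assume u: "u \<in> {0..1}"
    have "(\<Sum>i=1..J. of_bool (ereal u \<in> {ext_state J c (i - 1)<..ext_state J c i}) :: real) = 1"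
    proof -
      have "(\<Sum>i=1..J. of_bool (ereal u \<in> {ext_state J c (i - 1)<..ext_state J c i}) :: real) =
        (\<Sum>i=1..J. (of_bool (u \<le> c i) :: real) - (if i = 1 then 0 else of_bool (u \<le> c (i - 1))))"
        by (intro sum.cong cell_indicator) auto
      also have "\<dots> = (\<Sum>i=1..J. (\<lambda>i. if i = 0 then 0 else of_bool (u \<le> c i)) i -
          (\<lambda>i. if i = 0 then 0 else of_bool (u \<le> c i)) (i - 1))"
        by (intro sum.cong) auto
      also have "\<dots> = (if J = 0 then 0 else of_bool (u \<le> c J)) - 0"
        by (subst sum_telescope_from_1) simp
      also have "\<dots> = 1" using u c_J J by simp
      finally show ?thesis .
    qed
    then show "shifted_chain_kernel J c q x u = shifted_kernel (chain_kernel J c q) x u"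
      by (simp add: shifted_chain_kernel_def shifted_kernel_def chain_kernel_def distrib_right sum.distrib
          sum_distrib_left[symmetric])
  qed
  then show "kernel_op (shifted_chain_kernel J c q) f x = chain_op f x"
    by (simp add: kernel_op_ext)
qed

lemma variation_sampled:
  assumes "variation g \<le> ereal W" "\<And>u. u \<in> {0..1} \<Longrightarrow> h u = g (c (above u))"
  shows "variation h \<le> ereal W"
proof (rule variation_sample[OF assms(1)])
  fix x y :: real assume xy: "0 \<le> x" "x \<le> y" "y \<le> 1"
  then have "above x \<le> above y" using above(3)[of x "above y"] above(1,2)[of y] by linarith
  then show "c (above x) \<le> c (above y)" using c_le_iff above(1) xy by auto
next
  fix x :: real assume "0 \<le> x" "x \<le> 1"
  then show "0 \<le> c (above x) \<and> c (above x) \<le> 1" "h x = g (c (above x))"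
    using c_unit above(1) assms(2) by auto
qed

text \<open>The constant \<open>V\<close> is that of \<kappa>, the same for every grid. This is the
  source of all bounds that are uniform in the chain.\<close>

lemma regular_chain_kernel: "regular_kernel (chain_kernel J c q) V"
proof -
  have "variation (chain_kernel J c q x) \<le> ereal V" for x
  proof (cases "x < 0")
    case True
    have "variation (chain_kernel J c q x) \<le> ereal 0"
      by (rule variation_cong[OF _ variation_const[of 0]]) (use True chain_kernel_eq in auto)
    then show ?thesis using regular_kernel_nonneg[OF reg] order_trans by (metis ereal_less_eq(3))
  next
    case False
    then show ?thesis
      by (intro variation_sampled[OF regular_kernelD(1)[OF reg, of "c (below x)"]] chain_kernel_eq) auto
  qed
  moreover have "chain_kernel J c q x u = 1" if "1 \<le> x" "u \<in> {0..1}" for x u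
  proof -
    have "J \<le> below x" using below(3)[of x J] that J c_J by simp
    then have "below x = J" using below(1)[of x] that by simp
    then show ?thesis
      using chain_kernel_eq(2)[OF that(2), of x] that regular_kernelD(3)[OF reg, of 1 "c (above u)"]
        c_unit[OF above(1), of u] c_J by simp
  qed
  moreover have "\<bar>chain_kernel J c q x u\<bar> \<le> 1" if "u \<in> {0..1}" for x u
    using chain_kernel_eq[OF that, of x] regular_kernelD(4)[OF reg, of "c (above u)" "c (below x)"]
      c_unit[OF above(1), of u] that by (cases "x < 0") auto
  ultimately show ?thesis unfolding regular_kernel_def using chain_kernel_eq(1) by blast
qed

section \<open>Reduction of the chain operator to cell masses\<close>

definition cell_mass :: "(real \<Rightarrow> real) \<Rightarrow> nat \<Rightarrow> real" where
  "cell_mass f i = f (c i) - (if i = 1 then 0 else f (c (i - 1)))"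

lemma kernel_op_chain:
  assumes f: "f \<in> dist_space"
  shows "kernel_op (chain_kernel J c q) f x = (\<Sum>i=1..J. row_dist J c q i x * cell_mass f i)"
proof -
  \<comment> \<open>For \<open>i = 1\<close> the coefficient 0 removes \<open>c 0\<close>, an index
    without a state.\<close>
  let ?g = "\<lambda>i u. 1 * of_bool (u \<le> c i) + (if i = 1 then 0 else -1) * of_bool (u \<le> c (i - 1)) :: real"
  have v: "variation (?g i) \<le> ereal (\<bar>1\<bar> * 1 + \<bar>if i = 1 then 0 else -1\<bar> * 1)" for i
    by (rule variation_lincomb[OF variation_atMost variation_atMost])
  have g: "ext_integral (?g i) f = cell_mass f i" if "i \<in> {1..J}" for i
  proof (cases "i = 1")
    case True
    then show ?thesis
      using ext_integral_lincomb_integrand[OF variation_atMost variation_atMost f, of 1 "c i" 0 "c (i - 1)"]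
        ext_integral_atMost[OF f, of "c i"] c_unit[OF that] by (simp add: cell_mass_def)
  next
    case False
    then have "i - 1 \<in> {1..J}" using that by auto
    then show ?thesis
      using ext_integral_lincomb_integrand[OF variation_atMost variation_atMost f, of 1 "c i" "-1" "c (i - 1)"]
        ext_integral_atMost[OF f, of "c i"] ext_integral_atMost[OF f, of "c (i - 1)"]
        c_unit[OF that] c_unit[of "i - 1"] False by (simp add: cell_mass_def)
  qed
  have "chain_kernel J c q x = (\<lambda>u. \<Sum>i=1..J. row_dist J c q i x * ?g i u)"
    unfolding chain_kernel_def
    by (intro ext sum.cong refl arg_cong[where f="(*) _"]) (subst cell_indicator, auto)
  then show ?thesis
    using ext_integral_sum_integrand[OF f, of "{1..J}" ?g, OF _ v] g
    by (simp add: kernel_op_ext)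
qed

lemma cell_mass_sum: "(\<Sum>i=1..J. cell_mass f i) = f 1"
proof -
  have "(\<Sum>i=1..J. cell_mass f i) =
      (\<Sum>i=1..J. (\<lambda>i. if i = 0 then 0 else f (c i)) i - (\<lambda>i. if i = 0 then 0 else f (c i)) (i - 1))"
    unfolding cell_mass_def by (intro sum.cong) auto
  also have "\<dots> = (if J = 0 then 0 else f (c J)) - 0"
    by (subst sum_telescope_from_1) simp
  finally show ?thesis using J c_J by simp
qed

definition step :: "(nat \<Rightarrow> real) \<Rightarrow> real \<Rightarrow> real" where
  "step w x = (\<Sum>j=1..J. of_bool (c j \<le> x) * w j)"

lemma step_dist_space: "step w \<in> dist_space"
proof -
  have "(\<lambda>x. of_bool (c j \<le> x)) \<in> dist_span" if "j \<in> {1..J}" for j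
    using dist_funs_span[OF step_dist_funs[of "{j}" c "\<lambda>_. 1"]] c_unit[OF that]
    by (simp del: sum_of_bool_eq sum_of_bool_mult_eq sum_mult_of_bool_eq)
  then have "(\<lambda>x. \<Sum>j\<in>{1..J}. w j * of_bool (c j \<le> x)) \<in> dist_span"
    by (intro dist_span_sum) auto
  then show ?thesis by (simp add: step_def[abs_def] mult.commute dist_span_space)
qed

text \<open>The jumps of a step function are its cell masses, so \<open>step\<close> and
  \<open>cell_mass\<close> translate between vectors and functions.\<close>

lemma cell_mass_step:
  assumes k: "k \<in> {1..J}"
  shows "cell_mass (step w) k = w k"
proof -
  have at: "step w (c i) = (\<Sum>j=1..i. w j)" if "i \<in> {1..J}" for i
  proof -
    have "step w (c i) = (\<Sum>j=1..J. of_bool (j \<le> i) * w j)"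
      unfolding step_def by (intro sum.cong) (use c_le_iff that in auto)
    also have "\<dots> = (\<Sum>j=1..i. w j)"
      by (rule sum.mono_neutral_cong_right) (use that in auto)
    finally show ?thesis .
  qed
  show ?thesis
  proof (cases "k = 1")
    case True
    then show ?thesis using at[OF k] by (simp add: cell_mass_def)
  next
    case False
    then obtain m where m: "k = Suc m" "m \<in> {1..J}" using k by (cases k) auto
    then show ?thesis using at[OF k] at[OF m(2)] False by (simp add: cell_mass_def)
  qed
qed

lemma cell_mass_add: "cell_mass (\<lambda>x. f x + h x) i = cell_mass f i + cell_mass h i"
  by (simp add: cell_mass_def)

text \<open>\<open>chain_op\<close> has finite rank: it factors through the vector of cell masses.\<close>

lemma chain_op_step:
  assumes f: "f \<in> dist_space"
  shows "chain_op f = step (\<lambda>j. \<Sum>i=1..J. (q i j + of_bool (j = 1)) * cell_mass f i)"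
proof
  fix x
  \<comment> \<open>The shift is a jump at the first state \<open>c 1 = 0\<close>, hence an extra 1
    in the column \<open>j = 1\<close> of the matrix; the mass \<open>f 1\<close> it multiplies is
    the sum of the cell masses.\<close>
  have "of_bool (x \<ge> 0) = (\<Sum>j=1..J. of_bool (c j \<le> x) * of_bool (j = 1) :: real)"
  proof -
    have "(\<Sum>j=1..J. of_bool (c j \<le> x) * of_bool (j = 1) :: real) =
        (\<Sum>j=1..J. if j = 1 then of_bool (c 1 \<le> x) else 0)" by (intro sum.cong) auto
    then show ?thesis using J c_1 by simp
  qed
  then have "of_bool (x \<ge> 0) * f 1 =
      (\<Sum>j=1..J. \<Sum>i=1..J. of_bool (c j \<le> x) * of_bool (j = 1) * cell_mass f i)"
    unfolding cell_mass_sum[of f, symmetric] by (simp only: sum_product)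
  moreover have "kernel_op (chain_kernel J c q) f x =
      (\<Sum>j=1..J. \<Sum>i=1..J. of_bool (c j \<le> x) * q i j * cell_mass f i)"
    unfolding kernel_op_chain[OF f] row_dist_def sum_distrib_right by (rule sum.swap)
  ultimately show "chain_op f x = step (\<lambda>j. \<Sum>i=1..J. (q i j + of_bool (j = 1)) * cell_mass f i) x"
    unfolding kernel_op_shifted[OF regular_chain_kernel f] step_def
    by (simp add: sum_distrib_left sum.distrib[symmetric] algebra_simps)
qed

lemma chain_op_dist_space: "f \<in> dist_space \<Longrightarrow> chain_op f \<in> dist_space"
  by (simp add: chain_op_step step_dist_space)

lemma id_minus_dist_space: "f \<in> dist_space \<Longrightarrow> id_minus chain_op f \<in> dist_space"
  unfolding id_minus_def by (intro dist_space_diff chain_op_dist_space)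

text \<open>Solving \<open>f - chain_op f = h\<close> is a linear system for the cell masses of \<open>f\<close>.\<close>

lemma id_minus_bij:
  assumes inj: "\<And>f. f \<in> dist_space \<Longrightarrow> f = chain_op f \<Longrightarrow> f = (\<lambda>_. 0)"
  shows "bij_betw (id_minus chain_op) dist_space dist_space"
proof -
  have "inj_on (id_minus chain_op) dist_space"
  proof (rule inj_onI)
    fix f h assume fh: "f \<in> dist_space" "h \<in> dist_space" "id_minus chain_op f = id_minus chain_op h"
    let ?d = "\<lambda>x. 1 * f x + (-1) * h x"
    have "?d x = chain_op ?d x" for x
      using fun_cong[OF fh(3), of x] unfolding shifted_lincomb[OF regular_chain_kernel fh(1,2)]
      by (simp add: id_minus_def)
    then have "?d = (\<lambda>_. 0)" using inj[OF dist_space_lincomb[OF fh(1,2)]] by blast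
    then show "f = h" by (auto simp: fun_eq_iff)
  qed
  moreover have "\<exists>f\<in>dist_space. id_minus chain_op f = h" if h: "h \<in> dist_space" for h
  proof -
    let ?A = "\<lambda>j i. q i j + of_bool (j = 1) :: real"
    let ?w = "\<lambda>z j. \<Sum>i=1..J. ?A j i * z i"
    have split: "(\<Sum>i=1..J. (of_bool (i = j) - ?A j i) * z i) = z j - ?w z j" if "j \<in> {1..J}" for j z
    proof -
      have "(\<Sum>i=1..J. (of_bool (i = j) - ?A j i) * z i) = (\<Sum>i=1..J. (if i = j then z i else 0) - ?A j i * z i)"
        by (intro sum.cong) (auto simp: algebra_simps)
      then show ?thesis using that by (simp add: sum_subtractf)
    qed
    have "\<exists>z. \<forall>j\<in>{1..J}. (\<Sum>i=1..J. (of_bool (i = j) - ?A j i) * z i) = cell_mass h j"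
    proof (rule square_system_solvable)
      fix z assume z: "\<And>j. j \<in> {1..J} \<Longrightarrow> (\<Sum>i=1..J. (of_bool (i = j) - ?A j i) * z i) = 0"
      have zw: "?w z j = z j" if "j \<in> {1..J}" for j using z[OF that] split[OF that, of z] by simp
      have "chain_op (step z) = step (?w z)"
        unfolding chain_op_step[OF step_dist_space]
        by (intro arg_cong[where f=step] ext sum.cong refl) (simp add: cell_mass_step)
      also have "\<dots> = step z" unfolding step_def by (intro ext sum.cong refl arg_cong[where f="(*) _"] zw)
      \<comment> \<open>A null vector of the matrix is the jump vector of a fixed point, so
        injectivity of the operator gives that of the matrix.\<close>
      finally have "step z = (\<lambda>_. 0)" using inj[OF step_dist_space] by simp
      then have "z i = 0" if "i \<in> {1..J}" for i
        using cell_mass_step[OF that, of z] by (simp add: cell_mass_def)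
      then show "\<forall>i\<in>{1..J}. z i = 0" by blast
    qed simp_all
    then obtain z where "\<forall>j\<in>{1..J}. (\<Sum>i=1..J. (of_bool (i = j) - ?A j i) * z i) = cell_mass h j"
      by (rule exE)
    then have z: "z j - ?w z j = cell_mass h j" if "j \<in> {1..J}" for j
      using that unfolding split[OF that, symmetric] by (rule bspec)
    \<comment> \<open>The solution is not a step function in general, but it differs from
      \<open>h\<close> by one. Its cell masses are \<open>z\<close>, so \<open>chain_op\<close>
      returns just the added part.\<close>
    define f where "f x = h x + step (?w z) x" for x
    have fd: "f \<in> dist_space"
      using dist_space_lincomb[OF h step_dist_space, of 1 1] by (simp add: f_def[abs_def])
    have mass: "cell_mass f i = z i" if "i \<in> {1..J}" for i
      unfolding f_def[abs_def] cell_mass_add using cell_mass_step[OF that] z[OF that] by simp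
    have "chain_op f = step (?w z)"
      unfolding chain_op_step[OF fd]
      by (intro arg_cong[where f=step] ext sum.cong refl) (simp add: mass)
    then have "id_minus chain_op f = h" by (simp add: id_minus_def f_def)
    then show ?thesis using fd by blast
  qed
  ultimately show ?thesis unfolding bij_betw_def using id_minus_dist_space by blast
qed

text \<open>The cell masses of \<open>f\<close> are the probabilities \<pi>, and the operator
  equation is the balance equation summed up to \<open>x\<close>. Uniqueness for the kernel thus
  yields uniqueness for the chain.\<close>

lemma chain_stationary_stationary:
  assumes "chain_stationary_dist J c q f"
  shows "stationary_dist (chain_kernel J c q) f"
proof -
  obtain \<pi> where \<pi>: "\<And>j. j \<in> {1..J} \<Longrightarrow> 0 \<le> \<pi> j" "(\<Sum>j=1..J. \<pi> j) = 1"
    "\<And>j. j \<in> {1..J} \<Longrightarrow> (\<Sum>i=1..J. \<pi> i * q i j) = \<pi> j" "f = step \<pi>"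
    using assms unfolding chain_stationary_dist_def step_def[abs_def] by blast
  have f: "f \<in> dist_funs"
    unfolding \<pi>(4) step_def[abs_def] by (rule step_dist_funs) (use c_unit \<pi> in auto)
  have "chain_op f x = f x + of_bool (x \<ge> 0)" for x
  proof -
    have "kernel_op (chain_kernel J c q) f x = (\<Sum>i=1..J. row_dist J c q i x * \<pi> i)"
      unfolding kernel_op_chain[OF dist_funs_dist_space[OF f]]
      by (intro sum.cong) (auto simp: \<pi>(4) cell_mass_step)
    also have "\<dots> = (\<Sum>j=1..J. of_bool (c j \<le> x) * (\<Sum>i=1..J. \<pi> i * q i j))"
      unfolding row_dist_def sum_distrib_right sum_distrib_left
      by (subst sum.swap) (simp add: algebra_simps)
    also have "\<dots> = f x" unfolding \<pi>(4) step_def by (intro sum.cong) (use \<pi>(3) in auto)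
    finally show ?thesis
      using kernel_op_shifted[OF regular_chain_kernel dist_funs_dist_space[OF f], of x]
        dist_funs_props(2)[OF f, of 1] by simp
  qed
  then show ?thesis using stationary_iff_shifted[OF regular_chain_kernel f] by blast
qed

text \<open>By \<open>stationary_iff_shifted\<close> both functions have the same image under
  \<open>id_minus chain_op\<close>.\<close>

lemma stationary_unique:
  assumes inj: "\<And>f. f \<in> dist_space \<Longrightarrow> f = chain_op f \<Longrightarrow> f = (\<lambda>_. 0)"
    and "stationary_dist (chain_kernel J c q) f" "stationary_dist (chain_kernel J c q) h"
  shows "f = h"
proof -
  have fh: "f \<in> dist_funs" "h \<in> dist_funs" using assms by (auto simp: stationary_dist_def)
  have "id_minus chain_op f = id_minus chain_op h"
    using assms(2,3) stationary_iff_shifted[OF regular_chain_kernel] fh by (simp add: id_minus_def)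
  moreover have "inj_on (id_minus chain_op) dist_space"
    by (rule bij_betw_imp_inj_on, rule id_minus_bij, rule inj)
  ultimately show ?thesis using fh dist_funs_dist_space by (auto dest: inj_onD)
qed

end

section \<open>Collectively compact approximation\<close>

lemma supnorm_nonneg: "f \<in> dist_space \<Longrightarrow> 0 \<le> supnorm f"
  using dist_space_supnorm[of f 0] by linarith

lemma supnorm_zero: "supnorm (\<lambda>_. 0) = 0"
  by (simp add: supnorm_def)

lemma dist_space_scale: "f \<in> dist_space \<Longrightarrow> (\<lambda>x. a * f x) \<in> dist_space"
  using dist_space_lincomb[of f f a 0] by simp

lemma supnorm_scale_le: "f \<in> dist_space \<Longrightarrow> supnorm (\<lambda>x. a * f x) \<le> \<bar>a\<bar> * supnorm f"
  by (rule supnorm_least) (simp add: abs_mult mult_left_mono dist_space_supnorm)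

lemma supnorm_le_zero:
  assumes "f \<in> dist_space" "supnorm f \<le> 0"
  shows "f = (\<lambda>_. 0)"
proof
  fix x show "f x = 0" using dist_space_supnorm[OF assms(1), of x] assms(2) by linarith
qed

text \<open>A lower bound for \<open>T\<close> is an upper bound for its inverse. This has to come
  first: \<open>opnorm\<close> is a real supremum and means nothing before the set is known to be
  bounded. The last claim follows by scaling \<open>T f\<close> into the unit ball.\<close>

lemma inverse_bounds:
  assumes bij: "bij_betw T dist_space dist_space"
    and hom: "\<And>a f. f \<in> dist_space \<Longrightarrow> T (\<lambda>x. a * f x) = (\<lambda>x. a * T f x)"
    and lower: "\<And>f. f \<in> dist_space \<Longrightarrow> supnorm f \<le> M * supnorm (T f)"
    and M: "0 \<le> M"
  defines "R \<equiv> the_inv_into dist_space T"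
  shows "bounded_on_dist_space R" "opnorm R \<le> M" "0 \<le> opnorm R"
    "\<And>f. f \<in> dist_space \<Longrightarrow> supnorm f \<le> opnorm R * supnorm (T f)"
proof -
  have inj: "inj_on T dist_space" and img: "T ` dist_space = dist_space"
    using bij by (auto simp: bij_betw_def)
  have R: "R h \<in> dist_space" "T (R h) = h" if "h \<in> dist_space" for h
    using the_inv_into_into[OF inj, of h dist_space] f_the_inv_into_f[OF inj, of h] that img
    by (auto simp: R_def)
  have RT: "R (T f) = f" if "f \<in> dist_space" for f
    unfolding R_def using the_inv_into_f_f[OF inj that] .
  have Tin: "T f \<in> dist_space" if "f \<in> dist_space" for f using img that by blast
  have bound: "supnorm (R h) \<le> M * supnorm h" if "h \<in> dist_space" for h
    using lower[OF R(1)[OF that]] R(2)[OF that] by simp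
  then show "bounded_on_dist_space R" unfolding bounded_on_dist_space_def by blast
  let ?S = "{f \<in> dist_space. supnorm f \<le> 1}"
  have ub: "supnorm (R h) \<le> M" if "h \<in> ?S" for h
  proof -
    have "M * supnorm h \<le> M * 1" using that M by (intro mult_left_mono) auto
    then show ?thesis using bound[of h] that by simp
  qed
  have bdd: "bdd_above ((\<lambda>h. supnorm (R h)) ` ?S)" by (rule bdd_aboveI2[OF ub])
  have zero: "(\<lambda>_. 0) \<in> ?S" using dist_span_space[OF dist_span_zero] supnorm_zero by simp
  show "opnorm R \<le> M" unfolding opnorm_def by (rule cSUP_least) (use zero ub in auto)
  have up: "supnorm (R h) \<le> opnorm R" if "h \<in> ?S" for h
    unfolding opnorm_def by (rule cSUP_upper[OF that bdd])
  show opn: "0 \<le> opnorm R"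
  proof -
    have "0 \<le> supnorm (R (\<lambda>_. 0))" by (rule supnorm_nonneg[OF R(1)]) (use zero in simp)
    then show ?thesis using up[OF zero] by linarith
  qed
  show "supnorm f \<le> opnorm R * supnorm (T f)" if f: "f \<in> dist_space" for f
  proof (cases "supnorm (T f) \<le> 0")
    case True
    then have "supnorm (T f) = 0" using supnorm_nonneg[OF Tin[OF f]] by simp
    then show ?thesis using lower[OF f] by simp
  next
    case False
    define s where "s = supnorm (T f)"
    have s: "s > 0" using False by (simp add: s_def)
    let ?f = "\<lambda>x. (1 / s) * f x"
    have fd: "?f \<in> dist_space" by (rule dist_space_scale[OF f])
    have "supnorm (T ?f) \<le> \<bar>1 / s\<bar> * supnorm (T f)"
      unfolding hom[OF f] by (rule supnorm_scale_le[OF Tin[OF f]])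
    also have "\<dots> = 1" using s by (simp add: s_def)
    finally have "supnorm (R (T ?f)) \<le> opnorm R" using Tin[OF fd] by (intro up) simp
    then have "supnorm ?f \<le> opnorm R" using RT[OF fd] by simp
    then have "s * supnorm ?f \<le> s * opnorm R" by (rule mult_left_mono) (use s in simp)
    moreover have "supnorm f \<le> s * supnorm ?f"
      using supnorm_scale_le[OF fd, of s] s by (simp add: mult.assoc[symmetric])
    ultimately have "supnorm f \<le> s * opnorm R" by (rule order_trans[rotated])
    then show ?thesis by (simp only: s_def[symmetric] mult.commute)
  qed
qed

text \<open>The second half of an Arzela-Ascoli argument: from some index on every \<open>x\<close>
  follows one of finitely many \<open>y\<close>, and at finitely many points convergence is
  simultaneous.\<close>

lemma uniform_limit_of_finite_nets:
  fixes F :: "nat \<Rightarrow> real \<Rightarrow> real"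
  assumes conv: "\<And>y. y \<in> S \<Longrightarrow> convergent (\<lambda>n. F n y)"
    and net: "\<And>e. e > 0 \<Longrightarrow> \<exists>G N. finite G \<and> G \<subseteq> S \<and> (\<forall>x. \<exists>y\<in>G. \<forall>n\<ge>N. \<bar>F n x - F n y\<bar> \<le> e)"
  shows "\<exists>h. uniform_limit UNIV F h sequentially"
proof -
  obtain l where l: "\<And>y. y \<in> S \<Longrightarrow> (\<lambda>n. F n y) \<longlonglongrightarrow> l y"
    using conv unfolding convergent_def by metis
  have "uniformly_Cauchy_on UNIV F"
    unfolding uniformly_Cauchy_on_def
  proof (intro allI impI)
    fix e :: real assume "e > 0"
    then have e: "e / 8 > 0" by simp
    obtain G N where G: "finite G" "G \<subseteq> S" "\<And>x. \<exists>y\<in>G. \<forall>n\<ge>N. \<bar>F n x - F n y\<bar> \<le> e / 8"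
      using net[OF e] by blast
    have "\<forall>\<^sub>F n in sequentially. \<forall>y\<in>G. dist (F n y) (l y) < e / 8"
      using l G(2) tendstoD[OF _ e] by (intro eventually_ball_finite G(1)) blast
    then obtain N' where N': "\<And>n y. n \<ge> N' \<Longrightarrow> y \<in> G \<Longrightarrow> dist (F n y) (l y) < e / 8"
      unfolding eventually_sequentially by blast
    have "dist (F m x) (F n x) < e" if "m \<ge> max N N'" "n \<ge> max N N'" for m n x
    proof -
      obtain y where y: "y \<in> G" "\<And>n. n \<ge> N \<Longrightarrow> \<bar>F n x - F n y\<bar> \<le> e / 8" using G(3)[of x] by blast
      have "\<bar>F m x - F m y\<bar> \<le> e / 8" "\<bar>F n x - F n y\<bar> \<le> e / 8" using y(2) that by auto
      moreover have "\<bar>F m y - l y\<bar> < e / 8" "\<bar>F n y - l y\<bar> < e / 8"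
        using N'[of m y] N'[of n y] y(1) that by (auto simp: dist_real_def)
      ultimately show ?thesis using \<open>e > 0\<close> unfolding dist_real_def by linarith
    qed
    then show "\<exists>M. \<forall>x\<in>UNIV. \<forall>m\<ge>M. \<forall>n\<ge>M. dist (F m x) (F n x) < e" by blast
  qed
  then show ?thesis using Cauchy_uniformly_convergent unfolding uniformly_convergent_on_def by blast
qed

section \<open>The sequence of truncations\<close>

locale chain_truncation =
  fixes \<kappa> :: "real \<Rightarrow> real \<Rightarrow> real" and V :: real
    and J :: "nat \<Rightarrow> nat" and c :: "nat \<Rightarrow> nat \<Rightarrow> real" and q :: "nat \<Rightarrow> nat \<Rightarrow> nat \<Rightarrow> real"
    and \<epsilon> :: "nat \<Rightarrow> real"
  assumes reg: "regular_kernel \<kappa> V"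
    and chain: "\<And>r. finite_chain (J r) (c r) (q r)"
    and \<epsilon>: "\<And>r. 0 \<le> \<epsilon> r" "\<epsilon> \<longlonglongrightarrow> 0"
    and cells: "\<And>r i x1 x2. i \<in> {1..J r} \<Longrightarrow> x1 \<in> {0..1} \<Longrightarrow> x2 \<in> {0..1} \<Longrightarrow>
      ereal x1 \<in> {ext_state (J r) (c r) i..<ext_state (J r) (c r) (i + 1)} \<Longrightarrow>
      ereal x2 \<in> {ext_state (J r) (c r) i..<ext_state (J r) (c r) (i + 1)} \<Longrightarrow>
      kernel_zeta \<kappa> x1 x2 < \<epsilon> r \<and> kernel_var \<kappa> x1 x2 < ereal (\<epsilon> r)"
    and nested: "\<And>r1 r2. r1 < r2 \<Longrightarrow> c r1 ` {1..J r1} \<subseteq> c r2 ` {1..J r2}"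
    and q_eq: "\<And>r i j. i \<in> {1..J r} \<Longrightarrow> j \<in> {1..J r} \<Longrightarrow>
      q r i j = ext_kernel \<kappa> (ext_state (J r) (c r) j) (c r i)
              - ext_kernel \<kappa> (ext_state (J r) (c r) (j - 1)) (c r i)"
    and lim: "\<And>x u. x \<in> {0..1} \<Longrightarrow> u \<in> {0..1} \<Longrightarrow>
      (\<lambda>r. chain_kernel (J r) (c r) (q r) x u) \<longlonglongrightarrow> \<kappa> x u"
begin

sublocale G: chain_grid \<kappa> V "J r" "c r" "q r" for r
  by unfold_locales (use reg chain q_eq in auto)

abbreviation K :: "(real \<Rightarrow> real) \<Rightarrow> real \<Rightarrow> real" where
  "K \<equiv> kernel_op (shifted_kernel \<kappa>)"

abbreviation Kr :: "nat \<Rightarrow> (real \<Rightarrow> real) \<Rightarrow> real \<Rightarrow> real" where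
  "Kr r \<equiv> kernel_op (shifted_kernel (chain_kernel (J r) (c r) (q r)))"

lemma V_nonneg: "0 \<le> V"
  by (rule regular_kernel_nonneg[OF reg])

lemma Kr_bound: "f \<in> dist_space \<Longrightarrow> (\<And>x. \<bar>f x\<bar> \<le> B) \<Longrightarrow> \<bar>Kr r f x\<bar> \<le> (2 + 3 * V) * B"
  by (rule shifted_bound[OF G.regular_chain_kernel])

lemma Kr_negative: "f \<in> dist_space \<Longrightarrow> x < 0 \<Longrightarrow> Kr r f x = 0"
  using kernel_op_shifted[OF G.regular_chain_kernel] kernel_op_outside(1)[OF G.regular_chain_kernel] by simp

lemma Kr_tendsto:
  assumes f: "f \<in> dist_space"
  shows "(\<lambda>r. Kr r f x) \<longlonglongrightarrow> K f x"
  unfolding kernel_op_ext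
proof (rule ext_integral_tendsto[OF variation_shifted[OF G.regular_chain_kernel] _ variation_shifted[OF reg] _ f])
  show "\<bar>shifted_kernel (chain_kernel (J r) (c r) (q r)) x 1\<bar> \<le> 2" for r
    using regular_kernelD(4)[OF G.regular_chain_kernel, of 1 r x] by (auto simp: shifted_kernel_def)
  fix u :: real assume u: "u \<in> {0..1}"
  have "(\<lambda>r. chain_kernel (J r) (c r) (q r) x u) \<longlonglongrightarrow> \<kappa> x u"
  proof (cases "x \<in> {0..1}")
    case True
    then show ?thesis by (rule lim[OF _ u])
  next
    case False
    then consider "x < 0" | "1 \<le> x" by fastforce
    then show ?thesis
      by cases (simp_all add: regular_kernelD(2,3)[OF reg _ u] regular_kernelD(2,3)[OF G.regular_chain_kernel _ u])
  qed
  then show "(\<lambda>r. shifted_kernel (chain_kernel (J r) (c r) (q r)) x u) \<longlonglongrightarrow> shifted_kernel \<kappa> x u"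
    unfolding shifted_kernel_def by (intro tendsto_intros)
qed

text \<open>As the grids are nested, a state \<open>y\<close> of the coarse grid \<open>r1\<close>
  is also a state of grid \<open>r\<close>, and rounding \<open>x\<close> to grid \<open>r\<close>
  stays in the coarse cell of \<open>y\<close>. The two sections thus differ by a sampled copy of a
  difference of \<kappa> inside one cell of \<open>r1\<close>. The bound involves
  \<open>\<epsilon> r1\<close> for all later \<open>r\<close>; the factor 4 is 1 for the value at
  \<open>u = 1\<close> plus 3 for the variation.\<close>

lemma Kr_cell:
  assumes r: "r1 \<le> r" and f: "f \<in> dist_space" and B: "\<And>x. \<bar>f x\<bar> \<le> B" and x: "0 \<le> x"
  shows "\<bar>Kr r f x - Kr r f (c r1 (G.below r1 x))\<bar> \<le> 4 * \<epsilon> r1 * B"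
proof -
  define l where "l = G.below r1 x"
  define y where "y = c r1 l"
  define x' where "x' = c r (G.below r x)"
  have l: "l \<in> {1..J r1}" "y \<le> x" using G.below(1,2)[OF x, of r1] by (auto simp: l_def y_def)
  have y0: "0 \<le> y" using G.c_unit[OF l(1)] by (simp add: y_def)
  have "y \<in> c r1 ` {1..J r1}" unfolding y_def using l(1) by (rule imageI)
  then have "y \<in> c r ` {1..J r}" using nested[of r1 r] r by (cases "r1 = r") (simp, auto dest: le_neq_implies_less)
  then obtain k where k: "k \<in> {1..J r}" "c r k = y" by (elim imageE) (rule that, auto)
  have yy: "c r (G.below r y) = y"
    using G.below(2)[OF y0, of r] G.below(3)[OF y0 k(1)] G.c_le_iff[OF k(1) G.below(1)[OF y0]] k(2) by simp
  have yx': "y \<le> x'"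
    using G.below(3)[OF x k(1)] G.c_le_iff[OF k(1) G.below(1)[OF x]] k(2) l(2) by (simp add: x'_def)
  have x'x: "x' \<le> x" using G.below(2)[OF x] by (simp add: x'_def)
  have unit: "y \<in> {0..1}" "x' \<in> {0..1}"
    using G.c_unit[OF l(1)] G.c_unit[OF G.below(1)[OF x]] by (auto simp: y_def x'_def)
  have next_gt: "x < c r1 (l + 1)" if "l < J r1"
    using G.below(3)[OF x, of "l + 1" r1] that l(1) by (simp add: l_def not_le[symmetric])
  have cell: "ereal z \<in> {ext_state (J r1) (c r1) l..<ext_state (J r1) (c r1) (l + 1)}"
    if "y \<le> z" "z \<le> x" for z
    using that l(1) next_gt by (auto simp: ext_state_def y_def)
  have zv: "kernel_zeta \<kappa> y x' < \<epsilon> r1 \<and> kernel_var \<kappa> y x' < ereal (\<epsilon> r1)"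
    by (rule cells[OF l(1) unit cell cell]) (use l(2) yx' x'x in auto)
  let ?T = "chain_kernel (J r) (c r) (q r)"
  let ?h = "\<lambda>u. 1 * shifted_kernel ?T x u + (-1) * shifted_kernel ?T y u"
  \<comment> \<open>Both \<open>x\<close> and \<open>y\<close> are nonnegative, so the shifts
    cancel.\<close>
  have h: "?h u = (\<lambda>u. \<kappa> x' u - \<kappa> y u) (c r (G.above r u))" if "u \<in> {0..1}" for u
    using G.chain_kernel_eq(2)[OF that x, of r] G.chain_kernel_eq(2)[OF that y0, of r] yy x y0
    by (simp add: shifted_kernel_def x'_def)
  have var: "variation ?h \<le> ereal (\<epsilon> r1)"
    by (rule G.variation_sampled[where r=r and g="\<lambda>u. \<kappa> x' u - \<kappa> y u", OF _ h])
      (use zv in \<open>auto simp: kernel_var_def\<close>)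
  have h1: "\<bar>?h 1\<bar> \<le> \<epsilon> r1"
    using h[of 1] zv G.above_1[of r] by (simp add: kernel_zeta_def)
  have eq: "Kr r f x - Kr r f y = ext_integral ?h f"
    using ext_integral_lincomb_integrand[OF variation_shifted[OF G.regular_chain_kernel]
        variation_shifted[OF G.regular_chain_kernel] f, of 1 r x "-1" r y]
    by (simp add: kernel_op_ext)
  have "\<bar>ext_integral ?h f\<bar> \<le> (\<bar>?h 1\<bar> + 3 * \<epsilon> r1) * B"
    by (rule ext_integral_bound[OF var f B])
  also have "\<dots> \<le> (\<epsilon> r1 + 3 * \<epsilon> r1) * B"
    by (rule mult_right_mono[OF add_right_mono[OF h1]]) (use B[of 0] in linarith)
  also have "\<dots> = 4 * \<epsilon> r1 * B" by (simp add: algebra_simps)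
  finally show ?thesis unfolding y_def[symmetric] l_def[symmetric] eq .
qed

text \<open>The point \<open>-1\<close> stands for the negative half-line, where all images vanish.
  The set is countable, which permits a diagonal subsequence.\<close>

definition grid_points :: "real set" where
  "grid_points = insert (-1) (\<Union>r. c r ` {1..J r})"

text \<open>The premise \<open>n \<le> r n\<close> ensures that the grid of \<open>r n\<close>
  refines that of \<open>r1\<close> as soon as \<open>n \<ge> r1\<close>, so one coarse grid serves
  all later operators.\<close>

lemma Kr_finite_net:
  assumes r: "\<And>n. n \<le> r n" and f: "\<And>n. f n \<in> dist_space" and B: "\<And>n x. \<bar>f n x\<bar> \<le> B" and e: "e > 0"
  shows "\<exists>G N. finite G \<and> G \<subseteq> grid_points \<and>
    (\<forall>x. \<exists>y\<in>G. \<forall>n\<ge>N. \<bar>Kr (r n) (f n) x - Kr (r n) (f n) y\<bar> \<le> e)"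
proof -
  have "(\<lambda>r. 4 * \<epsilon> r * B) \<longlonglongrightarrow> 4 * 0 * B" by (intro tendsto_intros \<epsilon>)
  then have "\<forall>\<^sub>F r in sequentially. 4 * \<epsilon> r * B < e" using e by (intro order_tendstoD(2)) auto
  then obtain r1 where r1: "4 * \<epsilon> r1 * B < e" unfolding eventually_sequentially by blast
  let ?G = "insert (-1) (c r1 ` {1..J r1})"
  have "\<exists>y\<in>?G. \<forall>n\<ge>r1. \<bar>Kr (r n) (f n) x - Kr (r n) (f n) y\<bar> \<le> e" for x
  proof (cases "x < 0")
    case True
    then show ?thesis using Kr_negative[OF f] e by (intro bexI[of _ "-1"]) auto
  next
    case False
    then have x: "0 \<le> x" by simp
    have "\<bar>Kr (r n) (f n) x - Kr (r n) (f n) (c r1 (G.below r1 x))\<bar> \<le> e" if "n \<ge> r1" for n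
      using Kr_cell[OF order_trans[OF that r] f B x, of n] r1 by linarith
    then show ?thesis using G.below(1)[OF x, of r1] by blast
  qed
  moreover have "?G \<subseteq> grid_points" unfolding grid_points_def by blast
  ultimately show ?thesis by (intro exI[of _ ?G] exI[of _ r1]) simp
qed

lemma Kr_uniform_limit:
  assumes f: "f \<in> dist_space"
  shows "uniform_limit UNIV (\<lambda>r. Kr r f) (K f) sequentially"
proof -
  have "\<exists>h. uniform_limit UNIV (\<lambda>r. Kr r f) h sequentially"
  proof (rule uniform_limit_of_finite_nets)
    show "convergent (\<lambda>n. Kr n f y)" if "y \<in> grid_points" for y
      using Kr_tendsto[OF f] unfolding convergent_def by blast
    show "\<exists>G N. finite G \<and> G \<subseteq> grid_points \<and> (\<forall>x. \<exists>y\<in>G. \<forall>n\<ge>N. \<bar>Kr n f x - Kr n f y\<bar> \<le> e)"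
      if "e > 0" for e
      by (rule Kr_finite_net[of "\<lambda>n. n" "\<lambda>_. f", OF _ f dist_space_supnorm[OF f] that]) simp
  qed
  then obtain h where h: "uniform_limit UNIV (\<lambda>r. Kr r f) h sequentially" by blast
  have "h x = K f x" for x
    using tendsto_uniform_limitI[OF h, of x] Kr_tendsto[OF f, of x] LIMSEQ_unique by blast
  then have "h = K f" by (rule ext)
  then show ?thesis using h by simp
qed

text \<open>A diagonal subsequence converges at all grid points, and the finite nets make the
  convergence uniform. The arguments \<open>f n\<close> may vary with the operator.\<close>

lemma Kr_collectively_compact:
  assumes r: "\<And>n. n \<le> r n" and f: "\<And>n. f n \<in> dist_space" and B: "\<And>n x. \<bar>f n x\<bar> \<le> B"
  obtains k h where "strict_mono k" "uniform_limit UNIV (\<lambda>n. Kr (r (k n)) (f (k n))) h sequentially"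
proof -
  have count: "countable grid_points" unfolding grid_points_def by auto
  obtain k where k: "strict_mono (k :: nat \<Rightarrow> nat)"
    "\<And>x. x \<in> grid_points \<Longrightarrow> \<exists>l. (\<lambda>n. Kr (r (k n)) (f (k n)) x) \<longlonglongrightarrow> l"
    using function_convergent_subsequence[OF count, of "\<lambda>n. Kr (r n) (f n)" "(2 + 3 * V) * B"]
      Kr_bound[OF f B] by auto
  have "\<exists>h. uniform_limit UNIV (\<lambda>n. Kr (r (k n)) (f (k n))) h sequentially"
  proof (rule uniform_limit_of_finite_nets)
    show "convergent (\<lambda>n. Kr (r (k n)) (f (k n)) y)" if "y \<in> grid_points" for y
      using k(2)[OF that] by (simp add: convergent_def)
    show "\<exists>G N. finite G \<and> G \<subseteq> grid_points \<and>
        (\<forall>x. \<exists>y\<in>G. \<forall>n\<ge>N. \<bar>Kr (r (k n)) (f (k n)) x - Kr (r (k n)) (f (k n)) y\<bar> \<le> e)"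
      if "e > 0" for e
      by (rule Kr_finite_net[OF _ f B that]) (use r seq_suble[OF k(1)] order_trans in blast)
  qed
  then show ?thesis using that k(1) by blast
qed

lemma id_minus_Kr_scale:
  "f \<in> dist_space \<Longrightarrow> id_minus (Kr r) (\<lambda>x. a * f x) = (\<lambda>x. a * id_minus (Kr r) f x)"
  using shifted_lincomb[OF G.regular_chain_kernel, of f f r a 0]
  by (simp add: id_minus_def fun_eq_iff algebra_simps)

text \<open>Otherwise normalised almost-fixed points of \<open>Kr r\<close> would accumulate at a fixed point of \<open>K\<close>.\<close>

lemma id_minus_Kr_lower_bound:
  assumes inj: "\<And>f. f \<in> dist_space \<Longrightarrow> (\<And>x. f x = K f x) \<Longrightarrow> f = (\<lambda>_. 0)"
  shows "\<exists>r0 M. 0 \<le> M \<and> (\<forall>r>r0. \<forall>f\<in>dist_space. supnorm f \<le> M * supnorm (id_minus (Kr r) f))"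
proof (rule ccontr)
  assume neg: "\<not> ?thesis"
  \<comment> \<open>The negation is used with threshold \<open>n\<close> and constant
    \<open>Suc n\<close>, so the indices \<open>r n\<close> tend to infinity while the defects
    become small relative to \<open>f n\<close>.\<close>
  have "\<exists>r f. n < r \<and> f \<in> dist_space \<and> real (Suc n) * supnorm (id_minus (Kr r) f) < supnorm f" for n
  proof (rule ccontr)
    assume none: "\<not> ?thesis"
    have "supnorm f \<le> real (Suc n) * supnorm (id_minus (Kr r) f)" if "n < r" "f \<in> dist_space" for r f
      using none that by (blast intro: leI)
    moreover have "0 \<le> real (Suc n)" by simp
    ultimately show False using neg by blast
  qed
  then obtain r f where rf: "\<And>n. n < r n" "\<And>n. f n \<in> dist_space"
    "\<And>n. real (Suc n) * supnorm (id_minus (Kr (r n)) (f n)) < supnorm (f n)"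
    by metis
  define s where "s n = supnorm (f n)" for n
  define g where "g n = (\<lambda>x. (1 / s n) * f n x)" for n
  have idd: "id_minus (Kr (r n)) (f n) \<in> dist_space" for n by (rule G.id_minus_dist_space[OF rf(2)])
  have s: "s n > 0" for n
  proof -
    have "0 \<le> real (Suc n) * supnorm (id_minus (Kr (r n)) (f n))"
      by (intro mult_nonneg_nonneg supnorm_nonneg idd) simp
    then show ?thesis using rf(3)[of n] unfolding s_def by linarith
  qed
  have gd: "g n \<in> dist_space" for n unfolding g_def by (rule dist_space_scale[OF rf(2)])
  have g1: "\<bar>g n x\<bar> \<le> 1" for n x
    using dist_space_supnorm[OF rf(2), of n x] s[of n] by (simp add: g_def s_def abs_mult)
  have small: "\<bar>g n x - Kr (r n) (g n) x\<bar> \<le> 1 / real (Suc n)" for n x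
  proof -
    have "\<bar>g n x - Kr (r n) (g n) x\<bar> = \<bar>id_minus (Kr (r n)) (g n) x\<bar>" by (simp add: id_minus_def)
    also have "\<dots> = (1 / s n) * \<bar>id_minus (Kr (r n)) (f n) x\<bar>"
      unfolding g_def id_minus_Kr_scale[OF rf(2)] using s[of n] by (simp add: abs_mult)
    also have "\<dots> \<le> (1 / s n) * (s n / real (Suc n))"
    proof (rule mult_left_mono)
      have "supnorm (id_minus (Kr (r n)) (f n)) \<le> s n / real (Suc n)"
        using rf(3)[of n] by (simp add: s_def field_simps)
      then show "\<bar>id_minus (Kr (r n)) (f n) x\<bar> \<le> s n / real (Suc n)"
        using dist_space_supnorm[OF idd, of n x] by linarith
    qed (use s[of n] in simp)
    also have "\<dots> = 1 / real (Suc n)" using s[of n] by simp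
    finally show ?thesis .
  qed
  have rn: "n \<le> r n" for n using rf(1)[of n] by simp
  obtain k h where k: "strict_mono k"
    and h: "uniform_limit UNIV (\<lambda>n. Kr (r (k n)) (g (k n))) h sequentially"
    by (rule Kr_collectively_compact[OF rn gd g1])
  have diff: "uniform_limit UNIV (\<lambda>n x. g (k n) x - Kr (r (k n)) (g (k n)) x) (\<lambda>_. 0) sequentially"
    unfolding uniform_limit_iff
  proof (intro allI impI)
    fix e :: real assume "e > 0"
    have "(\<lambda>n. 1 / real (Suc n)) \<longlonglongrightarrow> 0" using LIMSEQ_inverse_real_of_nat by (simp add: inverse_eq_divide)
    then have "\<forall>\<^sub>F n in sequentially. 1 / real (Suc n) < e"
      using \<open>e > 0\<close> by (intro order_tendstoD(2)) auto
    then show "\<forall>\<^sub>F n in sequentially. \<forall>x\<in>UNIV. dist (g (k n) x - Kr (r (k n)) (g (k n)) x) 0 < e"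
    proof eventually_elim
      case (elim n)
      have "1 / real (Suc (k n)) \<le> 1 / real (Suc n)" using seq_suble[OF k, of n] by (simp add: frac_le)
      then show ?case using small[of "k n"] elim by (auto simp: dist_real_def intro: le_less_trans order_trans)
    qed
  qed
  \<comment> \<open>\<open>g\<close> is the vanishing defect plus its image, so compactness of the
    images makes \<open>g\<close> itself converge.\<close>
  have gh: "uniform_limit UNIV (\<lambda>n. g (k n)) h sequentially"
    using uniform_limit_lincomb[OF diff h, of 1 1] by simp
  have hd: "h \<in> dist_space" by (rule dist_space_limit[OF _ gh]) (rule gd)
  have "h x = K h x" for x
  proof -
    have rk: "filterlim (\<lambda>n. r (k n)) at_top sequentially"
    proof (rule filterlim_at_top_mono[OF filterlim_ident])
      show "\<forall>\<^sub>F n in sequentially. n \<le> r (k n)"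
        using order_trans[OF seq_suble[OF k] rn] by (intro always_eventually) blast
    qed
    have "(\<lambda>n. Kr (r (k n)) h x) \<longlonglongrightarrow> K h x" by (rule filterlim_compose[OF Kr_tendsto[OF hd] rk])
    moreover have "(\<lambda>n. Kr (r (k n)) (g (k n)) x) \<longlonglongrightarrow> h x" using tendsto_uniform_limitI[OF h] by simp
    ultimately have lim0: "(\<lambda>n. \<bar>Kr (r (k n)) (g (k n)) x - Kr (r (k n)) h x\<bar>) \<longlonglongrightarrow> \<bar>h x - K h x\<bar>"
      by (intro tendsto_intros)
    \<comment> \<open>The uniform bound on the operators makes them negligible on
      \<open>g - h\<close>; hence the limit \<open>h\<close> of the images of \<open>g\<close>
      agrees with the limit \<open>K h\<close> of the images of \<open>h\<close>.\<close>
    have le: "\<bar>h x - K h x\<bar> \<le> (2 + 3 * V) * e" if e: "e > 0" for e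
    proof (rule tendsto_upperbound[OF lim0])
      show "\<forall>\<^sub>F n in sequentially. \<bar>Kr (r (k n)) (g (k n)) x - Kr (r (k n)) h x\<bar> \<le> (2 + 3 * V) * e"
        using uniform_limitD[OF gh e]
      proof eventually_elim
        case (elim n)
        have "\<bar>Kr (r (k n)) (\<lambda>x. 1 * g (k n) x + (-1) * h x) x\<bar> \<le> (2 + 3 * V) * e"
          by (rule Kr_bound[OF dist_space_lincomb[OF gd hd]]) (use elim in \<open>auto simp: dist_real_def less_imp_le\<close>)
        then show ?case unfolding shifted_lincomb[OF G.regular_chain_kernel gd hd] by simp
      qed
    qed simp
    have "\<not> \<bar>h x - K h x\<bar> > 0"
    proof
      assume pos: "\<bar>h x - K h x\<bar> > 0"
      define C where "C = 2 + 3 * V"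
      have C: "C > 0" using V_nonneg by (simp add: C_def)
      have "\<bar>h x - K h x\<bar> / (2 * C) > 0" using pos C by (intro divide_pos_pos) auto
      from le[OF this] have "\<bar>h x - K h x\<bar> \<le> C * (\<bar>h x - K h x\<bar> / (2 * C))" by (simp add: C_def)
      also have "\<dots> = \<bar>h x - K h x\<bar> / 2" using C by simp
      finally show False using pos by simp
    qed
    then show ?thesis by simp
  qed
  then have "h = (\<lambda>_. 0)" by (rule inj[OF hd])
  then have "\<forall>\<^sub>F n in sequentially. \<forall>x\<in>UNIV. dist (g (k n) x) 0 < 1 / 2"
    using uniform_limitD[OF gh, of "1/2"] by simp
  then obtain n where n: "\<And>x. \<bar>g (k n) x\<bar> < 1 / 2" unfolding eventually_sequentially by (auto simp: dist_real_def)
  \<comment> \<open>If \<open>h\<close> vanishes, some normalised \<open>g (k n)\<close> is below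
    1/2 everywhere, so \<open>f (k n)\<close> would have at most half its own norm.\<close>
  have "supnorm (f (k n)) \<le> s (k n) / 2"
  proof (rule supnorm_least)
    fix x
    show "\<bar>f (k n) x\<bar> \<le> s (k n) / 2" using n[of x] s[of "k n"] by (simp add: g_def abs_mult field_simps)
  qed
  then show False using s[of "k n"] by (simp add: s_def)
qed

end

section \<open>The error bound and its convergence\<close>

theorem theorem3:
  fixes \<kappa> :: "real \<Rightarrow> real \<Rightarrow> real" and p :: "real \<Rightarrow> real"
    and J :: "nat \<Rightarrow> nat" and c :: "nat \<Rightarrow> nat \<Rightarrow> real" and q :: "nat \<Rightarrow> nat \<Rightarrow> nat \<Rightarrow> real"
    and pr :: "nat \<Rightarrow> real \<Rightarrow> real"
  defines "K \<equiv> kernel_op (shifted_kernel \<kappa>)"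
    and "Kr \<equiv> \<lambda>r. kernel_op (shifted_chain_kernel (J r) (c r) (q r))"
  defines "R \<equiv> \<lambda>r. the_inv_into dist_space (id_minus (Kr r))"
  defines "bnd \<equiv> \<lambda>r. opnorm (R r) * supnorm (\<lambda>x. K p x - Kr r p x)"
  assumes "markov_kernel \<kappa>"
    and "stationary_dist \<kappa> p"
    and "uniformly_bounded_variation \<kappa>"
    and "cadlag_countable_jumps \<kappa>"
    and "unique_stationary_dist \<kappa> p"
    and "\<And>r. finite_chain (J r) (c r) (q r)"
    and "\<And>r. chain_stationary_dist (J r) (c r) (q r) (pr r)"
    and "proper_truncation \<kappa> J c q"
  shows "(\<exists>r0. \<forall>r>r0.
            (\<forall>f. chain_stationary_dist (J r) (c r) (q r) f \<longleftrightarrow> f = pr r) \<and>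
            (\<forall>f. stationary_dist (chain_kernel (J r) (c r) (q r)) f \<longleftrightarrow> f = pr r) \<and>
            bij_betw (id_minus (Kr r)) dist_space dist_space \<and>
            bounded_on_dist_space (R r) \<and>
            supnorm (\<lambda>x. p x - pr r x) \<le> bnd r) \<and>
         bnd \<longlonglongrightarrow> 0 \<and>
         uniform_limit UNIV pr p sequentially"
proof -
  \<comment> \<open>Nonnegativity excludes \<open>-\<infinity>\<close>, so the finite supremum is a
    real number \<open>V\<close>.\<close>
  have "0 \<le> (SUP x\<in>{0..1}. variation (\<kappa> x))"
    by (rule order_trans[OF variation_nonneg[of "\<kappa> 0"]]) (rule SUP_upper, simp)
  then obtain V where V: "(SUP x\<in>{0..1}. variation (\<kappa> x)) = ereal V"
    using assms(7) unfolding uniformly_bounded_variation_def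
    by (cases "SUP x\<in>{0..1}. variation (\<kappa> x)") auto
  have reg: "regular_kernel \<kappa> V"
    by (rule regular_markov_kernel[OF assms(5)]) (unfold V[symmetric], rule SUP_upper)
  obtain \<epsilon> where \<epsilon>: "\<forall>r. 0 \<le> \<epsilon> r" "\<epsilon> \<longlonglongrightarrow> 0" "\<forall>r. \<forall>i\<in>{1..J r}. \<forall>x1\<in>{0..1}. \<forall>x2\<in>{0..1}.
           ereal x1 \<in> {ext_state (J r) (c r) i..<ext_state (J r) (c r) (i + 1)} \<and>
           ereal x2 \<in> {ext_state (J r) (c r) i..<ext_state (J r) (c r) (i + 1)} \<longrightarrow>
           kernel_zeta \<kappa> x1 x2 < \<epsilon> r \<and> kernel_var \<kappa> x1 x2 < ereal (\<epsilon> r)"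
    using assms(12) unfolding proper_truncation_def by (elim conjE exE) (rule that)
  interpret T: chain_truncation \<kappa> V J c q \<epsilon>
  proof
    show "regular_kernel \<kappa> V" by (rule reg)
    show "finite_chain (J r) (c r) (q r)" for r by (rule assms(10))
    show "0 \<le> \<epsilon> r" for r using \<epsilon>(1) by blast
    show "\<epsilon> \<longlonglongrightarrow> 0" by (rule \<epsilon>(2))
  next
    fix r i x1 x2
    assume "i \<in> {1..J r}" "x1 \<in> {0..1}" "x2 \<in> {0..1}"
      "ereal x1 \<in> {ext_state (J r) (c r) i..<ext_state (J r) (c r) (i + 1)}"
      "ereal x2 \<in> {ext_state (J r) (c r) i..<ext_state (J r) (c r) (i + 1)}"
    then show "kernel_zeta \<kappa> x1 x2 < \<epsilon> r \<and> kernel_var \<kappa> x1 x2 < ereal (\<epsilon> r)" using \<epsilon>(3) by blast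
  next
    show "c r1 ` {1..J r1} \<subseteq> c r2 ` {1..J r2}" if "r1 < r2" for r1 r2
      using assms(12) that unfolding proper_truncation_def by blast
    show "q r i j = ext_kernel \<kappa> (ext_state (J r) (c r) j) (c r i)
              - ext_kernel \<kappa> (ext_state (J r) (c r) (j - 1)) (c r i)"
      if "i \<in> {1..J r}" "j \<in> {1..J r}" for r i j
      using assms(12) that unfolding proper_truncation_def by blast
    show "(\<lambda>r. chain_kernel (J r) (c r) (q r) x u) \<longlonglongrightarrow> \<kappa> x u" if "x \<in> {0..1}" "u \<in> {0..1}" for x u
      using assms(12) that unfolding proper_truncation_def by blast
  qed
  have Kr: "Kr r = T.Kr r" for r unfolding Kr_def by (rule T.G.shifted_chain_kernel_op)
  have p: "p \<in> dist_funs" using assms(6) by (simp add: stationary_dist_def)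
  note pd = dist_funs_dist_space[OF p]
  have Kp: "K p x = p x + of_bool (x \<ge> 0)" for x
    using stationary_iff_shifted[OF reg p] assms(6) by (simp add: K_def)
  \<comment> \<open>A fixed point of the shifted operator is a multiple of \<open>p\<close> by the
    uniqueness condition and has mass 0; since \<open>p 1 = 1\<close>, the factor is 0.\<close>
  have injK: "f = (\<lambda>_. 0)" if f: "f \<in> dist_space" "\<And>x. f x = T.K f x" for f
  proof -
    have "f x = kernel_op \<kappa> f x" for x by (rule shifted_fixed_point(2)[OF reg f])
    then have "f \<in> {f \<in> dist_space. \<forall>x\<in>{0..1}. f x = kernel_op \<kappa> f x}" using f(1) by blast
    then obtain \<alpha> where \<alpha>: "f = (\<lambda>x. \<alpha> * p x)"
      using assms(9) unfolding unique_stationary_dist_def by blast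
    moreover have "f 1 = 0" by (rule shifted_fixed_point(1)[OF reg f])
    ultimately show ?thesis using dist_funs_props(2)[OF p, of 1] by simp
  qed
  obtain r0 M where M: "0 \<le> M"
    "\<And>r f. r > r0 \<Longrightarrow> f \<in> dist_space \<Longrightarrow> supnorm f \<le> M * supnorm (id_minus (T.Kr r) f)"
    using T.id_minus_Kr_lower_bound[OF injK] by blast
  have injKr: "f = (\<lambda>_. 0)" if "r > r0" "f \<in> dist_space" "f = T.Kr r f" for r f
  proof -
    have "id_minus (T.Kr r) f = (\<lambda>_. 0)" using fun_cong[OF that(3)] by (simp add: id_minus_def)
    then show ?thesis using supnorm_le_zero[OF that(2)] M(2)[OF that(1,2)] supnorm_zero by simp
  qed
  have bij: "bij_betw (id_minus (Kr r)) dist_space dist_space" if "r > r0" for r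
    unfolding Kr by (rule T.G.id_minus_bij) (rule injKr[OF that])
  have inv: "bounded_on_dist_space (R r)" "opnorm (R r) \<le> M" "0 \<le> opnorm (R r)"
    "\<And>f. f \<in> dist_space \<Longrightarrow> supnorm f \<le> opnorm (R r) * supnorm (id_minus (Kr r) f)" if r: "r > r0" for r
  proof -
    have hom: "id_minus (Kr r) (\<lambda>x. a * f x) = (\<lambda>x. a * id_minus (Kr r) f x)"
      if "f \<in> dist_space" for a f
      unfolding Kr by (rule T.id_minus_Kr_scale[OF that])
    have lower: "supnorm f \<le> M * supnorm (id_minus (Kr r) f)" if "f \<in> dist_space" for f
      unfolding Kr by (rule M(2)[OF r that])
    note b = inverse_bounds[where T="id_minus (Kr r)" and M=M, OF bij[OF r]]
    show "bounded_on_dist_space (R r)" unfolding R_def by (rule b(1)) (rule hom lower M(1); assumption?)+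
    show "opnorm (R r) \<le> M" unfolding R_def by (rule b(2)) (rule hom lower M(1); assumption?)+
    show "0 \<le> opnorm (R r)" unfolding R_def by (rule b(3)) (rule hom lower M(1); assumption?)+
    show "supnorm f \<le> opnorm (R r) * supnorm (id_minus (Kr r) f)" if "f \<in> dist_space" for f
      unfolding R_def by (rule b(4)[OF _ _ _ that]) (rule hom lower M(1); assumption?)+
  qed
  have pr: "pr r \<in> dist_funs" "stationary_dist (chain_kernel (J r) (c r) (q r)) (pr r)" for r
    using T.G.chain_stationary_stationary[OF assms(11)[of r]] by (auto simp: stationary_dist_def)
  have Krpr: "Kr r (pr r) x = pr r x + of_bool (x \<ge> 0)" for r x
    unfolding Kr using stationary_iff_shifted[OF T.G.regular_chain_kernel pr(1)] pr(2) by blast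
  have uniq: "f = pr r" if "r > r0" "stationary_dist (chain_kernel (J r) (c r) (q r)) f" for r f
    by (rule T.G.stationary_unique[OF _ that(2) pr(2)]) (rule injKr[OF that(1)])
  \<comment> \<open>The terms \<open>of_bool (x \<ge> 0)\<close> in the equations for
    \<open>p\<close> and \<open>pr r\<close> cancel.\<close>
  have diff: "id_minus (Kr r) (\<lambda>x. p x - pr r x) = (\<lambda>x. K p x - Kr r p x)" for r
  proof
    fix x
    have "Kr r (\<lambda>x. 1 * p x + (-1) * pr r x) x = 1 * Kr r p x + (-1) * Kr r (pr r) x"
      unfolding Kr by (rule shifted_lincomb[OF T.G.regular_chain_kernel pd dist_funs_dist_space[OF pr(1)]])
    then show "id_minus (Kr r) (\<lambda>x. p x - pr r x) x = K p x - Kr r p x"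
      using Krpr[of r x] Kp[of x] by (simp add: id_minus_def)
  qed
  have dd: "(\<lambda>x. p x - pr r x) \<in> dist_space" for r
    by (rule dist_space_diff[OF pd dist_funs_dist_space[OF pr(1)]])
  have err: "supnorm (\<lambda>x. p x - pr r x) \<le> bnd r" if "r > r0" for r
    unfolding bnd_def diff[symmetric] by (rule inv(4)[OF that dd])
  have sup0: "(\<lambda>r. supnorm (\<lambda>x. K p x - Kr r p x)) \<longlonglongrightarrow> 0"
  proof (rule tendstoI)
    fix e :: real assume e: "e > 0"
    then have e2: "e / 2 > 0" by simp
    show "\<forall>\<^sub>F r in sequentially. dist (supnorm (\<lambda>x. K p x - Kr r p x)) 0 < e"
      using uniform_limitD[OF T.Kr_uniform_limit[OF pd] e2]
    proof eventually_elim
      case (elim r)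
      have b: "\<bar>K p x - Kr r p x\<bar> \<le> e / 2" for x
        using elim unfolding K_def Kr by (auto simp: dist_real_def abs_minus_commute less_imp_le)
      have "supnorm (\<lambda>x. K p x - Kr r p x) \<le> e / 2" by (rule supnorm_least[OF b])
      moreover have "0 \<le> supnorm (\<lambda>x. K p x - Kr r p x)"
        using supnorm_upper[of "\<lambda>x. K p x - Kr r p x" "e / 2" 0] b by fastforce
      ultimately show ?case using e by simp
    qed
  qed
  have supd: "0 \<le> supnorm (\<lambda>x. K p x - Kr r p x)" for r
    unfolding diff[symmetric] by (rule supnorm_nonneg, unfold Kr, rule T.G.id_minus_dist_space[OF dd])
  \<comment> \<open>The inverses are bounded by the common \<open>M\<close> beyond
    \<open>r0\<close>, so the bound inherits the convergence of the residual
    \<open>K p - Kr r p\<close>.\<close>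
  have bnd0: "bnd \<longlonglongrightarrow> 0"
  proof (rule tendsto_sandwich)
    show "\<forall>\<^sub>F r in sequentially. 0 \<le> bnd r"
      unfolding bnd_def using eventually_gt_at_top[of r0]
      by eventually_elim (intro mult_nonneg_nonneg inv(3) supd, auto)
    show "\<forall>\<^sub>F r in sequentially. bnd r \<le> M * supnorm (\<lambda>x. K p x - Kr r p x)"
      unfolding bnd_def using eventually_gt_at_top[of r0]
      by eventually_elim (intro mult_right_mono inv(2) supd, auto)
    show "(\<lambda>r. M * supnorm (\<lambda>x. K p x - Kr r p x)) \<longlonglongrightarrow> 0"
      using tendsto_mult_left[OF sup0, of M] by simp
  qed simp
  have "uniform_limit UNIV pr p sequentially"
    unfolding uniform_limit_iff
  proof (intro allI impI)
    fix e :: real assume "e > 0"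
    then have "\<forall>\<^sub>F r in sequentially. bnd r < e" using bnd0 by (intro order_tendstoD(2)) auto
    then show "\<forall>\<^sub>F r in sequentially. \<forall>x\<in>UNIV. dist (pr r x) (p x) < e"
      using eventually_gt_at_top[of r0]
    proof eventually_elim
      case (elim r)
      then have "\<bar>p x - pr r x\<bar> < e" for x using dist_space_supnorm[OF dd, of x r] err[of r] by linarith
      then show ?case by (simp add: dist_real_def abs_minus_commute)
    qed
  qed
  moreover have "(\<forall>f. chain_stationary_dist (J r) (c r) (q r) f \<longleftrightarrow> f = pr r) \<and>
      (\<forall>f. stationary_dist (chain_kernel (J r) (c r) (q r)) f \<longleftrightarrow> f = pr r) \<and>
      bij_betw (id_minus (Kr r)) dist_space dist_space \<and> bounded_on_dist_space (R r) \<and>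
      supnorm (\<lambda>x. p x - pr r x) \<le> bnd r" if r: "r > r0" for r
  proof (intro conjI allI)
    fix f
    show "chain_stationary_dist (J r) (c r) (q r) f \<longleftrightarrow> f = pr r"
      using uniq[OF r T.G.chain_stationary_stationary] assms(11) by blast
    show "stationary_dist (chain_kernel (J r) (c r) (q r)) f \<longleftrightarrow> f = pr r"
      using uniq[OF r] pr(2) by blast
  next
    show "bij_betw (id_minus (Kr r)) dist_space dist_space" by (rule bij[OF r])
    show "bounded_on_dist_space (R r)" by (rule inv(1)[OF r])
    show "supnorm (\<lambda>x. p x - pr r x) \<le> bnd r" by (rule err[OF r])
  qed
  ultimately show ?thesis using bnd0 by blast
qed

end
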